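(* The functor $\widehat{(-)}:Set^{\mathbb S}\to\mathbf{End}$ is faithful, full on isomorphisms, and its essential image is the category $\mathbf{San}$ of semi-analytic functors and semi-cartesian natural transformations.
   Context: Notation: $(n]=\{1,\dots,n\}$ for $n\in\omega=\{0,1,2,\dots\}$. $\mathbb S$ is the category with objects $(n]$, $n\in\omega$, and surjections as morphisms. $\mathbf{End}$ is the category of finitary endofunctors of $Set$ and all natural transformations. For a set $X$, $\left[{X\atop n}\right]$ is the set of injections $(n]\to X$, on which the symmetric group $S_n$ acts on the right by composition. For $A:\mathbb S\to Set$ write $A_n=A((n])$, with left $S_n$-action, and let $\left[{X\atop n}\right]\otimes_n A_n$ be the quotient of $\left[{X\atop n}\right]\times A_n$ by $(\vec x\circ\sigma,a)\sim(\vec x,A(\sigma)(a))$, $\sigma\in S_n$; classes are written $[\vec x,a]$. Put $\hat A(X)=\sum_{n\in\omega}\left[{X\atop n}\right]\otimes_nA_n$. For $f:X\to Y$, $\hat A(f)([\vec x,a])=[\vec y,A(\alpha)(a)]$, where $f\circ\vec x=\vec y\circ\alpha$ with $\alpha:(n]\to(m]$ surjective and $\vec y:(m]\to Y$ injective. For a natural transformation $\tau:A\to B$, $\hat\tau_X([\vec x,a])=[\vec x,\tau_n(a)]$. A functor $Set\to Set$ is semi-analytic if it is finitary and preserves pullbacks along monomorphisms. A natural transformation is semi-cartesian if its naturality squares for monomorphisms are pullbacks. $\mathbf{San}$ is the (non-full) subcategory of $\mathbf{End}$ of semi-analytic functors and semi-cartesian natural transformations. The essential image of a functor is the subcategory of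 the target consisting of objects isomorphic to values of the functor and morphisms that, up to composition with isomorphisms, are values of the functor; full on isomorphisms means every isomorphism $\hat A\to\hat B$ is of the form $\hat\tau$. *)

theory Defs
  imports Main "HOL-Library.FuncSet"
begin

section \<open>Categories, functors, natural transformations\<close>

record ('o, 'm) cat =
  Obj :: "'o set"
  Arr :: "'m set"
  Dom :: "'m \<Rightarrow> 'o"
  Cod :: "'m \<Rightarrow> 'o"
  Ide :: "'o \<Rightarrow> 'm"
  Comp :: "'m \<Rightarrow> 'm \<Rightarrow> 'm"  (infixr "\<cdot>\<index>" 70)

definition Hom :: "('o, 'm) cat \<Rightarrow> 'o \<Rightarrow> 'o \<Rightarrow> 'm set" where
  "Hom C a b = {f \<in> Arr C. Dom C f = a \<and> Cod C f = b}"

locale category =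
  fixes C :: "('o, 'm) cat"
  assumes Dom_in_Obj: "f \<in> Arr C \<Longrightarrow> Dom C f \<in> Obj C"
    and Cod_in_Obj: "f \<in> Arr C \<Longrightarrow> Cod C f \<in> Obj C"
    and Ide_in_Hom: "a \<in> Obj C \<Longrightarrow> Ide C a \<in> Hom C a a"
    and Comp_in_Hom: "f \<in> Hom C a b \<Longrightarrow> g \<in> Hom C b c \<Longrightarrow> g \<cdot>\<^bsub>C\<^esub> f \<in> Hom C a c"
    and Comp_Ide: "f \<in> Hom C a b \<Longrightarrow> f \<cdot>\<^bsub>C\<^esub> Ide C a = f"
    and Ide_Comp: "f \<in> Hom C a b \<Longrightarrow> Ide C b \<cdot>\<^bsub>C\<^esub> f = f"
    and Comp_assoc: "f \<in> Hom C a b \<Longrightarrow> g \<in> Hom C b c \<Longrightarrow> h \<in> Hom C c d \<Longrightarrow>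
          (h \<cdot>\<^bsub>C\<^esub> g) \<cdot>\<^bsub>C\<^esub> f = h \<cdot>\<^bsub>C\<^esub> (g \<cdot>\<^bsub>C\<^esub> f)"

definition is_iso :: "('o, 'm) cat \<Rightarrow> 'm \<Rightarrow> bool" where
  "is_iso C f \<longleftrightarrow> f \<in> Arr C \<and>
     (\<exists>g \<in> Hom C (Cod C f) (Dom C f).
        g \<cdot>\<^bsub>C\<^esub> f = Ide C (Dom C f) \<and> f \<cdot>\<^bsub>C\<^esub> g = Ide C (Cod C f))"

definition is_mono :: "('o, 'm) cat \<Rightarrow> 'm \<Rightarrow> bool" where
  "is_mono C m \<longleftrightarrow> m \<in> Arr C \<and>
     (\<forall>a \<in> Obj C. \<forall>g \<in> Hom C a (Dom C m). \<forall>h \<in> Hom C a (Dom C m).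
        m \<cdot>\<^bsub>C\<^esub> g = m \<cdot>\<^bsub>C\<^esub> h \<longrightarrow> g = h)"

text \<open>\<open>is_pullback C p q f g\<close>: the square \<open>f \<cdot> p = g \<cdot> q\<close> is a pullback of the cospan \<open>f\<close>, \<open>g\<close>.\<close>

definition is_pullback :: "('o, 'm) cat \<Rightarrow> 'm \<Rightarrow> 'm \<Rightarrow> 'm \<Rightarrow> 'm \<Rightarrow> bool" where
  "is_pullback C p q f g \<longleftrightarrow>
     (\<exists>w \<in> Obj C. \<exists>x \<in> Obj C. \<exists>y \<in> Obj C. \<exists>z \<in> Obj C.
        p \<in> Hom C w x \<and> q \<in> Hom C w y \<and> f \<in> Hom C x z \<and> g \<in> Hom C y z \<and>
        f \<cdot>\<^bsub>C\<^esub> p = g \<cdot>\<^bsub>C\<^esub> q \<and>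
        (\<forall>v \<in> Obj C. \<forall>r \<in> Hom C v x. \<forall>s \<in> Hom C v y.
           f \<cdot>\<^bsub>C\<^esub> r = g \<cdot>\<^bsub>C\<^esub> s \<longrightarrow>
           (\<exists>!h. h \<in> Hom C v w \<and> p \<cdot>\<^bsub>C\<^esub> h = r \<and> q \<cdot>\<^bsub>C\<^esub> h = s)))"

record ('o1, 'm1, 'o2, 'm2) func =
  FObj :: "'o1 \<Rightarrow> 'o2"
  FArr :: "'m1 \<Rightarrow> 'm2"

text \<open>The extensionality conditions make equality of records coincide with equality of functors.\<close>

locale is_functor = C: category C + D: category D
  for C :: "('o1, 'm1) cat" and D :: "('o2, 'm2) cat" +
  fixes F :: "('o1, 'm1, 'o2, 'm2) func"
  assumes FObj_in_Obj: "a \<in> Obj C \<Longrightarrow> FObj F a \<in> Obj D"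
    and FArr_in_Hom: "f \<in> Hom C a b \<Longrightarrow> FArr F f \<in> Hom D (FObj F a) (FObj F b)"
    and FArr_Ide: "a \<in> Obj C \<Longrightarrow> FArr F (Ide C a) = Ide D (FObj F a)"
    and FArr_Comp: "f \<in> Hom C a b \<Longrightarrow> g \<in> Hom C b c \<Longrightarrow>
          FArr F (g \<cdot>\<^bsub>C\<^esub> f) = FArr F g \<cdot>\<^bsub>D\<^esub> FArr F f"
    and FObj_extensional: "FObj F \<in> extensional (Obj C)"
    and FArr_extensional: "FArr F \<in> extensional (Arr C)"

definition func_comp ::
  "('o1, 'm1) cat \<Rightarrow> ('o2, 'm2, 'o3, 'm3) func \<Rightarrow> ('o1, 'm1, 'o2, 'm2) func \<Rightarrow>
   ('o1, 'm1, 'o3, 'm3) func" where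
  "func_comp J G F =
     \<lparr>FObj = compose (Obj J) (FObj G) (FObj F), FArr = compose (Arr J) (FArr G) (FArr F)\<rparr>"

definition is_nat_trans ::
  "('o1, 'm1) cat \<Rightarrow> ('o2, 'm2) cat \<Rightarrow> ('o1, 'm1, 'o2, 'm2) func \<Rightarrow>
   ('o1, 'm1, 'o2, 'm2) func \<Rightarrow> ('o1 \<Rightarrow> 'm2) \<Rightarrow> bool" where
  "is_nat_trans C D F G t \<longleftrightarrow> is_functor C D F \<and> is_functor C D G \<and>
     t \<in> extensional (Obj C) \<and>
     (\<forall>a \<in> Obj C. t a \<in> Hom D (FObj F a) (FObj G a)) \<and>
     (\<forall>f \<in> Arr C. t (Cod C f) \<cdot>\<^bsub>D\<^esub> FArr F f = FArr G f \<cdot>\<^bsub>D\<^esub> t (Dom C f))"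

text \<open>Arrows in the concrete categories below carry their domain and codomain.\<close>

datatype ('o, 't) arrow = Arrow (src: 'o) (tgt: 'o) (body: 't)

type_synonym ('o1, 'm1, 'o2, 'm2) ntrans =
  "(('o1, 'm1, 'o2, 'm2) func, 'o1 \<Rightarrow> 'm2) arrow"

definition functor_category ::
  "('o1, 'm1) cat \<Rightarrow> ('o2, 'm2) cat \<Rightarrow>
   (('o1, 'm1, 'o2, 'm2) func, ('o1, 'm1, 'o2, 'm2) ntrans) cat" where
  "functor_category C D =
     \<lparr>Obj = {F. is_functor C D F},
      Arr = {t. is_nat_trans C D (src t) (tgt t) (body t)},
      Dom = src,
      Cod = tgt,
      Ide = (\<lambda>F. Arrow F F (\<lambda>a\<in>Obj C. Ide D (FObj F a))),
      Comp = (\<lambda>t s. Arrow (src s) (tgt t) (\<lambda>a\<in>Obj C. body t a \<cdot>\<^bsub>D\<^esub> body s a))\<rparr>"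

definition faithful ::
  "('o1, 'm1) cat \<Rightarrow> ('o1, 'm1, 'o2, 'm2) func \<Rightarrow> bool" where
  "faithful C F \<longleftrightarrow>
     (\<forall>a \<in> Obj C. \<forall>b \<in> Obj C. inj_on (FArr F) (Hom C a b))"

definition full_on_isos ::
  "('o1, 'm1) cat \<Rightarrow> ('o2, 'm2) cat \<Rightarrow> ('o1, 'm1, 'o2, 'm2) func \<Rightarrow> bool" where
  "full_on_isos C D F \<longleftrightarrow>
     (\<forall>a \<in> Obj C. \<forall>b \<in> Obj C. \<forall>g \<in> Hom D (FObj F a) (FObj F b).
        is_iso D g \<longrightarrow> (\<exists>f \<in> Hom C a b. FArr F f = g))"

definition essential_image ::
  "('o1, 'm1) cat \<Rightarrow> ('o2, 'm2) cat \<Rightarrow> ('o1, 'm1, 'o2, 'm2) func \<Rightarrow> ('o2, 'm2) cat" where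
  "essential_image C D F = D
     \<lparr>Obj := {d \<in> Obj D. \<exists>a \<in> Obj C. \<exists>i \<in> Hom D (FObj F a) d. is_iso D i},
      Arr := {g \<in> Arr D. \<exists>a \<in> Obj C. \<exists>b \<in> Obj C. \<exists>f \<in> Hom C a b.
                \<exists>i \<in> Hom D (Dom D g) (FObj F a). \<exists>j \<in> Hom D (FObj F b) (Cod D g).
                  is_iso D i \<and> is_iso D j \<and> g = j \<cdot>\<^bsub>D\<^esub> FArr F f \<cdot>\<^bsub>D\<^esub> i}\<rparr>"


section \<open>Filtered colimits\<close>

definition is_cocone ::
  "('j, 'k) cat \<Rightarrow> ('o, 'm) cat \<Rightarrow> ('j, 'k, 'o, 'm) func \<Rightarrow> 'o \<Rightarrow> ('j \<Rightarrow> 'm) \<Rightarrow> bool" where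
  "is_cocone J C D c \<iota> \<longleftrightarrow> c \<in> Obj C \<and>
     (\<forall>j \<in> Obj J. \<iota> j \<in> Hom C (FObj D j) c) \<and>
     (\<forall>u \<in> Arr J. \<iota> (Cod J u) \<cdot>\<^bsub>C\<^esub> FArr D u = \<iota> (Dom J u))"

definition is_colimit ::
  "('j, 'k) cat \<Rightarrow> ('o, 'm) cat \<Rightarrow> ('j, 'k, 'o, 'm) func \<Rightarrow> 'o \<Rightarrow> ('j \<Rightarrow> 'm) \<Rightarrow> bool" where
  "is_colimit J C D c \<iota> \<longleftrightarrow> is_cocone J C D c \<iota> \<and>
     (\<forall>d \<kappa>. is_cocone J C D d \<kappa> \<longrightarrow>
        (\<exists>!h. h \<in> Hom C c d \<and> (\<forall>j \<in> Obj J. h \<cdot>\<^bsub>C\<^esub> \<iota> j = \<kappa> j)))"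

definition is_filtered :: "('j, 'k) cat \<Rightarrow> bool" where
  "is_filtered J \<longleftrightarrow> category J \<and> Obj J \<noteq> {} \<and>
     (\<forall>a \<in> Obj J. \<forall>b \<in> Obj J. \<exists>c \<in> Obj J. Hom J a c \<noteq> {} \<and> Hom J b c \<noteq> {}) \<and>
     (\<forall>a \<in> Obj J. \<forall>b \<in> Obj J. \<forall>f \<in> Hom J a b. \<forall>g \<in> Hom J a b.
        \<exists>c \<in> Obj J. \<exists>h \<in> Hom J b c. h \<cdot>\<^bsub>J\<^esub> f = h \<cdot>\<^bsub>J\<^esub> g)"


section \<open>The category of sets\<close>

text \<open>
  HOL has no type of all sets, so \<open>Set\<close> is the category of small subsets of a type \<open>'u\<close>, for a
  notion of smallness satisfying replacement, union and infinity. Power sets are not needed and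
  are not required to be small. Grothendieck universes (the subsets of \<open>'u\<close> of cardinality below
  an uncountable strongly inaccessible \<open>\<kappa> \<le> |'u|\<close>) are instances; so are all subsets of an infinite
  type, and all subsets of cardinality below an uncountable regular cardinal \<open>\<kappa> \<le> |'u|\<close>.
\<close>

locale set_universe =
  fixes small :: "'u set \<Rightarrow> bool"
  assumes small_image: "small X \<Longrightarrow> Y \<subseteq> f ` X \<Longrightarrow> small Y"
    and small_UN: "small I \<Longrightarrow> (\<And>i. i \<in> I \<Longrightarrow> small (K i)) \<Longrightarrow> small (\<Union>i\<in>I. K i)"
    and small_infinite: "\<exists>X. infinite X \<and> small X"

lemma (in set_universe) infinite_UNIV_universe: "infinite (UNIV :: 'u set)"
  using small_infinite by (metis infinite_super subset_UNIV)

type_synonym 'u setarr = "('u set, 'u \<Rightarrow> 'u) arrow"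

definition Sets :: "('u set \<Rightarrow> bool) \<Rightarrow> ('u set, 'u setarr) cat" where
  "Sets small =
     \<lparr>Obj = {X. small X},
      Arr = {f. small (src f) \<and> small (tgt f) \<and> body f \<in> src f \<rightarrow>\<^sub>E tgt f},
      Dom = src,
      Cod = tgt,
      Ide = (\<lambda>X. Arrow X X (\<lambda>x\<in>X. x)),
      Comp = (\<lambda>g f. Arrow (src f) (tgt g) (compose (src f) (body g) (body f)))\<rparr>"

type_synonym 'u setfunc = "('u set, 'u setarr, 'u set, 'u setarr) func"
type_synonym 'u settrans = "('u set, 'u setarr, 'u set, 'u setarr) ntrans"

text \<open>
  Every small category is isomorphic to one whose objects and arrows form small subsets of \<open>'u\<close>,
  so these suffice as index categories.
\<close>

definition finitary :: "('u set \<Rightarrow> bool) \<Rightarrow> 'u setfunc \<Rightarrow> bool" where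
  "finitary small F \<longleftrightarrow>
     (\<forall>(J :: ('u, 'u) cat) D c \<iota>.
        small (Obj J) \<and> small (Arr J) \<and> is_filtered J \<and> is_functor J (Sets small) D \<and>
        is_colimit J (Sets small) D c \<iota> \<longrightarrow>
        is_colimit J (Sets small) (func_comp J F D) (FObj F c) (\<lambda>j. FArr F (\<iota> j)))"

definition preserves_pullbacks_along_monos :: "('u set \<Rightarrow> bool) \<Rightarrow> 'u setfunc \<Rightarrow> bool" where
  "preserves_pullbacks_along_monos small F \<longleftrightarrow>
     (\<forall>p q f m. is_mono (Sets small) m \<and> is_pullback (Sets small) p q f m \<longrightarrow>
        is_pullback (Sets small) (FArr F p) (FArr F q) (FArr F f) (FArr F m))"

definition semi_analytic :: "('u set \<Rightarrow> bool) \<Rightarrow> 'u setfunc \<Rightarrow> bool" where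
  "semi_analytic small F \<longleftrightarrow> is_functor (Sets small) (Sets small) F \<and>
     finitary small F \<and> preserves_pullbacks_along_monos small F"

definition semi_cartesian :: "('u set \<Rightarrow> bool) \<Rightarrow> 'u settrans \<Rightarrow> bool" where
  "semi_cartesian small t \<longleftrightarrow>
     (\<forall>m. is_mono (Sets small) m \<longrightarrow>
        is_pullback (Sets small) (FArr (src t) m) (body t (src m)) (body t (tgt m)) (FArr (tgt t) m))"

definition End :: "('u set \<Rightarrow> bool) \<Rightarrow> ('u setfunc, 'u settrans) cat" where
  "End small = (let E = functor_category (Sets small) (Sets small) in
     E \<lparr>Obj := {F \<in> Obj E. finitary small F},
        Arr := {t \<in> Arr E. finitary small (src t) \<and> finitary small (tgt t)}\<rparr>)"

definition San :: "('u set \<Rightarrow> bool) \<Rightarrow> ('u setfunc, 'u settrans) cat" where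
  "San small = (End small)
     \<lparr>Obj := {F \<in> Obj (End small). semi_analytic small F},
      Arr := {t \<in> Arr (End small).
                semi_analytic small (src t) \<and> semi_analytic small (tgt t) \<and>
                semi_cartesian small t}\<rparr>"


section \<open>The functor from \<open>Set\<^sup>S\<close> to endofunctors\<close>

text \<open>The object \<open>(n]\<close> is represented by \<open>n\<close>; its underlying set is \<open>{1..n}\<close>.\<close>

type_synonym surjarr = "(nat, nat \<Rightarrow> nat) arrow"

definition Surj :: "(nat, surjarr) cat" where
  "Surj =
     \<lparr>Obj = UNIV,
      Arr = {f. body f \<in> {1..src f} \<rightarrow>\<^sub>E {1..tgt f} \<and> body f ` {1..src f} = {1..tgt f}},
      Dom = src,
      Cod = tgt,
      Ide = (\<lambda>n. Arrow n n (\<lambda>i\<in>{1..n}. i)),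
      Comp = (\<lambda>g f. Arrow (src f) (tgt g) (compose {1..src f} (body g) (body f)))\<rparr>"

type_synonym 'u surjfunc = "(nat, surjarr, 'u set, 'u setarr) func"
type_synonym 'u surjtrans = "(nat, surjarr, 'u set, 'u setarr) ntrans"

definition Injections :: "nat \<Rightarrow> 'u set \<Rightarrow> (nat \<Rightarrow> 'u) set" where
  "Injections n X = {x \<in> {1..n} \<rightarrow>\<^sub>E X. inj_on x {1..n}}"

definition Sym :: "nat \<Rightarrow> (nat \<Rightarrow> nat) set" where
  "Sym n = {\<sigma> \<in> {1..n} \<rightarrow>\<^sub>E {1..n}. bij_betw \<sigma> {1..n} {1..n}}"

text \<open>
  The generating relation \<open>(x \<circ> \<sigma>, a) \<sim> (x, A(\<sigma>)(a))\<close>. It is already an equivalence relation, see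
  \<open>equiv_tensor_rel\<close> below.
\<close>

definition tensor_rel ::
  "'u surjfunc \<Rightarrow> 'u set \<Rightarrow> nat \<Rightarrow> (((nat \<Rightarrow> 'u) \<times> 'u) \<times> ((nat \<Rightarrow> 'u) \<times> 'u)) set" where
  "tensor_rel A X n =
     {((compose {1..n} x \<sigma>, a), (x, body (FArr A (Arrow n n \<sigma>)) a)) | x \<sigma> a.
        x \<in> Injections n X \<and> \<sigma> \<in> Sym n \<and> a \<in> FObj A n}"

text \<open>
  The elements \<open>(n, [x, a])\<close> of the disjoint sum of the quotients have to be coded as elements of
  \<open>'u\<close>. As the classes \<open>[x, a]\<close> are finite sets, one injective coding (which exists by
  \<open>inj_on_encode\<close>) serves all \<open>A\<close> and all \<open>X\<close>.
\<close>

definition codable :: "(nat \<times> ((nat \<Rightarrow> 'u) \<times> 'u) set) set" where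
  "codable = {(n, c). finite c \<and> (\<forall>(x, a) \<in> c. x \<in> extensional {1..n})}"

definition encode :: "nat \<times> ((nat \<Rightarrow> 'u) \<times> 'u) set \<Rightarrow> 'u" where
  "encode = (SOME e. inj_on e codable)"

lemma ex_inj_on_codable:
  assumes "infinite (UNIV :: 'u set)"
  shows "\<exists>e :: nat \<times> ((nat \<Rightarrow> 'u) \<times> 'u) set \<Rightarrow> 'u. inj_on e codable"
proof -
  obtain p :: "'u \<times> 'u \<Rightarrow> 'u" where p: "inj p"
    using card_of_Times_same_infinite[OF assms] by (auto simp flip: card_of_ordIso simp: bij_betw_def)
  obtain i :: "nat \<Rightarrow> 'u" where i: "inj i"
    using assms infinite_countable_subset by blast
  define l :: "'u list \<Rightarrow> 'u" where "l = (\<lambda>xs. foldr (\<lambda>x y. p (x, y)) xs (i 0))"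
  have l_len: "length xs = length ys \<Longrightarrow> l xs = l ys \<Longrightarrow> xs = ys" for xs ys
    by (induction xs ys rule: list_induct2) (auto simp: l_def dest: injD[OF p])
  define L :: "'u list \<Rightarrow> 'u" where "L = (\<lambda>xs. p (i (length xs), l xs))"
  have L: "inj L"
    by (rule injI) (auto simp: L_def dest!: injD[OF p] injD[OF i] intro: l_len)
  define elt :: "nat \<Rightarrow> (nat \<Rightarrow> 'u) \<times> 'u \<Rightarrow> 'u"
    where "elt = (\<lambda>n (x, a). p (L (map x [1..<Suc n]), a))"
  have elt: "x = y \<and> a = b"
    if "x \<in> extensional {1..n}" "y \<in> extensional {1..n}" "elt n (x, a) = elt n (y, b)" for n x a y b
  proof -
    have "L (map x [1..<Suc n]) = L (map y [1..<Suc n])" "a = b"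
      using that(3) by (auto simp: elt_def simp del: upt_Suc dest!: injD[OF p])
    then have "\<forall>k \<in> {1..n}. x k = y k"
      by (auto simp del: upt_Suc dest!: injD[OF L])
    then show ?thesis using that(1,2) \<open>a = b\<close> by (blast intro: extensionalityI)
  qed
  define lst :: "'u set \<Rightarrow> 'u list" where "lst = (\<lambda>s. SOME xs. set xs = s)"
  have lst: "set (lst s) = s" if "finite s" for s
    unfolding lst_def using finite_list[OF that] by (rule someI_ex)
  define e where "e = (\<lambda>(n, c). p (i n, L (lst (elt n ` c))))"
  have "inj_on e codable"
  proof (rule inj_onI, clarify)
    fix n c m d
    assume c: "(n, c) \<in> codable" and d: "(m, d) \<in> codable" and eq: "e (n, c) = e (m, d)"
    have nm: "n = m" and "lst (elt n ` c) = lst (elt m ` d)"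
      using eq by (auto simp: e_def dest!: injD[OF p] injD[OF i] injD[OF L])
    then have "elt n ` c = elt n ` d"
      using c d lst[of "elt n ` c"] lst[of "elt n ` d"] by (simp add: codable_def)
    moreover have "inj_on (elt n) (c \<union> d)"
    proof (rule inj_onI, clarify)
      fix x a y b
      assume "(x, a) \<in> c \<union> d" "(y, b) \<in> c \<union> d" and eq': "elt n (x, a) = elt n (y, b)"
      then have "x \<in> extensional {1..n}" "y \<in> extensional {1..n}"
        using c d nm by (auto simp: codable_def)
      then show "x = y \<and> a = b" using elt eq' by blast
    qed
    ultimately have "c = d" by (meson inj_on_Un_image_eq_iff)
    with nm show "n = m \<and> c = d" by simp
  qed
  then show ?thesis by blast
qed

lemma (in set_universe) inj_on_encode:
  "inj_on (encode :: nat \<times> ((nat \<Rightarrow> 'u) \<times> 'u) set \<Rightarrow> 'u) codable"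
  unfolding encode_def by (rule someI_ex[OF ex_inj_on_codable[OF infinite_UNIV_universe]])

lemma tensor_class_codable:
  assumes "x \<in> Injections n X"
  shows "(n, tensor_rel A X n `` {(x, a)}) \<in> codable"
proof -
  have *: "y \<in> {1..n} \<rightarrow>\<^sub>E x ` {1..n} \<and> (\<exists>\<sigma> \<in> Sym n. b = body (FArr A (Arrow n n \<sigma>)) a)"
    if yb: "((x, a), (y, b)) \<in> tensor_rel A X n" for y b
  proof -
    obtain \<sigma> where \<sigma>: "\<sigma> \<in> Sym n" and y: "y \<in> Injections n X"
      and x: "x = compose {1..n} y \<sigma>" and b: "b = body (FArr A (Arrow n n \<sigma>)) a"
      using yb by (auto simp: tensor_rel_def)
    have "y k \<in> x ` {1..n}" if k: "k \<in> {1..n}" for k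
    proof -
      obtain j where "j \<in> {1..n}" "k = \<sigma> j"
        using \<sigma> k unfolding Sym_def bij_betw_def by blast
      then show ?thesis by (auto simp: x compose_def)
    qed
    then show ?thesis using \<sigma> y b by (auto simp: Injections_def PiE_iff)
  qed
  have "tensor_rel A X n `` {(x, a)} \<subseteq>
      ({1..n} \<rightarrow>\<^sub>E x ` {1..n}) \<times> (\<lambda>\<sigma>. body (FArr A (Arrow n n \<sigma>)) a) ` Sym n"
    using * by auto
  moreover have "finite (Sym n)"
    by (rule finite_subset[of _ "{1..n} \<rightarrow>\<^sub>E {1..n}"]) (auto simp: Sym_def intro!: finite_PiE)
  ultimately have "finite (tensor_rel A X n `` {(x, a)})"
    by (meson finite_PiE finite_SigmaI finite_atLeastAtMost finite_imageI finite_subset)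
  then show ?thesis using * by (auto simp: codable_def PiE_iff)
qed

lemma equiv_tensor_rel:
  assumes "is_functor Surj (Sets small) A"
  shows "equiv (Injections n X \<times> FObj A n) (tensor_rel A X n)"
proof -
  interpret A: is_functor Surj "Sets small" A by fact
  let ?act = "\<lambda>\<sigma>. body (FArr A (Arrow n n \<sigma>))"
  let ?one = "\<lambda>i\<in>{1..n}. i"
  have Sym_Hom: "Arrow n n \<sigma> \<in> Hom Surj n n" if "\<sigma> \<in> Sym n" for \<sigma>
    using that by (auto simp: Sym_def Hom_def Surj_def bij_betw_def)
  have act_Hom: "FArr A (Arrow n n \<sigma>) \<in> Hom (Sets small) (FObj A n) (FObj A n)"
    if "\<sigma> \<in> Sym n" for \<sigma>
    using A.FArr_in_Hom[OF Sym_Hom[OF that]] .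
  have act: "?act \<sigma> a \<in> FObj A n" if "\<sigma> \<in> Sym n" "a \<in> FObj A n" for \<sigma> a
    using act_Hom[OF that(1)] that(2) by (auto simp: Hom_def Sets_def)
  have act_one: "?act ?one a = a" if "a \<in> FObj A n" for a
    using A.FArr_Ide[of n] that by (simp add: Surj_def Sets_def)
  have act_comp: "?act (compose {1..n} \<tau> \<sigma>) a = ?act \<tau> (?act \<sigma> a)"
    if "\<sigma> \<in> Sym n" "\<tau> \<in> Sym n" "a \<in> FObj A n" for \<sigma> \<tau> a
    using A.FArr_Comp[OF Sym_Hom[OF that(1)] Sym_Hom[OF that(2)]] act_Hom[OF that(1)] that(3)
    by (simp add: Surj_def Sets_def Hom_def compose_def)
  have one: "?one \<in> Sym n"
    by (auto simp: Sym_def bij_betw_def inj_on_def)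
  have comp: "compose {1..n} \<tau> \<sigma> \<in> Sym n" if "\<sigma> \<in> Sym n" "\<tau> \<in> Sym n" for \<sigma> \<tau>
  proof -
    have "bij_betw (compose {1..n} \<tau> \<sigma>) {1..n} {1..n}"
      using that by (auto simp: Sym_def intro: bij_betw_compose)
    then show ?thesis
      by (auto simp: Sym_def PiE_iff compose_def dest: bij_betwE)
  qed
  have Inj: "compose {1..n} x \<sigma> \<in> Injections n X" if "x \<in> Injections n X" "\<sigma> \<in> Sym n" for x \<sigma>
  proof -
    have "inj_on (x \<circ> \<sigma>) {1..n}"
      using that by (auto simp: Injections_def Sym_def bij_betw_def intro: comp_inj_on)
    then have "inj_on (compose {1..n} x \<sigma>) {1..n}"
      by (simp add: compose_def inj_on_restrict_eq comp_def)
    moreover have "compose {1..n} x \<sigma> \<in> {1..n} \<rightarrow>\<^sub>E X"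
      using that by (simp add: Injections_def Sym_def compose_def PiE_iff)
    ultimately show ?thesis by (simp add: Injections_def)
  qed
  have inv: "\<exists>\<rho> \<in> Sym n. compose {1..n} \<sigma> \<rho> = ?one \<and> compose {1..n} \<rho> \<sigma> = ?one"
    if "\<sigma> \<in> Sym n" for \<sigma>
  proof (intro bexI conjI)
    have \<sigma>: "bij_betw \<sigma> {1..n} {1..n}" using that by (simp add: Sym_def)
    let ?\<rho> = "restrict (inv_into {1..n} \<sigma>) {1..n}"
    have *: "bij_betw (inv_into {1..n} \<sigma>) {1..n} {1..n}" by (rule bij_betw_inv_into[OF \<sigma>])
    then show "?\<rho> \<in> Sym n"
      unfolding Sym_def by (auto simp: bij_betw_restrict_eq dest: bij_betwE)
    show "compose {1..n} \<sigma> ?\<rho> = ?one" "compose {1..n} ?\<rho> \<sigma> = ?one"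
      using \<sigma> bij_betwE[OF \<sigma>]
      by (auto simp: compose_def fun_eq_iff bij_betw_inv_into_right bij_betw_inv_into_left)
  qed
  have comp_one: "compose {1..n} x ?one = x" if "x \<in> Injections n X" for x
    using that by (auto simp: Injections_def compose_def fun_eq_iff PiE_iff extensional_def)
  have comp_assoc: "compose {1..n} (compose {1..n} x \<sigma>) \<tau> = compose {1..n} x (compose {1..n} \<sigma> \<tau>)"
    if "\<tau> \<in> Sym n" for x :: "nat \<Rightarrow> 'a" and \<sigma> \<tau>
    using that by (auto simp: Sym_def compose_def fun_eq_iff)
  have relI: "((compose {1..n} x \<sigma>, a), (x, ?act \<sigma> a)) \<in> tensor_rel A X n"
    if "x \<in> Injections n X" "\<sigma> \<in> Sym n" "a \<in> FObj A n" for x \<sigma> a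
    using that by (auto simp: tensor_rel_def)
  have relE: "\<exists>x \<sigma> a. p = (compose {1..n} x \<sigma>, a) \<and> q = (x, ?act \<sigma> a) \<and>
      x \<in> Injections n X \<and> \<sigma> \<in> Sym n \<and> a \<in> FObj A n"
    if "(p, q) \<in> tensor_rel A X n" for p q
    using that by (auto simp: tensor_rel_def)
  show ?thesis
  proof (rule equivI)
    show "tensor_rel A X n \<subseteq> (Injections n X \<times> FObj A n) \<times> (Injections n X \<times> FObj A n)"
      by (auto dest!: relE intro: Inj act)
    show "refl_on (Injections n X \<times> FObj A n) (tensor_rel A X n)"
      unfolding refl_on_def by (metis SigmaE relI[OF _ one] comp_one act_one)
    show "sym (tensor_rel A X n)"
    proof (rule symI)
      fix p q assume "(p, q) \<in> tensor_rel A X n"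
      then obtain x \<sigma> a where p: "p = (compose {1..n} x \<sigma>, a)" and q: "q = (x, ?act \<sigma> a)"
        and h: "x \<in> Injections n X" "\<sigma> \<in> Sym n" "a \<in> FObj A n" using relE by blast
      obtain \<rho> where \<rho>: "\<rho> \<in> Sym n" "compose {1..n} \<sigma> \<rho> = ?one" "compose {1..n} \<rho> \<sigma> = ?one"
        using inv[OF h(2)] by blast
      have "?act \<rho> (?act \<sigma> a) = a" "compose {1..n} (compose {1..n} x \<sigma>) \<rho> = x"
        using act_comp[OF h(2) \<rho>(1) h(3)] act_one[OF h(3)] comp_assoc[OF \<rho>(1)] comp_one[OF h(1)] \<rho>
        by simp_all
      then show "(q, p) \<in> tensor_rel A X n"
        using relI[OF Inj[OF h(1,2)] \<rho>(1) act[OF h(2,3)]] by (simp add: p q)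
    qed
    show "trans (tensor_rel A X n)"
    proof (rule transI)
      fix p q r assume "(p, q) \<in> tensor_rel A X n" "(q, r) \<in> tensor_rel A X n"
      then obtain x \<sigma> a y \<tau> where p: "p = (compose {1..n} x \<sigma>, a)" and r: "r = (y, ?act \<tau> (?act \<sigma> a))"
        and h: "x = compose {1..n} y \<tau>" "y \<in> Injections n X" "\<sigma> \<in> Sym n" "\<tau> \<in> Sym n" "a \<in> FObj A n"
        by (auto dest!: relE)
      show "(p, r) \<in> tensor_rel A X n"
        using relI[OF h(2) comp[OF h(3,4)] h(5)] act_comp[OF h(3,4,5)] comp_assoc[OF h(3)]
        by (simp add: p r h(1))
    qed
  qed
qed

definition cls :: "'u surjfunc \<Rightarrow> 'u set \<Rightarrow> nat \<Rightarrow> (nat \<Rightarrow> 'u) \<Rightarrow> 'u \<Rightarrow> 'u" where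
  "cls A X n x a = encode (n, tensor_rel A X n `` {(x, a)})"

definition hat_set :: "'u surjfunc \<Rightarrow> 'u set \<Rightarrow> 'u set" where
  "hat_set A X = (\<Union>n. (\<lambda>c. encode (n, c)) ` ((Injections n X \<times> FObj A n) // tensor_rel A X n))"

definition hat_map :: "'u surjfunc \<Rightarrow> 'u setarr \<Rightarrow> 'u setarr" where
  "hat_map A f = Arrow (hat_set A (src f)) (hat_set A (tgt f))
     (\<lambda>u\<in>hat_set A (src f).
        THE v. \<exists>n m x a y \<alpha>. x \<in> Injections n (src f) \<and> a \<in> FObj A n \<and> u = cls A (src f) n x a \<and>
          y \<in> Injections m (tgt f) \<and> \<alpha> \<in> Hom Surj n m \<and>
          compose {1..n} (body f) x = compose {1..n} y (body \<alpha>) \<and>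
          v = cls A (tgt f) m y (body (FArr A \<alpha>) a))"

definition hat_func :: "('u set \<Rightarrow> bool) \<Rightarrow> 'u surjfunc \<Rightarrow> 'u setfunc" where
  "hat_func small A =
     \<lparr>FObj = (\<lambda>X\<in>Obj (Sets small). hat_set A X), FArr = (\<lambda>f\<in>Arr (Sets small). hat_map A f)\<rparr>"

definition hat_component :: "'u surjtrans \<Rightarrow> 'u set \<Rightarrow> 'u setarr" where
  "hat_component t X = Arrow (hat_set (src t) X) (hat_set (tgt t) X)
     (\<lambda>u\<in>hat_set (src t) X.
        THE v. \<exists>n x a. x \<in> Injections n X \<and> a \<in> FObj (src t) n \<and> u = cls (src t) X n x a \<and>
          v = cls (tgt t) X n x (body (body t n) a))"

definition hat_trans :: "('u set \<Rightarrow> bool) \<Rightarrow> 'u surjtrans \<Rightarrow> 'u settrans" where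
  "hat_trans small t = Arrow (hat_func small (src t)) (hat_func small (tgt t))
     (\<lambda>X\<in>Obj (Sets small). hat_component t X)"

definition SetS :: "('u set \<Rightarrow> bool) \<Rightarrow> ('u surjfunc, 'u surjtrans) cat" where
  "SetS small = functor_category Surj (Sets small)"

definition hat :: "('u set \<Rightarrow> bool) \<Rightarrow> ('u surjfunc, 'u surjtrans, 'u setfunc, 'u settrans) func" where
  "hat small =
     \<lparr>FObj = (\<lambda>A\<in>Obj (SetS small). hat_func small A),
      FArr = (\<lambda>t\<in>Arr (SetS small). hat_trans small t)\<rparr>"

end

(*
  An injection x : {1..n} -> X together with a in A_n gives the element [x, a] of A^(X). Allowing x to
  be an arbitrary map, with [z o alpha, a] = [z, A(alpha)(a)], makes f act by [x, a] |-> [f o x, a], and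
  injective representatives are unique up to a permutation. From this normal form A^ preserves
  filtered colimits and pullbacks along monos, and transformations induced by A -> B are
  semi-cartesian. Conversely a semi-cartesian t preserves supports, so its value at the generic
  element [nu, a] over an n-element set has the form [nu, c], and naturality determines t from
  a |-> c.

  A semi-analytic F is recovered from A_n = the elements of F((n]) that do not come from a proper
  subset of (n]. Surjections preserve this property, because F preserves preimages of subsets.
  Every element of F(X) has a finite support, because X is the filtered union of its finite
  subsets; a support of minimal size presents the element as F(x)(a) with x injective and a in A_n,
  and preimages of supports show that x and a are unique up to a permutation.
*)

theory Submission
  imports Defs "HOL-Library.Countable_Set"
begin


section \<open>Categories\<close>

text \<open>The functor \<open>hat\<close> is specified by descriptions, coded classes and
  extensional arrows, none of which is convenient to compute with. They are absorbed once into
  \<open>gen\<close>: after \<open>cls_eq_iff\<close>, \<open>body_hat_map\<close> and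
  \<open>body_hat_component\<close> the classes [x, a] are handled as formal expressions, governed
  by \<open>gen_act\<close> and by the uniqueness of normal forms. Preservation of pullbacks along
  monos controls supports in two ways. A mono is recognised by its pullback along itself, so
  injections stay injective under F; and the preimage of a subset is a pullback along its inclusion.
  A general transformation may shrink supports (for instance the unique one from the identity
  functor to the constant functor 1), so \<open>hat\<close> is not full. Isomorphisms are
  semi-cartesian, so fullness on isomorphisms and the description of the arrows of the image both
  come from \<open>semi_cartesian_is_hat_trans\<close>. Power sets may be too large for the
  universe. Finite subsets and injections are therefore bounded through lists, and the index
  category of the finite subsets of a set has to be coded by elements of \<open>'u\<close>.\<close>

lemma Hom_iff: "f \<in> Hom C a b \<longleftrightarrow> f \<in> Arr C \<and> Dom C f = a \<and> Cod C f = b"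
  by (simp add: Hom_def)

text \<open>\<open>End\<close> and \<open>San\<close> arise from an ambient category by replacing
  only the fields \<open>Obj\<close> and \<open>Arr\<close>. Identities and composites are
  inherited, so only closure of the new arrows has to be checked.\<close>

lemma category_restrict:
  assumes "category D" and Ob: "Ob \<subseteq> Obj D" and R: "R \<subseteq> Arr D"
    and ends: "\<And>f. f \<in> R \<Longrightarrow> Dom D f \<in> Ob \<and> Cod D f \<in> Ob"
    and ide: "\<And>a. a \<in> Ob \<Longrightarrow> Ide D a \<in> R"
    and comp: "\<And>f g. f \<in> R \<Longrightarrow> g \<in> R \<Longrightarrow> Cod D f = Dom D g \<Longrightarrow> g \<cdot>\<^bsub>D\<^esub> f \<in> R"
  shows "category (D\<lparr>Obj := Ob, Arr := R\<rparr>)"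
proof -
  interpret D: category D by fact
  have Hom: "f \<in> Hom (D\<lparr>Obj := Ob, Arr := R\<rparr>) a b \<longleftrightarrow> f \<in> R \<and> f \<in> Hom D a b" for f a b
    using R by (auto simp: Hom_def)
  show ?thesis
  proof
    fix f g a b c
    assume "f \<in> Hom (D\<lparr>Obj := Ob, Arr := R\<rparr>) a b" "g \<in> Hom (D\<lparr>Obj := Ob, Arr := R\<rparr>) b c"
    then show "g \<cdot>\<^bsub>D\<lparr>Obj := Ob, Arr := R\<rparr>\<^esub> f \<in> Hom (D\<lparr>Obj := Ob, Arr := R\<rparr>) a c"
      using comp[of f g] D.Comp_in_Hom[of f a b g c] by (simp add: Hom) (simp add: Hom_iff)
  qed (use ends ide Ob in \<open>auto simp: Hom D.Comp_Ide D.Ide_Comp intro: D.Ide_in_Hom D.Comp_assoc\<close>)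
qed

lemma nat_trans_ide:
  assumes "is_functor C D F"
  shows "is_nat_trans C D F F (\<lambda>a\<in>Obj C. Ide D (FObj F a))"
proof -
  interpret is_functor C D F by fact
  have "Ide D (FObj F (Cod C f)) \<cdot>\<^bsub>D\<^esub> FArr F f = FArr F f \<cdot>\<^bsub>D\<^esub> Ide D (FObj F (Dom C f))"
    if "f \<in> Arr C" for f
  proof -
    have "FArr F f \<in> Hom D (FObj F (Dom C f)) (FObj F (Cod C f))"
      using that by (intro FArr_in_Hom) (simp add: Hom_iff)
    then show ?thesis by (simp add: D.Ide_Comp D.Comp_Ide)
  qed
  then show ?thesis
    using assms by (auto simp: is_nat_trans_def FObj_in_Obj D.Ide_in_Hom C.Dom_in_Obj C.Cod_in_Obj)
qed

lemma nat_trans_comp: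
  assumes s: "is_nat_trans C D F G s" and t: "is_nat_trans C D G H t"
  shows "is_nat_trans C D F H (\<lambda>a\<in>Obj C. t a \<cdot>\<^bsub>D\<^esub> s a)"
proof -
  interpret F: is_functor C D F using s by (simp add: is_nat_trans_def)
  interpret G: is_functor C D G using s by (simp add: is_nat_trans_def)
  interpret H: is_functor C D H using t by (simp add: is_nat_trans_def)
  have sH: "s a \<in> Hom D (FObj F a) (FObj G a)" and tH: "t a \<in> Hom D (FObj G a) (FObj H a)"
    if "a \<in> Obj C" for a
    using s t that by (auto simp: is_nat_trans_def)
  have "(t (Cod C f) \<cdot>\<^bsub>D\<^esub> s (Cod C f)) \<cdot>\<^bsub>D\<^esub> FArr F f = FArr H f \<cdot>\<^bsub>D\<^esub> (t (Dom C f) \<cdot>\<^bsub>D\<^esub> s (Dom C f))"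
    if f: "f \<in> Arr C" for f
  proof -
    have a: "Dom C f \<in> Obj C" "Cod C f \<in> Obj C" and fH: "f \<in> Hom C (Dom C f) (Cod C f)"
      using f by (auto simp: F.C.Dom_in_Obj F.C.Cod_in_Obj Hom_iff)
    have sf: "s (Cod C f) \<cdot>\<^bsub>D\<^esub> FArr F f = FArr G f \<cdot>\<^bsub>D\<^esub> s (Dom C f)"
      and tf: "t (Cod C f) \<cdot>\<^bsub>D\<^esub> FArr G f = FArr H f \<cdot>\<^bsub>D\<^esub> t (Dom C f)"
      using s t f by (auto simp: is_nat_trans_def)
    have "(t (Cod C f) \<cdot>\<^bsub>D\<^esub> s (Cod C f)) \<cdot>\<^bsub>D\<^esub> FArr F f = t (Cod C f) \<cdot>\<^bsub>D\<^esub> (FArr G f \<cdot>\<^bsub>D\<^esub> s (Dom C f))"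
      using F.D.Comp_assoc[OF F.FArr_in_Hom[OF fH] sH[OF a(2)] tH[OF a(2)]] sf by simp
    also have "\<dots> = (FArr H f \<cdot>\<^bsub>D\<^esub> t (Dom C f)) \<cdot>\<^bsub>D\<^esub> s (Dom C f)"
      using F.D.Comp_assoc[OF sH[OF a(1)] G.FArr_in_Hom[OF fH] tH[OF a(2)]] tf by simp
    also have "\<dots> = FArr H f \<cdot>\<^bsub>D\<^esub> (t (Dom C f) \<cdot>\<^bsub>D\<^esub> s (Dom C f))"
      using F.D.Comp_assoc[OF sH[OF a(1)] tH[OF a(1)] H.FArr_in_Hom[OF fH]] .
    finally show ?thesis .
  qed
  then show ?thesis
    using F.is_functor_axioms H.is_functor_axioms
    by (auto simp: is_nat_trans_def F.C.Dom_in_Obj F.C.Cod_in_Obj intro: F.D.Comp_in_Hom[OF sH tH])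
qed

lemma category_functor_category:
  assumes "category C" "category D"
  shows "category (functor_category C D)"
proof -
  let ?E = "functor_category C D"
  interpret C: category C by fact
  interpret D: category D by fact
  have Hom: "t \<in> Hom (?E) F G \<longleftrightarrow>
      src t = F \<and> tgt t = G \<and> is_nat_trans C D F G (body t)" for t F G
    by (auto simp: Hom_iff functor_category_def)
  have comp: "t a \<in> Hom D (FObj F a) (FObj G a)" if "is_nat_trans C D F G t" "a \<in> Obj C" for t F G a
    using that by (auto simp: is_nat_trans_def)
  have ext: "t \<in> extensional (Obj C)" if "is_nat_trans C D F G t" for t F G
    using that by (auto simp: is_nat_trans_def)
  show ?thesis
  proof
    fix t :: "('a, 'b, 'c, 'd) ntrans" assume "t \<in> Arr (?E)"
    then show "Dom (?E) t \<in> Obj (?E)"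
      "Cod (?E) t \<in> Obj (?E)"
      by (auto simp: functor_category_def is_nat_trans_def)
  next
    fix F :: "('a, 'b, 'c, 'd) func" assume "F \<in> Obj (?E)"
    then show "Ide (?E) F \<in> Hom (?E) F F"
      unfolding Hom by (simp add: functor_category_def nat_trans_ide)
  next
    fix s t :: "('a, 'b, 'c, 'd) ntrans" and F G H
    assume "s \<in> Hom (?E) F G" "t \<in> Hom (?E) G H"
    then show "t \<cdot>\<^bsub>?E\<^esub> s \<in> Hom (?E) F H"
      unfolding Hom by (auto simp: functor_category_def nat_trans_comp)
  next
    fix t :: "('a, 'b, 'c, 'd) ntrans" and F G
    assume "t \<in> Hom (?E) F G"
    then have t: "src t = F" "tgt t = G" "is_nat_trans C D F G (body t)" by (auto simp: Hom)
    show "t \<cdot>\<^bsub>?E\<^esub> Ide (?E) F = t"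
      "Ide (?E) G \<cdot>\<^bsub>?E\<^esub> t = t"
      \<comment> \<open>Composition restricts the components to \<open>Obj C\<close>, so the unit
        laws hold as equations of arrows only because \<open>t\<close> is extensional.\<close>
      using t ext[OF t(3)] D.Comp_Ide[OF comp[OF t(3)]] D.Ide_Comp[OF comp[OF t(3)]]
      by (auto simp: functor_category_def intro!: arrow.expand extensionalityI[of _ "Obj C"])
  next
    fix r s t :: "('a, 'b, 'c, 'd) ntrans" and F G H K
    assume "r \<in> Hom (?E) F G" "s \<in> Hom (?E) G H"
      "t \<in> Hom (?E) H K"
    then have n: "is_nat_trans C D F G (body r)" "is_nat_trans C D G H (body s)"
      "is_nat_trans C D H K (body t)" by (auto simp: Hom)
    show "(t \<cdot>\<^bsub>?E\<^esub> s) \<cdot>\<^bsub>?E\<^esub> r =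
        t \<cdot>\<^bsub>?E\<^esub> (s \<cdot>\<^bsub>?E\<^esub> r)"
      using D.Comp_assoc[OF comp[OF n(1)] comp[OF n(2)] comp[OF n(3)]]
      by (auto simp: functor_category_def intro!: restrict_ext)
  qed
qed

lemma is_functor_func_comp:
  assumes "is_functor J C D" "is_functor C E F"
  shows "is_functor J E (func_comp J F D)"
proof -
  interpret D: is_functor J C D by fact
  interpret F: is_functor C E F by fact
  show ?thesis
  proof
    fix f a b assume f: "f \<in> Hom J a b"
    then have "a \<in> Obj J" "b \<in> Obj J" "f \<in> Arr J"
      using D.C.Dom_in_Obj D.C.Cod_in_Obj by (auto simp: Hom_iff)
    then show "FArr (func_comp J F D) f \<in> Hom E (FObj (func_comp J F D) a) (FObj (func_comp J F D) b)"
      using F.FArr_in_Hom[OF D.FArr_in_Hom[OF f]] by (simp add: func_comp_def compose_def)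
  next
    fix a assume "a \<in> Obj J"
    then show "FArr (func_comp J F D) (Ide J a) = Ide E (FObj (func_comp J F D) a)"
      using D.C.Ide_in_Hom[of a]
      by (simp add: func_comp_def compose_def Hom_iff D.FArr_Ide F.FArr_Ide D.FObj_in_Obj)
  next
    fix f g a b c assume fg: "f \<in> Hom J a b" "g \<in> Hom J b c"
    then show "FArr (func_comp J F D) (g \<cdot>\<^bsub>J\<^esub> f) =
        FArr (func_comp J F D) g \<cdot>\<^bsub>E\<^esub> FArr (func_comp J F D) f"
      using D.C.Comp_in_Hom[OF fg] D.FArr_Comp[OF fg]
        F.FArr_Comp[OF D.FArr_in_Hom[OF fg(1)] D.FArr_in_Hom[OF fg(2)]]
      by (simp add: func_comp_def compose_def Hom_iff)
  qed (auto simp: func_comp_def compose_def D.FObj_in_Obj F.FObj_in_Obj)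
qed

lemma category_Sets: "category (Sets small)"
proof
  fix f g :: "'a setarr" and X Y Z
  assume f: "f \<in> Hom (Sets small) X Y"
  show "f \<cdot>\<^bsub>Sets small\<^esub> Ide (Sets small) X = f" "Ide (Sets small) Y \<cdot>\<^bsub>Sets small\<^esub> f = f"
    using f by (auto simp: Hom_iff Sets_def PiE_iff compose_def extensional_def fun_eq_iff
        intro!: arrow.expand, metis)
  assume g: "g \<in> Hom (Sets small) Y Z"
  show "g \<cdot>\<^bsub>Sets small\<^esub> f \<in> Hom (Sets small) X Z"
    using f g by (auto simp: Hom_iff Sets_def PiE_iff compose_def)
next
  fix f g h :: "'a setarr" and W X Y Z
  assume "f \<in> Hom (Sets small) W X" "g \<in> Hom (Sets small) X Y" "h \<in> Hom (Sets small) Y Z"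
  then show "(h \<cdot>\<^bsub>Sets small\<^esub> g) \<cdot>\<^bsub>Sets small\<^esub> f = h \<cdot>\<^bsub>Sets small\<^esub> (g \<cdot>\<^bsub>Sets small\<^esub> f)"
    by (auto simp: Hom_iff Sets_def PiE_iff compose_def intro!: restrict_ext)
qed (auto simp: Hom_iff Sets_def)

lemma category_Surj: "category Surj"
proof
  fix f g :: surjarr and n m k
  assume f: "f \<in> Hom Surj n m"
  show "f \<cdot>\<^bsub>Surj\<^esub> Ide Surj n = f" "Ide Surj m \<cdot>\<^bsub>Surj\<^esub> f = f"
    using f by (auto simp: Hom_iff Surj_def PiE_iff Pi_iff compose_def extensional_def fun_eq_iff
        intro!: arrow.expand)
  assume g: "g \<in> Hom Surj m k"
  have "(\<lambda>i. body g (body f i)) ` {1..n} = {1..k}"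
    using f g by (clarsimp simp: Hom_iff Surj_def simp del: One_nat_def simp flip: image_image)
  then show "g \<cdot>\<^bsub>Surj\<^esub> f \<in> Hom Surj n k"
    using f g by (auto simp: Hom_iff Surj_def compose_def PiE_iff Pi_iff)
next
  fix f g h :: surjarr and n m k l
  assume "f \<in> Hom Surj n m" "g \<in> Hom Surj m k" "h \<in> Hom Surj k l"
  then show "(h \<cdot>\<^bsub>Surj\<^esub> g) \<cdot>\<^bsub>Surj\<^esub> f = h \<cdot>\<^bsub>Surj\<^esub> (g \<cdot>\<^bsub>Surj\<^esub> f)"
    by (auto simp: Hom_iff Surj_def PiE_iff Pi_iff compose_def intro!: restrict_ext)
qed (auto simp: Hom_iff Surj_def)


section \<open>Sets and functions\<close>

text \<open>Restriction to \<open>X\<close> makes the arrow depend only on the values on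
  \<open>X\<close>, so any HOL function can serve as a map without first being made
  extensional.\<close>

definition mor :: "'u set \<Rightarrow> 'u set \<Rightarrow> ('u \<Rightarrow> 'u) \<Rightarrow> 'u setarr" where
  "mor X Y f = Arrow X Y (restrict f X)"

text \<open>With raw functions in place of arrow records, composites become lambda terms and maps
  have to agree only on their domain.\<close>

definition fmap :: "'u setfunc \<Rightarrow> 'u set \<Rightarrow> 'u set \<Rightarrow> ('u \<Rightarrow> 'u) \<Rightarrow> 'u \<Rightarrow> 'u" where
  "fmap F X Y f u = body (FArr F (mor X Y f)) u"

lemma mor_sel [simp]: "src (mor X Y f) = X" "tgt (mor X Y f) = Y"
  "x \<in> X \<Longrightarrow> body (mor X Y f) x = f x"
  by (simp_all add: mor_def)

lemma mor_cong: "(\<And>x. x \<in> X \<Longrightarrow> f x = g x) \<Longrightarrow> mor X Y f = mor X Y g"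
  by (auto simp: mor_def)

lemma Obj_Sets [simp]: "X \<in> Obj (Sets small) \<longleftrightarrow> small X"
  by (simp add: Sets_def)

lemma Hom_Sets_iff: "f \<in> Hom (Sets small) X Y \<longleftrightarrow>
    src f = X \<and> tgt f = Y \<and> small X \<and> small Y \<and> body f \<in> X \<rightarrow>\<^sub>E Y"
  by (auto simp: Hom_iff Sets_def)

lemma Arr_Sets_iff: "f \<in> Arr (Sets small) \<longleftrightarrow> f \<in> Hom (Sets small) (src f) (tgt f)"
  by (auto simp: Hom_iff Sets_def)

lemma Dom_Cod_Sets [simp]: "Dom (Sets small) = src" "Cod (Sets small) = tgt"
  by (simp_all add: Sets_def)

lemma mor_in_Hom: "small X \<Longrightarrow> small Y \<Longrightarrow> f \<in> X \<rightarrow> Y \<Longrightarrow> mor X Y f \<in> Hom (Sets small) X Y"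
  by (auto simp: Hom_Sets_iff mor_def)

lemma Hom_Sets_eq_mor: "f \<in> Hom (Sets small) X Y \<Longrightarrow> f = mor X Y (body f)"
  by (auto simp: Hom_Sets_iff mor_def PiE_iff extensional_restrict intro!: arrow.expand)

lemma Hom_Sets_body: "f \<in> Hom (Sets small) X Y \<Longrightarrow> x \<in> X \<Longrightarrow> body f x \<in> Y"
  by (auto simp: Hom_Sets_iff)

lemma Hom_Sets_small: "f \<in> Hom (Sets small) X Y \<Longrightarrow> small X \<and> small Y"
  by (auto simp: Hom_Sets_iff)

lemma Hom_Sets_eqI:
  assumes "f \<in> Hom (Sets small) X Y" "g \<in> Hom (Sets small) X Y" "\<And>x. x \<in> X \<Longrightarrow> body f x = body g x"
  shows "f = g"
  using assms by (metis Hom_Sets_eq_mor mor_cong)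

lemma body_Comp_Sets [simp]:
  "x \<in> src f \<Longrightarrow> body (g \<cdot>\<^bsub>Sets small\<^esub> f) x = body g (body f x)"
  by (simp add: Sets_def compose_def)

lemma Comp_Sets_eqD:
  assumes "g \<cdot>\<^bsub>Sets small\<^esub> f = g' \<cdot>\<^bsub>Sets small\<^esub> f'"
    and "f \<in> Hom (Sets small) W X" "f' \<in> Hom (Sets small) W X'" "w \<in> W"
  shows "body g (body f w) = body g' (body f' w)"
  using assms by (metis Hom_Sets_iff body_Comp_Sets)

lemma Comp_Sets_in_Hom:
  "f \<in> Hom (Sets small) X Y \<Longrightarrow> g \<in> Hom (Sets small) Y Z \<Longrightarrow> g \<cdot>\<^bsub>Sets small\<^esub> f \<in> Hom (Sets small) X Z"
  by (rule category.Comp_in_Hom[OF category_Sets])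

lemma Comp_mor: "f \<in> X \<rightarrow> Y \<Longrightarrow> mor Y Z g \<cdot>\<^bsub>Sets small\<^esub> mor X Y f = mor X Z (\<lambda>x. g (f x))"
  by (auto simp: mor_def Sets_def compose_def intro!: restrict_ext)

lemma Ide_Sets: "Ide (Sets small) X = mor X X (\<lambda>x. x)"
  by (simp add: mor_def Sets_def)

text \<open>One interface for endofunctors of \<open>Sets\<close>, functors on \<open>Surj\<close>
  and filtered diagrams: the elementwise laws are proved once for an arbitrary source
  category.\<close>

locale set_valued = is_functor J "Sets small" D
  for J :: "('j, 'k) cat" and small :: "'u set \<Rightarrow> bool" and D :: "('j, 'k, 'u set, 'u setarr) func"
begin

lemma small_FObj: "a \<in> Obj J \<Longrightarrow> small (FObj D a)"
  using FObj_in_Obj by simp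

lemma body_in: "h \<in> Hom J a b \<Longrightarrow> x \<in> FObj D a \<Longrightarrow> body (FArr D h) x \<in> FObj D b"
  by (rule Hom_Sets_body[OF FArr_in_Hom])

lemma src_tgt_FArr: "h \<in> Hom J a b \<Longrightarrow> src (FArr D h) = FObj D a" "h \<in> Hom J a b \<Longrightarrow> tgt (FArr D h) = FObj D b"
  using FArr_in_Hom by (simp_all add: Hom_Sets_iff)

lemma body_Comp: "f \<in> Hom J a b \<Longrightarrow> g \<in> Hom J b c \<Longrightarrow> x \<in> FObj D a \<Longrightarrow>
    body (FArr D (g \<cdot>\<^bsub>J\<^esub> f)) x = body (FArr D g) (body (FArr D f) x)"
  by (simp add: FArr_Comp src_tgt_FArr)

lemma body_Ide: "a \<in> Obj J \<Longrightarrow> x \<in> FObj D a \<Longrightarrow> body (FArr D (Ide J a)) x = x"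
  by (simp add: FArr_Ide Ide_Sets)

end

lemma nat_trans_set_valued:
  assumes "is_nat_trans J (Sets small) F G t"
  shows "set_valued J small F" "set_valued J small G"
    "a \<in> Obj J \<Longrightarrow> t a \<in> Hom (Sets small) (FObj F a) (FObj G a)"
    "h \<in> Hom J a b \<Longrightarrow> x \<in> FObj F a \<Longrightarrow>
      body (t b) (body (FArr F h) x) = body (FArr G h) (body (t a) x)"
proof -
  show F: "set_valued J small F" and G: "set_valued J small G"
    using assms by (simp_all add: is_nat_trans_def set_valued_def)
  interpret F: set_valued J small F by fact
  show *: "t a \<in> Hom (Sets small) (FObj F a) (FObj G a)" if "a \<in> Obj J" for a
    using assms that by (simp add: is_nat_trans_def)
  assume h: "h \<in> Hom J a b" and x: "x \<in> FObj F a"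
  then have ab: "a \<in> Obj J" "b \<in> Obj J"
    using F.C.Dom_in_Obj F.C.Cod_in_Obj by (auto simp: Hom_iff)
  have "t b \<cdot>\<^bsub>Sets small\<^esub> FArr F h = FArr G h \<cdot>\<^bsub>Sets small\<^esub> t a"
    using assms h by (auto simp: is_nat_trans_def Hom_iff)
  then have "body (t b \<cdot>\<^bsub>Sets small\<^esub> FArr F h) x = body (FArr G h \<cdot>\<^bsub>Sets small\<^esub> t a) x"
    by simp
  then show "body (t b) (body (FArr F h) x) = body (FArr G h) (body (t a) x)"
    using x *[OF ab(1)] F.src_tgt_FArr[OF h] by (simp add: Hom_Sets_iff)
qed

text \<open>The two composites in a naturality square are parallel arrows of sets, hence equal once
  they agree on elements. Transformations are built below by formulas on elements.\<close>

lemma set_valued_nat_transI: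
  assumes F: "set_valued J small F" and G: "set_valued J small G"
    and "t \<in> extensional (Obj J)"
    and t: "\<And>a. a \<in> Obj J \<Longrightarrow> t a \<in> Hom (Sets small) (FObj F a) (FObj G a)"
    and nat: "\<And>h a b x. h \<in> Hom J a b \<Longrightarrow> x \<in> FObj F a \<Longrightarrow>
      body (t b) (body (FArr F h) x) = body (FArr G h) (body (t a) x)"
  shows "is_nat_trans J (Sets small) F G t"
proof -
  interpret F: set_valued J small F by fact
  interpret G: set_valued J small G by fact
  have "t (Cod J h) \<cdot>\<^bsub>Sets small\<^esub> FArr F h = FArr G h \<cdot>\<^bsub>Sets small\<^esub> t (Dom J h)" if "h \<in> Arr J" for h
  proof (rule Hom_Sets_eqI)
    have h: "h \<in> Hom J (Dom J h) (Cod J h)" using that by (simp add: Hom_iff)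
    have o: "Dom J h \<in> Obj J" "Cod J h \<in> Obj J"
      using that F.C.Dom_in_Obj F.C.Cod_in_Obj by auto
    show "t (Cod J h) \<cdot>\<^bsub>Sets small\<^esub> FArr F h \<in> Hom (Sets small) (FObj F (Dom J h)) (FObj G (Cod J h))"
      by (rule Comp_Sets_in_Hom[OF F.FArr_in_Hom[OF h] t[OF o(2)]])
    show "FArr G h \<cdot>\<^bsub>Sets small\<^esub> t (Dom J h) \<in> Hom (Sets small) (FObj F (Dom J h)) (FObj G (Cod J h))"
      by (rule Comp_Sets_in_Hom[OF t[OF o(1)] G.FArr_in_Hom[OF h]])
    show "body (t (Cod J h) \<cdot>\<^bsub>Sets small\<^esub> FArr F h) x = body (FArr G h \<cdot>\<^bsub>Sets small\<^esub> t (Dom J h)) x"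
      if "x \<in> FObj F (Dom J h)" for x
      using that nat[OF h that] t[OF o(1)] F.src_tgt_FArr[OF h] by (simp add: Hom_Sets_iff)
  qed
  then show ?thesis
    using assms F.is_functor_axioms G.is_functor_axioms by (auto simp: is_nat_trans_def)
qed

locale set_endo = set_valued "Sets small" small F
  for small :: "'u set \<Rightarrow> bool" and F :: "'u setfunc"
begin

lemma fmap_in:
  "small X \<Longrightarrow> small Y \<Longrightarrow> f \<in> X \<rightarrow> Y \<Longrightarrow> u \<in> FObj F X \<Longrightarrow> fmap F X Y f u \<in> FObj F Y"
  unfolding fmap_def by (rule body_in[OF mor_in_Hom])

lemma fmap_fmap:
  "small X \<Longrightarrow> small Y \<Longrightarrow> small Z \<Longrightarrow> f \<in> X \<rightarrow> Y \<Longrightarrow> g \<in> Y \<rightarrow> Z \<Longrightarrow> u \<in> FObj F X \<Longrightarrow>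
    fmap F Y Z g (fmap F X Y f u) = fmap F X Z (\<lambda>x. g (f x)) u"
  unfolding fmap_def using body_Comp[OF mor_in_Hom mor_in_Hom, of X Y f Z g u] by (simp add: Comp_mor)

lemma fmap_cong: "(\<And>x. x \<in> X \<Longrightarrow> f x = g x) \<Longrightarrow> fmap F X Y f u = fmap F X Y g u"
  unfolding fmap_def by (simp add: mor_cong[of X f g])

lemma fmap_ident: "small X \<Longrightarrow> u \<in> FObj F X \<Longrightarrow> (\<And>x. x \<in> X \<Longrightarrow> f x = x) \<Longrightarrow> fmap F X X f u = u"
  using body_Ide[of X u] fmap_cong[of X f "\<lambda>x. x"] by (simp add: fmap_def Ide_Sets)

lemma body_FArr_eq_fmap:
  "f \<in> Hom (Sets small) X Y \<Longrightarrow> body (FArr F f) u = fmap F X Y (body f) u"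
  unfolding fmap_def by (simp flip: Hom_Sets_eq_mor)

end

section \<open>Smallness for sets over arbitrary types\<close>

context set_universe
begin

text \<open>The predicate \<open>small\<close> speaks only about subsets of \<open>'u\<close>, while
  lists, pairs and sets of subsets live in other types. Covering by an image of a small set extends
  it to every type and, by replacement, agrees with it on \<open>'u\<close>.\<close>

definition Small :: "'b set \<Rightarrow> bool" where
  "Small S \<longleftrightarrow> (\<exists>X (f :: 'u \<Rightarrow> 'b). small X \<and> S \<subseteq> f ` X)"

lemma Small_iff_small: "Small S \<longleftrightarrow> small S"
proof
  show "Small S \<Longrightarrow> small S" using small_image by (auto simp: Small_def)
  show "small S \<Longrightarrow> Small S" unfolding Small_def by (metis image_ident order_refl)
qed

lemma Small_image: "Small S \<Longrightarrow> T \<subseteq> f ` S \<Longrightarrow> Small T"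
  unfolding Small_def by (metis image_comp image_mono order_trans)

lemma Small_subset: "Small S \<Longrightarrow> T \<subseteq> S \<Longrightarrow> Small T"
  using Small_image[of S T "\<lambda>x. x"] by simp

text \<open>The axiom \<open>small_UN\<close> applies to subsets of \<open>'u\<close> indexed by a
  small subset of \<open>'u\<close>. The disjoint union of the family is therefore coded inside
  \<open>'u\<close> by pairs of an index code and a member code, and decoding it covers the
  union.\<close>

lemma Small_UN:
  assumes "Small I" "\<And>i. i \<in> I \<Longrightarrow> Small (K i)"
  shows "Small (\<Union>i\<in>I. K i)"
proof -
  obtain p :: "'u \<times> 'u \<Rightarrow> 'u" where p: "inj p"
    using card_of_Times_same_infinite[OF infinite_UNIV_universe]
    by (auto simp flip: card_of_ordIso simp: bij_betw_def)
  obtain X g where X: "small X" "I \<subseteq> g ` X" using assms(1) by (auto simp: Small_def)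
  obtain Y k where Y: "small (Y i)" "K i \<subseteq> k i ` Y i" if "i \<in> I" for i
    using assms(2) unfolding Small_def by metis
  let ?P = "\<Union>x\<in>{x \<in> X. g x \<in> I}. (\<lambda>y. p (x, y)) ` Y (g x)"
  have "small {x \<in> X. g x \<in> I}"
    using X(1) Small_subset by (metis (no_types, lifting) Small_iff_small mem_Collect_eq subsetI)
  then have "small ?P"
    by (rule small_UN) (auto intro: small_image[OF Y(1)])
  moreover have "(\<Union>i\<in>I. K i) \<subseteq> (\<lambda>u. case inv p u of (x, y) \<Rightarrow> k (g x) y) ` ?P"
  proof
    fix z assume "z \<in> (\<Union>i\<in>I. K i)"
    then obtain i y where i: "i \<in> I" and y: "y \<in> Y i" and z: "z = k i y" using Y(2) by blast
    then obtain x where x: "x \<in> X" "g x = i" using X(2) by blast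
    have "p (x, y) \<in> ?P" using x i y by auto
    moreover have "z = (case inv p (p (x, y)) of (x, y) \<Rightarrow> k (g x) y)"
      using x z by (simp add: inv_f_f[OF p])
    ultimately show "z \<in> (\<lambda>u. case inv p u of (x, y) \<Rightarrow> k (g x) y) ` ?P" by (rule rev_image_eqI)
  qed
  ultimately show ?thesis unfolding Small_def by blast
qed

text \<open>An infinite small set contains a copy of the natural numbers, so these are
  \<open>Small\<close>, and every countable set is covered by an image of them.\<close>

lemma Small_countable: "countable S \<Longrightarrow> Small S"
proof -
  obtain X where X: "infinite X" "small X" using small_infinite by blast
  then obtain i :: "nat \<Rightarrow> 'u" where i: "inj i" "range i \<subseteq> X" using infinite_countable_subset by blast
  assume "countable S"
  then have f: "S \<subseteq> range (from_nat_into S)" by (rule subset_range_from_nat_into)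
  have "UNIV \<subseteq> inv i ` X"
  proof
    fix n show "n \<in> inv i ` X" using i by (intro rev_image_eqI[of "i n"]) auto
  qed
  then show "Small S"
    using X(2) Small_image[OF _ f] by (auto simp: Small_def)
qed

lemma Small_finite: "finite S \<Longrightarrow> Small S"
  by (simp add: Small_countable countable_finite)

lemma small_finite: "finite X \<Longrightarrow> small X"
  using Small_finite Small_iff_small by blast

lemma Small_Times: "Small S \<Longrightarrow> Small T \<Longrightarrow> Small (S \<times> T)"
proof -
  assume S: "Small S" and T: "Small T"
  have "S \<times> T = (\<Union>s\<in>S. Pair s ` T)" by auto
  then show ?thesis using Small_UN[OF S] Small_image[OF T] by (metis order_refl)
qed

text \<open>A countable union over the length. Lists take over the role of power sets: finite
  subsets of \<open>X\<close> are sets of entries of lists over \<open>X\<close>, and maps on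
  \<open>{1..n}\<close> are read off from lists of values.\<close>

lemma Small_lists: "Small S \<Longrightarrow> Small (lists S)"
proof -
  assume S: "Small S"
  have "Small {xs \<in> lists S. length xs = n}" for n
  proof (induction n)
    case 0 then show ?case by (auto intro: Small_finite)
  next
    case (Suc n)
    have "{xs \<in> lists S. length xs = Suc n} \<subseteq> (\<lambda>(x, xs). x # xs) ` (S \<times> {xs \<in> lists S. length xs = n})"
      by (auto simp: length_Suc_conv image_iff) 
    then show ?case by (rule Small_image[OF Small_Times[OF S Suc]])
  qed
  then have "Small (\<Union>n. {xs \<in> lists S. length xs = n})"
    by (intro Small_UN[OF Small_countable]) auto
  then show ?thesis by (rule Small_subset) auto
qed

lemma small_subset: "small X \<Longrightarrow> Y \<subseteq> X \<Longrightarrow> small Y"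
  using Small_subset Small_iff_small by blast

end


section \<open>Monomorphisms and pullbacks of sets in terms of elements\<close>

context set_universe
begin

text \<open>Elements are maps from a singleton, so cancellation against such maps already gives
  injectivity.\<close>

lemma is_mono_Sets_iff:
  assumes "m \<in> Hom (Sets small) X Y"
  shows "is_mono (Sets small) m \<longleftrightarrow> inj_on (body m) X"
proof
  assume mono: "is_mono (Sets small) m"
  show "inj_on (body m) X"
  proof (rule inj_onI)
    fix x y assume xy: "x \<in> X" "y \<in> X" and eq: "body m x = body m y"
    \<comment> \<open>\<open>{x}\<close> is used merely as a singleton; its maps to \<open>X\<close>
      with value \<open>z = x\<close> and \<open>z = y\<close> are compared.\<close>
    have g: "mor {x} X (\<lambda>_. z) \<in> Hom (Sets small) {x} X" if "z \<in> X" for z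
      using that small_finite[of "{x}"] Hom_Sets_small[OF assms] by (intro mor_in_Hom) auto
    have "m \<cdot>\<^bsub>Sets small\<^esub> mor {x} X (\<lambda>_. x) = m \<cdot>\<^bsub>Sets small\<^esub> mor {x} X (\<lambda>_. y)"
      by (rule Hom_Sets_eqI) (use Comp_Sets_in_Hom[OF g assms] xy eq in auto)
    moreover have "Dom (Sets small) m = X" using assms by (simp add: Hom_Sets_iff)
    ultimately have "mor {x} X (\<lambda>_. x) = mor {x} X (\<lambda>_. y)"
      using mono g xy small_finite[of "{x}"] by (auto simp: is_mono_def)
    then show "x = y" by (metis mor_sel(3) singletonI)
  qed
next
  assume inj: "inj_on (body m) X"
  show "is_mono (Sets small) m"
    unfolding is_mono_def
  proof (intro conjI ballI impI)
    show "m \<in> Arr (Sets small)" using assms by (simp add: Hom_iff)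
    fix a g h assume g: "g \<in> Hom (Sets small) a (Dom (Sets small) m)"
      and h: "h \<in> Hom (Sets small) a (Dom (Sets small) m)" 
      and eq: "m \<cdot>\<^bsub>Sets small\<^esub> g = m \<cdot>\<^bsub>Sets small\<^esub> h"
    have "body m (body g x) = body m (body h x)" if "x \<in> a" for x
      using Comp_Sets_eqD[OF eq g h that] .
    moreover have "body g x \<in> X" "body h x \<in> X" if "x \<in> a" for x
      using that g h assms by (auto simp: Hom_Sets_iff)
    ultimately show "g = h"
      using inj by (intro Hom_Sets_eqI[OF g h]) (auto simp: inj_on_def)
  qed
qed

lemma is_mono_mor_iff:
  "small X \<Longrightarrow> small Y \<Longrightarrow> f \<in> X \<rightarrow> Y \<Longrightarrow> is_mono (Sets small) (mor X Y f) \<longleftrightarrow> inj_on f X"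
  using is_mono_Sets_iff[OF mor_in_Hom] by (simp add: inj_on_def)

text \<open>The universal property is tested on a one-point set, whose maps are elements.\<close>

lemma is_pullback_SetsD:
  assumes "is_pullback (Sets small) p q f g"
  obtains W X Y Z where "p \<in> Hom (Sets small) W X" "q \<in> Hom (Sets small) W Y"
    "f \<in> Hom (Sets small) X Z" "g \<in> Hom (Sets small) Y Z"
    "\<And>w. w \<in> W \<Longrightarrow> body f (body p w) = body g (body q w)"
    "\<And>x y. x \<in> X \<Longrightarrow> y \<in> Y \<Longrightarrow> body f x = body g y \<Longrightarrow> \<exists>!w. w \<in> W \<and> body p w = x \<and> body q w = y"
proof -
  let ?S = "Sets small"
  obtain W X Y Z where H: "p \<in> Hom ?S W X" "q \<in> Hom ?S W Y" "f \<in> Hom ?S X Z" "g \<in> Hom ?S Y Z"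
    and comm: "f \<cdot>\<^bsub>?S\<^esub> p = g \<cdot>\<^bsub>?S\<^esub> q"
    and univ: "\<And>V r s. V \<in> Obj ?S \<Longrightarrow> r \<in> Hom ?S V X \<Longrightarrow> s \<in> Hom ?S V Y \<Longrightarrow>
       f \<cdot>\<^bsub>?S\<^esub> r = g \<cdot>\<^bsub>?S\<^esub> s \<Longrightarrow> \<exists>!h. h \<in> Hom ?S V W \<and> p \<cdot>\<^bsub>?S\<^esub> h = r \<and> q \<cdot>\<^bsub>?S\<^esub> h = s"
    using assms unfolding is_pullback_def by blast
  show ?thesis
  proof (rule that[OF H])
    fix w assume "w \<in> W"
    then show "body f (body p w) = body g (body q w)"
      using Comp_Sets_eqD[OF comm H(1,2)] by simp
  next
    fix x y assume xy: "x \<in> X" "y \<in> Y" and eq: "body f x = body g y"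
    let ?V = "{x}" and ?r = "mor {x} X (\<lambda>_. x)" and ?s = "mor {x} Y (\<lambda>_. y)"
    have small: "small X" "small Y" "small W" "small Z" "small ?V"
      using H by (auto simp: Hom_Sets_iff small_finite)
    have rs: "?r \<in> Hom ?S ?V X" "?s \<in> Hom ?S ?V Y"
      using xy small by (auto intro!: mor_in_Hom)
    have "f \<cdot>\<^bsub>?S\<^esub> ?r = g \<cdot>\<^bsub>?S\<^esub> ?s"
      by (rule Hom_Sets_eqI[OF Comp_Sets_in_Hom[OF rs(1) H(3)] Comp_Sets_in_Hom[OF rs(2) H(4)]])
        (use eq in simp)
    then have "\<exists>!h. h \<in> Hom ?S ?V W \<and> p \<cdot>\<^bsub>?S\<^esub> h = ?r \<and> q \<cdot>\<^bsub>?S\<^esub> h = ?s"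
      using small(5) by (intro univ rs) auto
    then obtain h where h: "h \<in> Hom ?S ?V W" "p \<cdot>\<^bsub>?S\<^esub> h = ?r" "q \<cdot>\<^bsub>?S\<^esub> h = ?s"
      and uniq: "\<And>h'. h' \<in> Hom ?S ?V W \<Longrightarrow> p \<cdot>\<^bsub>?S\<^esub> h' = ?r \<Longrightarrow> q \<cdot>\<^bsub>?S\<^esub> h' = ?s \<Longrightarrow> h' = h"
      by (elim ex1E) blast
    show "\<exists>!w. w \<in> W \<and> body p w = x \<and> body q w = y"
    proof (intro ex1I conjI)
      show "body h x \<in> W" using h(1) by (auto simp: Hom_Sets_iff)
      show "body p (body h x) = x" "body q (body h x) = y"
        using h(2,3) body_Comp_Sets[of x h small p] body_Comp_Sets[of x h small q] h(1)
        by (auto simp: Hom_Sets_iff)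
      fix w assume w: "w \<in> W \<and> body p w = x \<and> body q w = y"
      have wH: "mor ?V W (\<lambda>_. w) \<in> Hom ?S ?V W" using w small by (auto intro!: mor_in_Hom)
      have "mor ?V W (\<lambda>_. w) = h"
        by (rule uniq[OF wH]; rule Hom_Sets_eqI) 
          (use w Comp_Sets_in_Hom[OF wH] H rs in auto)
      then show "w = body h x" by (metis mor_sel(3) singletonI)
    qed
  qed
qed

text \<open>The mediating map is chosen pointwise; it is unique because \<open>p\<close> and
  \<open>q\<close> are jointly injective.\<close>

lemma is_pullback_SetsI:
  assumes H: "p \<in> Hom (Sets small) W X" "q \<in> Hom (Sets small) W Y"
    "f \<in> Hom (Sets small) X Z" "g \<in> Hom (Sets small) Y Z"
    and comm: "\<And>w. w \<in> W \<Longrightarrow> body f (body p w) = body g (body q w)"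
    and ex: "\<And>x y. x \<in> X \<Longrightarrow> y \<in> Y \<Longrightarrow> body f x = body g y \<Longrightarrow> \<exists>w\<in>W. body p w = x \<and> body q w = y"
    and uniq: "\<And>w w'. w \<in> W \<Longrightarrow> w' \<in> W \<Longrightarrow> body p w = body p w' \<Longrightarrow> body q w = body q w' \<Longrightarrow> w = w'"
  shows "is_pullback (Sets small) p q f g"
proof -
  let ?S = "Sets small"
  have small: "small W" "small X" "small Y" "small Z" using H by (auto simp: Hom_Sets_iff)
  have "\<exists>!h. h \<in> Hom ?S V W \<and> p \<cdot>\<^bsub>?S\<^esub> h = r \<and> q \<cdot>\<^bsub>?S\<^esub> h = s"
    if V: "small V" and r: "r \<in> Hom ?S V X" and s: "s \<in> Hom ?S V Y"
      and rs: "f \<cdot>\<^bsub>?S\<^esub> r = g \<cdot>\<^bsub>?S\<^esub> s" for V r s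
  proof -
    have "\<exists>w\<in>W. body p w = body r v \<and> body q w = body s v" if v: "v \<in> V" for v
    proof (rule ex)
      show "body r v \<in> X" "body s v \<in> Y" using r s v by (auto simp: Hom_Sets_iff)
      show "body f (body r v) = body g (body s v)"
        using Comp_Sets_eqD[OF rs r s v] .
    qed
    then obtain h where h: "\<And>v. v \<in> V \<Longrightarrow> h v \<in> W \<and> body p (h v) = body r v \<and> body q (h v) = body s v"
      by metis
    have hH: "mor V W h \<in> Hom ?S V W" using h V small by (auto intro!: mor_in_Hom)
    show ?thesis
    proof (intro ex1I conjI)
      show "mor V W h \<in> Hom ?S V W" by (rule hH)
      show "p \<cdot>\<^bsub>?S\<^esub> mor V W h = r"
        by (rule Hom_Sets_eqI[OF Comp_Sets_in_Hom[OF hH H(1)] r]) (simp add: h)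
      show "q \<cdot>\<^bsub>?S\<^esub> mor V W h = s"
        by (rule Hom_Sets_eqI[OF Comp_Sets_in_Hom[OF hH H(2)] s]) (simp add: h)
      fix h' assume h': "h' \<in> Hom ?S V W \<and> p \<cdot>\<^bsub>?S\<^esub> h' = r \<and> q \<cdot>\<^bsub>?S\<^esub> h' = s"
      show "h' = mor V W h"
      proof (rule Hom_Sets_eqI[OF _ hH])
        show "h' \<in> Hom ?S V W" using h' by simp
        fix v assume v: "v \<in> V"
        have "src h' = V" using h' by (simp add: Hom_Sets_iff)
        then have *: "body p (body h' v) = body r v" "body q (body h' v) = body s v"
          using h' v by (auto simp flip: body_Comp_Sets[of v h' small])
        have "body h' v \<in> W" using h' v by (auto simp: Hom_Sets_iff)
        then have "body h' v = h v" by (rule uniq) (simp_all add: h[OF v] *)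
        then show "body h' v = body (mor V W h) v" using v by simp
      qed
    qed
  qed
  moreover have "f \<cdot>\<^bsub>?S\<^esub> p = g \<cdot>\<^bsub>?S\<^esub> q"
    by (rule Hom_Sets_eqI[OF Comp_Sets_in_Hom[OF H(1,3)] Comp_Sets_in_Hom[OF H(2,4)]])
      (use H comm in \<open>auto simp: Hom_Sets_iff\<close>)
  ultimately show ?thesis
    using H small unfolding is_pullback_def Obj_Sets by (intro bexI[of _ W] bexI[of _ X] bexI[of _ Y] bexI[of _ Z]) auto
qed

end

section \<open>Filtered colimits of sets\<close>

locale filtered_diagram = set_universe small + set_valued J small D
  for small :: "'u set \<Rightarrow> bool" and J :: "('j, 'k) cat"
    and D :: "('j, 'k, 'u set, 'u setarr) func" +
  assumes filtered: "is_filtered J"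
begin

lemma upper_bound:
  assumes "i \<in> Obj J" "j \<in> Obj J"
  obtains k f g where "k \<in> Obj J" "f \<in> Hom J i k" "g \<in> Hom J j k"
  using filtered assms unfolding is_filtered_def by blast

lemma coequalize:
  assumes "f \<in> Hom J i j" "g \<in> Hom J i j"
  obtains k h where "h \<in> Hom J j k" "h \<cdot>\<^bsub>J\<^esub> f = h \<cdot>\<^bsub>J\<^esub> g"
proof -
  have "i \<in> Obj J" "j \<in> Obj J" using assms C.Dom_in_Obj C.Cod_in_Obj by (auto simp: Hom_iff)
  then show ?thesis using filtered assms that unfolding is_filtered_def by blast
qed

lemma Hom_Obj: "f \<in> Hom J i j \<Longrightarrow> i \<in> Obj J \<and> j \<in> Obj J"
  using C.Dom_in_Obj C.Cod_in_Obj by (auto simp: Hom_iff)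

definition dmap :: "'k \<Rightarrow> 'u \<Rightarrow> 'u" where
  "dmap h x = body (FArr D h) x"

lemma dmap_in: "h \<in> Hom J i j \<Longrightarrow> x \<in> FObj D i \<Longrightarrow> dmap h x \<in> FObj D j"
  unfolding dmap_def by (rule body_in)

lemma dmap_Comp: "f \<in> Hom J i j \<Longrightarrow> g \<in> Hom J j k \<Longrightarrow> x \<in> FObj D i \<Longrightarrow>
    dmap (g \<cdot>\<^bsub>J\<^esub> f) x = dmap g (dmap f x)"
  unfolding dmap_def by (rule body_Comp)

lemma cocone_in:
  "is_cocone J (Sets small) D c \<iota> \<Longrightarrow> j \<in> Obj J \<Longrightarrow> x \<in> FObj D j \<Longrightarrow> body (\<iota> j) x \<in> c"
  by (auto simp: is_cocone_def intro: Hom_Sets_body)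

lemma cocone_dmap:
  assumes "is_cocone J (Sets small) D c \<iota>" "h \<in> Hom J i j" "x \<in> FObj D i"
  shows "body (\<iota> j) (dmap h x) = body (\<iota> i) x"
proof -
  have "\<iota> j \<cdot>\<^bsub>Sets small\<^esub> FArr D h = \<iota> i" using assms by (auto simp: is_cocone_def Hom_iff)
  then show ?thesis
    using assms src_tgt_FArr[OF assms(2)] body_Comp_Sets[of x "FArr D h" small "\<iota> j"]
    by (simp add: dmap_def)
qed

lemma is_coconeI:
  assumes c: "small c" and \<iota>: "\<And>j. j \<in> Obj J \<Longrightarrow> \<iota> j \<in> Hom (Sets small) (FObj D j) c"
    and nat: "\<And>h i j x. h \<in> Hom J i j \<Longrightarrow> x \<in> FObj D i \<Longrightarrow> body (\<iota> j) (dmap h x) = body (\<iota> i) x"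
  shows "is_cocone J (Sets small) D c \<iota>"
  unfolding is_cocone_def
proof (intro conjI ballI)
  fix h assume "h \<in> Arr J"
  then have h: "h \<in> Hom J (Dom J h) (Cod J h)" by (simp add: Hom_iff)
  show "\<iota> (Cod J h) \<cdot>\<^bsub>Sets small\<^esub> FArr D h = \<iota> (Dom J h)"
    by (rule Hom_Sets_eqI[OF Comp_Sets_in_Hom[OF FArr_in_Hom[OF h]]])
      (use \<iota> Hom_Obj[OF h] nat[OF h] src_tgt_FArr[OF h] in \<open>auto simp: dmap_def\<close>)
qed (use assms in auto)

text \<open>Together with \<open>eventually_inj\<close> this is the concrete criterion for a cocone
  over a filtered diagram of sets to be a colimit; both directions are proved below.\<close>

definition jointly_surj :: "'u set \<Rightarrow> ('j \<Rightarrow> 'u setarr) \<Rightarrow> bool" where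
  "jointly_surj c \<iota> \<longleftrightarrow> (\<forall>z\<in>c. \<exists>j\<in>Obj J. \<exists>x\<in>FObj D j. body (\<iota> j) x = z)"

text \<open>Only elements at the same stage are compared: filteredness moves elements at different
  stages to a common one first.\<close>

definition eventually_inj :: "('j \<Rightarrow> 'u setarr) \<Rightarrow> bool" where
  "eventually_inj \<iota> \<longleftrightarrow> (\<forall>j\<in>Obj J. \<forall>x\<in>FObj D j. \<forall>y\<in>FObj D j. body (\<iota> j) x = body (\<iota> j) y \<longrightarrow>
     (\<exists>k. \<exists>h\<in>Hom J j k. dmap h x = dmap h y))"

text \<open>Both \<open>g\<close> and \<open>h\<close> mediate to the cocone formed by the legs
  followed by \<open>g\<close>, and a colimit admits only one mediating map.\<close>

lemma colimit_mor_eq: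
  assumes "is_colimit J (Sets small) D c \<iota>" "small d" "g \<in> c \<rightarrow> d" "h \<in> c \<rightarrow> d"
    and eq: "\<And>j x. j \<in> Obj J \<Longrightarrow> x \<in> FObj D j \<Longrightarrow> g (body (\<iota> j) x) = h (body (\<iota> j) x)"
    and z: "z \<in> c"
  shows "g z = h z"
proof -
  let ?S = "Sets small"
  have cocone: "is_cocone J ?S D c \<iota>" using assms(1) by (simp add: is_colimit_def)
  then have c: "small c" and \<iota>: "\<And>j. j \<in> Obj J \<Longrightarrow> \<iota> j \<in> Hom ?S (FObj D j) c"
    by (auto simp: is_cocone_def)
  have gh: "mor c d g \<in> Hom ?S c d" "mor c d h \<in> Hom ?S c d" using assms c by (auto intro: mor_in_Hom)
  let ?\<kappa> = "\<lambda>j. mor c d g \<cdot>\<^bsub>?S\<^esub> \<iota> j"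
  have \<kappa>: "?\<kappa> j \<in> Hom ?S (FObj D j) d" if "j \<in> Obj J" for j
    using Comp_Sets_in_Hom[OF \<iota>[OF that] gh(1)] .
  have \<kappa>_body: "body (?\<kappa> j) x = g (body (\<iota> j) x)" if "j \<in> Obj J" "x \<in> FObj D j" for j x
    using \<iota>[OF that(1)] that(2) cocone_in[OF cocone that] by (simp add: Hom_Sets_iff)
  have "is_cocone J ?S D d ?\<kappa>"
  proof (rule is_coconeI[OF \<open>small d\<close> \<kappa>])
    fix u i j x assume u: "u \<in> Hom J i j" and x: "x \<in> FObj D i"
    show "body (?\<kappa> j) (dmap u x) = body (?\<kappa> i) x"
      using \<kappa>_body[OF _ dmap_in[OF u x]] \<kappa>_body[OF _ x] Hom_Obj[OF u] cocone_dmap[OF cocone u x] by simp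
  qed
  then have "\<exists>!h. h \<in> Hom ?S c d \<and> (\<forall>j \<in> Obj J. h \<cdot>\<^bsub>?S\<^esub> \<iota> j = ?\<kappa> j)"
    using assms(1) by (simp add: is_colimit_def)
  moreover have "mor c d h \<cdot>\<^bsub>?S\<^esub> \<iota> j = ?\<kappa> j" if "j \<in> Obj J" for j
  proof (rule Hom_Sets_eqI[OF Comp_Sets_in_Hom[OF \<iota>[OF that] gh(2)] \<kappa>[OF that]])
    fix x assume "x \<in> FObj D j"
    then show "body (mor c d h \<cdot>\<^bsub>?S\<^esub> \<iota> j) x = body (?\<kappa> j) x"
      using eq[OF that] \<iota>[OF that] \<kappa>_body[OF that] cocone_in[OF cocone that] by (simp add: Hom_Sets_iff)
  qed
  ultimately have "mor c d g = mor c d h" using gh by blast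
  then show ?thesis using z by (metis mor_sel(3))
qed

lemma ex_two_points: "\<exists>s t :: 'u. s \<noteq> t"
  using ex_new_if_finite[OF infinite_UNIV_universe, of "{undefined}"] by auto

text \<open>If no leg hits \<open>z\<close>, the constant map with value \<open>s\<close> and its
  modification at \<open>z\<close> agree on all legs, so they would have to be equal.\<close>

lemma colimit_jointly_surj:
  assumes "is_colimit J (Sets small) D c \<iota>"
  shows "jointly_surj c \<iota>"
  unfolding jointly_surj_def
proof (rule ballI, rule ccontr)
  fix z assume z: "z \<in> c" and no: "\<not> (\<exists>j\<in>Obj J. \<exists>x\<in>FObj D j. body (\<iota> j) x = z)"
  obtain s t :: 'u where st: "s \<noteq> t" using ex_two_points by blast
  have "(\<lambda>_. s) z = (\<lambda>w. if w = z then t else s) z"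
    by (rule colimit_mor_eq[OF assms, of "{s, t}"]) (use no z in \<open>auto intro: small_finite\<close>)
  then show False using st by simp
qed

text \<open>
  The element \<open>x\<close> of \<open>D i\<close> classifies, by a cocone into a two-element set, the elements that get
  identified with it at some stage.
\<close>

lemma colimit_eventually_inj:
  assumes colim: "is_colimit J (Sets small) D c \<iota>"
  shows "eventually_inj \<iota>"
  unfolding eventually_inj_def
proof (intro ballI impI)
  fix i x y assume i: "i \<in> Obj J" and x: "x \<in> FObj D i" and y: "y \<in> FObj D i"
    and eq: "body (\<iota> i) x = body (\<iota> i) y"
  let ?S = "Sets small"
  obtain s t :: 'u where st: "s \<noteq> t" using ex_two_points by blast
  \<comment> \<open>\<open>E j w\<close> means that transition maps out of \<open>j\<close> and
    \<open>i\<close> bring \<open>w\<close> and \<open>x\<close> together. The legs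
    \<open>?\<kappa>\<close> are the characteristic maps of \<open>E\<close>, with \<open>t\<close>
    for true and \<open>s\<close> for false.\<close>
  define E where "E j w \<longleftrightarrow> (\<exists>k. \<exists>u\<in>Hom J j k. \<exists>v\<in>Hom J i k. dmap u w = dmap v x)" for j w
  let ?\<kappa> = "\<lambda>j. mor (FObj D j) {s, t} (\<lambda>w. if E j w then t else s)"
  have \<kappa>: "?\<kappa> j \<in> Hom ?S (FObj D j) {s, t}" if "j \<in> Obj J" for j
    using small_FObj[OF that] by (intro mor_in_Hom) (auto intro: small_finite)
  have E: "E j' (dmap h w) \<longleftrightarrow> E j w" if h: "h \<in> Hom J j j'" and w: "w \<in> FObj D j" for h j j' w
  proof
    assume "E j' (dmap h w)"
    then obtain k u v where "u \<in> Hom J j' k" "v \<in> Hom J i k" "dmap u (dmap h w) = dmap v x"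
      by (auto simp: E_def)
    then show "E j w"
      unfolding E_def using h w C.Comp_in_Hom[OF h] by (metis dmap_Comp)
  next
    assume "E j w"
    then obtain k u v where uv: "u \<in> Hom J j k" "v \<in> Hom J i k" "dmap u w = dmap v x"
      by (auto simp: E_def)
    \<comment> \<open>The witness for \<open>w\<close> lies over \<open>k\<close>, its image
      \<open>dmap h w\<close> over \<open>j'\<close>. A common stage \<open>l\<close> alone does not
      suffice, since the two routes from \<open>j\<close> to \<open>l\<close> may differ;
      \<open>r\<close> makes them equal.\<close>
    obtain l p q where pq: "p \<in> Hom J k l" "q \<in> Hom J j' l"
      using upper_bound Hom_Obj uv(1) h by metis
    obtain m r where r: "r \<in> Hom J l m" "r \<cdot>\<^bsub>J\<^esub> (p \<cdot>\<^bsub>J\<^esub> u) = r \<cdot>\<^bsub>J\<^esub> (q \<cdot>\<^bsub>J\<^esub> h)"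
      using coequalize[OF C.Comp_in_Hom[OF uv(1) pq(1)] C.Comp_in_Hom[OF h pq(2)]] by metis
    have "dmap (r \<cdot>\<^bsub>J\<^esub> q) (dmap h w) = dmap (r \<cdot>\<^bsub>J\<^esub> (q \<cdot>\<^bsub>J\<^esub> h)) w"
      using dmap_Comp[OF h C.Comp_in_Hom[OF pq(2) r(1)] w] C.Comp_assoc[OF h pq(2) r(1)] by simp
    also have "\<dots> = dmap (r \<cdot>\<^bsub>J\<^esub> p) (dmap u w)"
      using dmap_Comp[OF uv(1) C.Comp_in_Hom[OF pq(1) r(1)] w] C.Comp_assoc[OF uv(1) pq(1) r(1)] r(2) by simp
    also have "\<dots> = dmap ((r \<cdot>\<^bsub>J\<^esub> p) \<cdot>\<^bsub>J\<^esub> v) x"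
      using dmap_Comp[OF uv(2) C.Comp_in_Hom[OF pq(1) r(1)] x] uv(3) by simp
    finally show "E j' (dmap h w)"
      unfolding E_def using C.Comp_in_Hom[OF pq(2) r(1)]
        C.Comp_in_Hom[OF uv(2) C.Comp_in_Hom[OF pq(1) r(1)]] by blast
  qed
  have "is_cocone J ?S D {s, t} ?\<kappa>"
    by (rule is_coconeI[OF _ \<kappa>]) (auto intro: small_finite simp: dmap_in E)
  then have "\<exists>!g. g \<in> Hom ?S c {s, t} \<and> (\<forall>j \<in> Obj J. g \<cdot>\<^bsub>?S\<^esub> \<iota> j = ?\<kappa> j)"
    using colim unfolding is_colimit_def by blast
  then obtain g where g: "g \<in> Hom ?S c {s, t}" "\<And>j. j \<in> Obj J \<Longrightarrow> g \<cdot>\<^bsub>?S\<^esub> \<iota> j = ?\<kappa> j"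
    by blast
  have \<kappa>g: "body (?\<kappa> i) w = body g (body (\<iota> i) w)" if "w \<in> FObj D i" for w
  proof -
    have "\<iota> i \<in> Hom ?S (FObj D i) c" using colim i by (simp add: is_colimit_def is_cocone_def)
    then have "w \<in> src (\<iota> i)" using that by (simp add: Hom_Sets_iff)
    then show ?thesis using g(2)[OF i] by (metis body_Comp_Sets)
  qed
  \<comment> \<open>\<open>x\<close> is related to itself by the identity. The classifying map
    factors through the legs, which do not separate \<open>x\<close> from \<open>y\<close>, so
    \<open>y\<close> also receives the value \<open>t\<close>.\<close>
  have "E i x" unfolding E_def using C.Ide_in_Hom[OF i] by blast
  then have "E i y"
    using \<kappa>g[OF x] \<kappa>g[OF y] eq x y st by (auto split: if_splits)
  then obtain k u v where uv: "u \<in> Hom J i k" "v \<in> Hom J i k" "dmap u y = dmap v x"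
    by (auto simp: E_def)
  \<comment> \<open>The maps \<open>u\<close> and \<open>v\<close> that bring \<open>y\<close> and
    \<open>x\<close> together may differ; once they are coequalized, a single map identifies both
    elements.\<close>
  obtain m r where r: "r \<in> Hom J k m" "r \<cdot>\<^bsub>J\<^esub> u = r \<cdot>\<^bsub>J\<^esub> v"
    using coequalize[OF uv(1,2)] by metis
  have "dmap (r \<cdot>\<^bsub>J\<^esub> u) x = dmap (r \<cdot>\<^bsub>J\<^esub> u) y"
    using dmap_Comp[OF uv(1) r(1) y] dmap_Comp[OF uv(2) r(1) x] r(2) uv(3) by simp
  then show "\<exists>k. \<exists>h\<in>Hom J i k. dmap h x = dmap h y"
    using C.Comp_in_Hom[OF uv(1) r(1)] by blast
qed

text \<open>A map out of \<open>c\<close> is defined through chosen representatives at some stage.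
  The fact \<open>wd\<close> shows independence of the choice: representatives are moved to a common
  stage and then identified at a later one.\<close>

lemma is_colimitI:
  assumes cocone: "is_cocone J (Sets small) D c \<iota>" and surj: "jointly_surj c \<iota>"
    and inj: "eventually_inj \<iota>"
  shows "is_colimit J (Sets small) D c \<iota>"
  unfolding is_colimit_def
proof (intro conjI allI impI)
  let ?S = "Sets small"
  show "is_cocone J ?S D c \<iota>" by fact
  fix d \<kappa> assume d: "is_cocone J ?S D d \<kappa>"
  have \<iota>: "\<iota> j \<in> Hom ?S (FObj D j) c" and \<kappa>: "\<kappa> j \<in> Hom ?S (FObj D j) d" if "j \<in> Obj J" for j
    using cocone d that by (auto simp: is_cocone_def)
  have small: "small c" "small d" using cocone d by (auto simp: is_cocone_def)
  have wd: "body (\<kappa> i) x = body (\<kappa> j) y"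
    if i: "i \<in> Obj J" "x \<in> FObj D i" and j: "j \<in> Obj J" "y \<in> FObj D j"
      and eq: "body (\<iota> i) x = body (\<iota> j) y" for i j x y
  proof -
    obtain k u v where k: "k \<in> Obj J" and u: "u \<in> Hom J i k" and v: "v \<in> Hom J j k"
      using upper_bound[OF i(1) j(1)] by metis
    have "body (\<iota> k) (dmap u x) = body (\<iota> k) (dmap v y)"
      using cocone_dmap[OF cocone u i(2)] cocone_dmap[OF cocone v j(2)] eq by simp
    then obtain l h where h: "h \<in> Hom J k l" "dmap h (dmap u x) = dmap h (dmap v y)"
      using inj k dmap_in[OF u i(2)] dmap_in[OF v j(2)] unfolding eventually_inj_def by blast
    then show ?thesis
      using cocone_dmap[OF d u i(2)] cocone_dmap[OF d v j(2)]
        cocone_dmap[OF d h(1) dmap_in[OF u i(2)]] cocone_dmap[OF d h(1) dmap_in[OF v j(2)]] by simp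
  qed
  obtain j x where jx: "j z \<in> Obj J" "x z \<in> FObj D (j z)" "body (\<iota> (j z)) (x z) = z" if "z \<in> c" for z
    using surj unfolding jointly_surj_def by metis
  define g where "g z = body (\<kappa> (j z)) (x z)" for z
  have gH: "mor c d g \<in> Hom ?S c d"
    using small Hom_Sets_body[OF \<kappa>[OF jx(1)] jx(2)] by (intro mor_in_Hom) (auto simp: g_def)
  have g: "g (body (\<iota> i) y) = body (\<kappa> i) y" if "i \<in> Obj J" "y \<in> FObj D i" for i y
    unfolding g_def using cocone_in[OF cocone that] jx that by (intro wd) auto
  show "\<exists>!h. h \<in> Hom ?S c d \<and> (\<forall>j \<in> Obj J. h \<cdot>\<^bsub>?S\<^esub> \<iota> j = \<kappa> j)"
  proof (intro ex1I conjI ballI)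
    show "mor c d g \<in> Hom ?S c d" by (rule gH)
    show "mor c d g \<cdot>\<^bsub>?S\<^esub> \<iota> i = \<kappa> i" if "i \<in> Obj J" for i
    proof (rule Hom_Sets_eqI[OF Comp_Sets_in_Hom[OF \<iota>[OF that] gH] \<kappa>[OF that]])
      fix y assume "y \<in> FObj D i"
      then show "body (mor c d g \<cdot>\<^bsub>?S\<^esub> \<iota> i) y = body (\<kappa> i) y"
        using g[OF that] \<iota>[OF that] cocone_in[OF cocone that] by (simp add: Hom_Sets_iff)
    qed
    fix h assume h: "h \<in> Hom ?S c d \<and> (\<forall>j \<in> Obj J. h \<cdot>\<^bsub>?S\<^esub> \<iota> j = \<kappa> j)"
    show "h = mor c d g"
    proof (rule Hom_Sets_eqI[OF _ gH])
      show "h \<in> Hom ?S c d" using h by simp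
      fix z assume z: "z \<in> c"
      have "x z \<in> src (\<iota> (j z))" using jx[OF z] \<iota> by (simp add: Hom_Sets_iff)
      then have "body h (body (\<iota> (j z)) (x z)) = body (\<kappa> (j z)) (x z)"
        using h jx(1)[OF z] by (metis body_Comp_Sets)
      then show "body h z = body (mor c d g) z" using z jx[OF z] by (simp add: g_def)
    qed
  qed
qed

text \<open>Upper bounds merge the stages of the single points into one. An element [x, a] over
  \<open>c\<close> involves only finitely many points of \<open>c\<close>, so it can be lifted to a
  stage as a whole.\<close>

lemma finite_lift:
  assumes cocone: "is_cocone J (Sets small) D c \<iota>" and surj: "jointly_surj c \<iota>"
    and "finite S" "S \<subseteq> c"
  shows "\<exists>j\<in>Obj J. S \<subseteq> body (\<iota> j) ` FObj D j"
  using assms(3,4)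
proof induction
  case empty
  then show ?case using filtered by (auto simp: is_filtered_def)
next
  case (insert z S)
  then obtain i where i: "i \<in> Obj J" "S \<subseteq> body (\<iota> i) ` FObj D i" by auto
  obtain j x where j: "j \<in> Obj J" "x \<in> FObj D j" "body (\<iota> j) x = z"
    using surj insert.prems unfolding jointly_surj_def by auto
  obtain k u v where k: "k \<in> Obj J" and u: "u \<in> Hom J i k" and v: "v \<in> Hom J j k"
    using upper_bound[OF i(1) j(1)] by metis
  have "z \<in> body (\<iota> k) ` FObj D k"
    using cocone_dmap[OF cocone v j(2)] dmap_in[OF v j(2)] j(3) by (metis imageI)
  moreover have "body (\<iota> i) y \<in> body (\<iota> k) ` FObj D k" if "y \<in> FObj D i" for y
    using cocone_dmap[OF cocone u that] dmap_in[OF u that] by (metis imageI)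
  ultimately show ?case using i(2) k by blast
qed

text \<open>Pairs are identified one after the other; those already identified remain so under
  further transition maps.\<close>

lemma finite_identify:
  assumes cocone: "is_cocone J (Sets small) D c \<iota>" and inj: "eventually_inj \<iota>"
    and j: "j \<in> Obj J"
    and "finite P" "P \<subseteq> {(x, y). x \<in> FObj D j \<and> y \<in> FObj D j \<and> body (\<iota> j) x = body (\<iota> j) y}"
  shows "\<exists>k. \<exists>h\<in>Hom J j k. \<forall>(x, y)\<in>P. dmap h x = dmap h y"
  using assms(4,5)
proof induction
  case empty
  then show ?case using C.Ide_in_Hom[OF j] by blast
next
  case (insert p P)
  then obtain k h where h: "h \<in> Hom J j k" "\<forall>(x, y)\<in>P. dmap h x = dmap h y" by auto
  obtain x y where p: "p = (x, y)" "x \<in> FObj D j" "y \<in> FObj D j" "body (\<iota> j) x = body (\<iota> j) y"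
    using insert.prems by auto
  have "body (\<iota> k) (dmap h x) = body (\<iota> k) (dmap h y)"
    using p cocone_dmap[OF cocone h(1)] by simp
  then obtain l g where g: "g \<in> Hom J k l" "dmap g (dmap h x) = dmap g (dmap h y)"
    using inj Hom_Obj[OF h(1)] dmap_in[OF h(1)] p unfolding eventually_inj_def by blast
  have "\<forall>(x, y)\<in>insert p P. dmap (g \<cdot>\<^bsub>J\<^esub> h) x = dmap (g \<cdot>\<^bsub>J\<^esub> h) y"
  proof clarify
    fix a b assume ab: "(a, b) \<in> insert p P"
    then have "dmap g (dmap h a) = dmap g (dmap h b)" using h g p by auto
    moreover have "a \<in> FObj D j" "b \<in> FObj D j" using ab insert.prems by auto
    ultimately show "dmap (g \<cdot>\<^bsub>J\<^esub> h) a = dmap (g \<cdot>\<^bsub>J\<^esub> h) b"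
      by (simp add: dmap_Comp[OF h(1) g(1)])
  qed
  then show ?case using C.Comp_in_Hom[OF h(1) g(1)] by blast
qed

end


declare One_nat_def [simp del]

section \<open>Elements of the functor associated with a functor on surjections\<close>

text \<open>The image equation contains the range condition as well as surjectivity. Values outside
  \<open>{1..n}\<close> are arbitrary; \<open>restrict\<close> enters only when an arrow of
  \<open>Surj\<close> is formed.\<close>

definition onto :: "nat \<Rightarrow> nat \<Rightarrow> (nat \<Rightarrow> nat) \<Rightarrow> bool" where
  "onto n m \<alpha> \<longleftrightarrow> \<alpha> ` {1..n} = {1..m}"

definition act :: "'u surjfunc \<Rightarrow> nat \<Rightarrow> nat \<Rightarrow> (nat \<Rightarrow> nat) \<Rightarrow> 'u \<Rightarrow> 'u" where
  "act A n m \<alpha> a = body (FArr A (Arrow n m (restrict \<alpha> {1..n}))) a"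

text \<open>The factorization of \<open>x\<close> as a surjection followed by an injection, with the
  image numbered by \<open>{1..k}\<close>.\<close>

definition is_factorization :: "'u set \<Rightarrow> nat \<Rightarrow> (nat \<Rightarrow> 'u) \<Rightarrow> nat \<Rightarrow> (nat \<Rightarrow> 'u) \<Rightarrow> (nat \<Rightarrow> nat) \<Rightarrow> bool" where
  "is_factorization X n x k z \<alpha> \<longleftrightarrow> z \<in> {1..k} \<rightarrow> X \<and> inj_on z {1..k} \<and> onto n k \<alpha> \<and> (\<forall>i\<in>{1..n}. x i = z (\<alpha> i))"

text \<open>
  The class \<open>[x, a]\<close> extended to maps \<open>x\<close> that need not be injective: \<open>[z \<circ> \<alpha>, a]\<close> stands for
  \<open>[z, A(\<alpha>)(a)]\<close>. With this convention \<open>f\<close> acts by \<open>[x, a] \<mapsto> [f \<circ> x, a]\<close>.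
\<close>

definition gen :: "'u surjfunc \<Rightarrow> 'u set \<Rightarrow> nat \<Rightarrow> (nat \<Rightarrow> 'u) \<Rightarrow> 'u \<Rightarrow> 'u" where
  "gen A X n x a = (SOME v. \<exists>k z \<alpha>. is_factorization X n x k z \<alpha> \<and>
     v = cls A X k (restrict z {1..k}) (act A n k \<alpha> a))"

lemma onto_in: "onto n m \<alpha> \<Longrightarrow> i \<in> {1..n} \<Longrightarrow> \<alpha> i \<in> {1..m}"
  unfolding onto_def by blast

lemma onto_surj: "onto n m \<alpha> \<Longrightarrow> j \<in> {1..m} \<Longrightarrow> \<exists>i\<in>{1..n}. \<alpha> i = j"
  unfolding onto_def by (metis imageE)

lemma onto_comp: "onto n m \<alpha> \<Longrightarrow> onto m k \<beta> \<Longrightarrow> onto n k (\<lambda>i. \<beta> (\<alpha> i))"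
  unfolding onto_def by (metis image_image)

lemma onto_ident: "onto n n (\<lambda>i. i)"
  by (simp add: onto_def)

lemma Hom_Surj_iff: "f \<in> Hom Surj n m \<longleftrightarrow>
    src f = n \<and> tgt f = m \<and> body f \<in> extensional {1..n} \<and> onto n m (body f)"
  by (auto simp: Hom_iff Surj_def onto_def PiE_iff)

lemma Obj_Surj [simp]: "n \<in> Obj Surj"
  by (simp add: Surj_def)

lemma onto_in_Hom: "onto n m \<alpha> \<Longrightarrow> Arrow n m (restrict \<alpha> {1..n}) \<in> Hom Surj n m"
  unfolding Hom_Surj_iff by (simp add: onto_def)

text \<open>A surjection of a finite set onto itself is injective by counting, so permutations are
  just endomorphisms in \<open>Surj\<close>.\<close>

lemma Sym_iff: "\<sigma> \<in> Sym n \<longleftrightarrow> \<sigma> \<in> extensional {1..n} \<and> onto n n \<sigma>"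
proof -
  have "inj_on \<sigma> {1..n}" if "\<sigma> ` {1..n} = {1..n}"
    using that by (intro eq_card_imp_inj_on) auto
  then show ?thesis by (auto simp: Sym_def onto_def bij_betw_def PiE_iff)
qed

lemma Injections_iff: "x \<in> Injections n X \<longleftrightarrow> x \<in> extensional {1..n} \<and> x \<in> {1..n} \<rightarrow> X \<and> inj_on x {1..n}"
  by (auto simp: Injections_def PiE_iff)

lemma restrict_in_Injections:
  "x \<in> {1..n} \<rightarrow> X \<Longrightarrow> inj_on x {1..n} \<Longrightarrow> restrict x {1..n} \<in> Injections n X"
  by (auto simp: Injections_iff inj_on_restrict_eq)

text \<open>The image is numbered: \<open>k\<close> is the number of distinct values of
  \<open>x\<close>, \<open>z\<close> enumerates them from 1, and \<open>\<alpha>\<close> sends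
  \<open>i\<close> to the number of \<open>x i\<close>.\<close>

lemma ex_factorization:
  assumes "x \<in> {1..n} \<rightarrow> X"
  obtains k z \<alpha> where "is_factorization X n x k z \<alpha>"
proof -
  obtain z where z: "bij_betw z {1..card (x ` {1..n})} (x ` {1..n})"
    using ex_bij_betw_nat_finite_1[of "x ` {1..n}"] by auto
  let ?k = "card (x ` {1..n})" and ?\<alpha> = "\<lambda>i. inv_into {1..card (x ` {1..n})} z (x i)"
  have "z (?\<alpha> i) = x i" if "i \<in> {1..n}" for i
    using that by (intro bij_betw_inv_into_right[OF z]) auto
  moreover have "?\<alpha> ` {1..n} = inv_into {1..?k} z ` (x ` {1..n})" by (simp add: image_image)
  then have "onto n ?k ?\<alpha>"
    using bij_betw_imp_surj_on[OF bij_betw_inv_into[OF z]] by (simp add: onto_def)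
  moreover have "z \<in> {1..?k} \<rightarrow> X"
    using bij_betw_imp_surj_on[OF z] assms by (simp flip: image_subset_iff_funcset)
  ultimately show ?thesis
    using that[of ?k z ?\<alpha>] bij_betw_imp_inj_on[OF z] by (simp add: is_factorization_def)
qed

lemma is_factorization_ident:
  "x \<in> {1..n} \<rightarrow> X \<Longrightarrow> inj_on x {1..n} \<Longrightarrow> is_factorization X n x n x (\<lambda>i. i)"
  by (simp add: is_factorization_def onto_ident)

lemma is_factorization_comp:
  "is_factorization X m y k z \<beta> \<Longrightarrow> onto n m \<alpha> \<Longrightarrow> is_factorization X n (\<lambda>i. y (\<alpha> i)) k z (\<lambda>i. \<beta> (\<alpha> i))"
  using onto_in by (auto simp: is_factorization_def intro: onto_comp)

lemma is_factorization_cong: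
  "is_factorization X n x k z \<alpha> \<Longrightarrow> (\<And>i. i \<in> {1..n} \<Longrightarrow> x i = y i) \<Longrightarrow> is_factorization X n y k z \<alpha>"
  by (auto simp: is_factorization_def)

text \<open>The injections \<open>z\<close> and \<open>w\<close> both have the image of
  \<open>x\<close>. Hence \<open>k = l\<close>, and \<open>z\<close> followed by the inverse of
  \<open>w\<close> is the comparison permutation.\<close>

lemma is_factorization_unique:
  assumes "is_factorization X n x k z \<alpha>" "is_factorization X n x l w \<beta>"
  shows "k = l" "\<exists>\<sigma>. onto k l \<sigma> \<and> (\<forall>i\<in>{1..k}. z i = w (\<sigma> i)) \<and> (\<forall>i\<in>{1..n}. \<sigma> (\<alpha> i) = \<beta> i)"
proof -
  have im: "z ` {1..k} = x ` {1..n}" "w ` {1..l} = x ` {1..n}"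
  proof -
    have "x ` {1..n} = z ` \<alpha> ` {1..n}" "x ` {1..n} = w ` \<beta> ` {1..n}"
      using assms by (simp_all add: is_factorization_def image_image)
    then show "z ` {1..k} = x ` {1..n}" "w ` {1..l} = x ` {1..n}"
      using assms by (simp_all add: is_factorization_def onto_def)
  qed
  have inj: "inj_on z {1..k}" "inj_on w {1..l}" using assms by (simp_all add: is_factorization_def)
  show "k = l" using im card_image[OF inj(1)] card_image[OF inj(2)] by simp
  let ?\<sigma> = "\<lambda>i. inv_into {1..l} w (z i)"
  have \<sigma>: "?\<sigma> (\<alpha> i) = \<beta> i" if "i \<in> {1..n}" for i
  proof -
    have "z (\<alpha> i) = w (\<beta> i)" "\<beta> i \<in> {1..l}"
      using assms that onto_in[of n l \<beta> i] by (auto simp: is_factorization_def)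
    then show ?thesis using inv_into_f_f[OF inj(2)] by simp
  qed
  have "?\<sigma> ` {1..k} = (\<lambda>i. ?\<sigma> (\<alpha> i)) ` {1..n}"
    using assms(1) image_image[of ?\<sigma> \<alpha> "{1..n}"] by (simp add: is_factorization_def onto_def)
  also have "\<dots> = \<beta> ` {1..n}" using \<sigma> by (rule image_cong[OF refl])
  finally have "onto k l ?\<sigma>" using assms(2) by (simp add: is_factorization_def onto_def)
  moreover have "z i = w (?\<sigma> i)" if "i \<in> {1..k}" for i
    using im that by (metis f_inv_into_f imageI)
  ultimately show "\<exists>\<sigma>. onto k l \<sigma> \<and> (\<forall>i\<in>{1..k}. z i = w (\<sigma> i)) \<and> (\<forall>i\<in>{1..n}. \<sigma> (\<alpha> i) = \<beta> i)"
    using \<sigma> by blast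
qed

locale surj_functor = set_universe small + set_valued Surj small A
  for small :: "'u set \<Rightarrow> bool" and A :: "'u surjfunc"
begin

lemma act_in: "onto n m \<alpha> \<Longrightarrow> a \<in> FObj A n \<Longrightarrow> act A n m \<alpha> a \<in> FObj A m"
  unfolding act_def by (rule body_in[OF onto_in_Hom])

lemma act_cong: "(\<And>i. i \<in> {1..n} \<Longrightarrow> \<alpha> i = \<beta> i) \<Longrightarrow> act A n m \<alpha> a = act A n m \<beta> a"
  unfolding act_def by (simp cong: restrict_cong)

lemma act_act:
  assumes "onto n m \<alpha>" "onto m k \<beta>" "a \<in> FObj A n"
  shows "act A m k \<beta> (act A n m \<alpha> a) = act A n k (\<lambda>i. \<beta> (\<alpha> i)) a"
proof -
  have "compose {1..n} (restrict \<beta> {1..m}) (restrict \<alpha> {1..n}) = restrict (\<lambda>i. \<beta> (\<alpha> i)) {1..n}"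
    using onto_in[OF assms(1)] by (auto simp: compose_def simp del: atLeastAtMost_iff)
  then show ?thesis
    using body_Comp[OF onto_in_Hom[OF assms(1)] onto_in_Hom[OF assms(2)] assms(3)]
    by (simp add: act_def Surj_def)
qed

lemma act_ident: "a \<in> FObj A n \<Longrightarrow> (\<And>i. i \<in> {1..n} \<Longrightarrow> \<alpha> i = i) \<Longrightarrow> act A n n \<alpha> a = a"
  using body_Ide[of n a] act_cong[of n \<alpha> "\<lambda>i. i" n a] by (simp add: act_def Surj_def)

lemma equiv_A: "equiv (Injections n X \<times> FObj A n) (tensor_rel A X n)"
  by (rule equiv_tensor_rel[OF is_functor_axioms])

text \<open>The coding is injective on classes, and the tensor relation is an equivalence, so
  equality of codes is the relation itself. Later arguments about equal classes rest on this
  criterion and not on the coding.\<close>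

lemma cls_eq_iff:
  assumes x: "x \<in> {1..n} \<rightarrow> X" "inj_on x {1..n}" "a \<in> FObj A n"
    and y: "y \<in> {1..m} \<rightarrow> X" "inj_on y {1..m}" "b \<in> FObj A m"
  shows "cls A X n (restrict x {1..n}) a = cls A X m (restrict y {1..m}) b \<longleftrightarrow>
    n = m \<and> (\<exists>\<sigma>. onto n n \<sigma> \<and> (\<forall>i\<in>{1..n}. x i = y (\<sigma> i)) \<and> b = act A n n \<sigma> a)"
proof -
  let ?x = "restrict x {1..n}" and ?y = "restrict y {1..m}"
  have "cls A X n ?x a = cls A X m ?y b \<longleftrightarrow>
      n = m \<and> tensor_rel A X n `` {(?x, a)} = tensor_rel A X n `` {(?y, b)}"
    unfolding cls_def
    using inj_on_eq_iff[OF inj_on_encode] tensor_class_codable[OF restrict_in_Injections[OF x(1,2)]]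
      tensor_class_codable[OF restrict_in_Injections[OF y(1,2)]] by (metis Pair_inject)
  also have "\<dots> \<longleftrightarrow> n = m \<and> ((?x, a), (?y, b)) \<in> tensor_rel A X n"
    using eq_equiv_class_iff[OF equiv_A, of "(?x, a)" n X "(?y, b)"]
      restrict_in_Injections[OF x(1,2)] restrict_in_Injections[OF y(1,2)] x(3) y(3) by auto
  also have "\<dots> \<longleftrightarrow> n = m \<and> (\<exists>\<sigma>. onto n n \<sigma> \<and> (\<forall>i\<in>{1..n}. x i = y (\<sigma> i)) \<and> b = act A n n \<sigma> a)"
  proof (rule conj_cong[OF refl])
    assume nm: "n = m"
    have y': "?y \<in> Injections n X" using restrict_in_Injections[OF y(1,2)] nm by simp
    have comp: "?x = compose {1..n} ?y \<sigma> \<longleftrightarrow> (\<forall>i\<in>{1..n}. x i = y (\<sigma> i))" if "onto n n \<sigma>" for \<sigma>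
      using onto_in[OF that] nm by (auto simp: compose_def fun_eq_iff simp del: atLeastAtMost_iff)
    show "((?x, a), (?y, b)) \<in> tensor_rel A X n \<longleftrightarrow>
        (\<exists>\<sigma>. onto n n \<sigma> \<and> (\<forall>i\<in>{1..n}. x i = y (\<sigma> i)) \<and> b = act A n n \<sigma> a)"
    proof
      assume "((?x, a), (?y, b)) \<in> tensor_rel A X n"
      then obtain \<sigma> where "\<sigma> \<in> Sym n" "?x = compose {1..n} ?y \<sigma>" "b = body (FArr A (Arrow n n \<sigma>)) a"
        unfolding tensor_rel_def by blast
      then show "\<exists>\<sigma>. onto n n \<sigma> \<and> (\<forall>i\<in>{1..n}. x i = y (\<sigma> i)) \<and> b = act A n n \<sigma> a"
        using comp by (auto simp: Sym_iff act_def extensional_restrict intro!: exI[of _ \<sigma>])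
    next
      assume "\<exists>\<sigma>. onto n n \<sigma> \<and> (\<forall>i\<in>{1..n}. x i = y (\<sigma> i)) \<and> b = act A n n \<sigma> a"
      then obtain \<sigma> where \<sigma>: "onto n n \<sigma>" "\<forall>i\<in>{1..n}. x i = y (\<sigma> i)" "b = act A n n \<sigma> a" by blast
      let ?\<sigma> = "restrict \<sigma> {1..n}"
      have on: "onto n n ?\<sigma>" using \<sigma>(1) by (simp add: onto_def)
      have "?x = compose {1..n} ?y ?\<sigma>" using \<sigma>(2) by (subst comp[OF on]) simp
      moreover have "?\<sigma> \<in> Sym n" using on by (simp add: Sym_iff)
      moreover have "b = body (FArr A (Arrow n n ?\<sigma>)) a" using \<sigma>(3) by (simp add: act_def)
      ultimately show "((?x, a), (?y, b)) \<in> tensor_rel A X n"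
        using y' x(3) unfolding tensor_rel_def by blast
    qed
  qed
  finally show ?thesis .
qed

text \<open>The permutation comparing the two factorizations carries A(\<alpha>)(a) to
  A(\<beta>)(a), which is an instance of the tensor relation. The choice made in \<open>gen\<close>
  is therefore immaterial.\<close>

lemma cls_factorization:
  assumes "is_factorization X n x k z \<alpha>" "is_factorization X n x l w \<beta>" "a \<in> FObj A n"
  shows "cls A X k (restrict z {1..k}) (act A n k \<alpha> a) = cls A X l (restrict w {1..l}) (act A n l \<beta> a)"
proof -
  obtain \<sigma> where kl: "k = l" and \<sigma>: "onto k l \<sigma>" "\<forall>i\<in>{1..k}. z i = w (\<sigma> i)" "\<forall>i\<in>{1..n}. \<sigma> (\<alpha> i) = \<beta> i"
    using is_factorization_unique[OF assms(1,2)] by blast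
  have on: "onto n k \<alpha>" "onto n l \<beta>" using assms by (simp_all add: is_factorization_def)
  have "act A n l \<beta> a = act A k l \<sigma> (act A n k \<alpha> a)"
    using \<sigma> act_act[OF on(1) \<sigma>(1) assms(3)] act_cong[of n "\<lambda>i. \<sigma> (\<alpha> i)" \<beta>] by simp
  then show ?thesis
    using assms kl \<sigma> by (subst cls_eq_iff) (auto simp: is_factorization_def act_in)
qed

lemma gen_eq_cls:
  assumes "is_factorization X n x k z \<alpha>" "a \<in> FObj A n"
  shows "gen A X n x a = cls A X k (restrict z {1..k}) (act A n k \<alpha> a)"
  unfolding gen_def
  by (rule some_equality) (use assms cls_factorization[OF _ assms] in blast)+

lemma gen_inj_eq_cls:
  "x \<in> {1..n} \<rightarrow> X \<Longrightarrow> inj_on x {1..n} \<Longrightarrow> a \<in> FObj A n \<Longrightarrow>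
    gen A X n x a = cls A X n (restrict x {1..n}) a"
  using gen_eq_cls[OF is_factorization_ident] act_ident[of a n "\<lambda>i. i"] by simp

lemma gen_cong:
  assumes "x \<in> {1..n} \<rightarrow> X" "a \<in> FObj A n" "\<And>i. i \<in> {1..n} \<Longrightarrow> x i = y i"
  shows "gen A X n x a = gen A X n y a"
proof -
  obtain k z \<alpha> where f: "is_factorization X n x k z \<alpha>" using ex_factorization[OF assms(1)] .
  have "is_factorization X n y k z \<alpha>" using f assms(3) by (rule is_factorization_cong)
  then show ?thesis using gen_eq_cls f assms(2) by simp
qed

text \<open>A factorization of \<open>y\<close> precomposed with \<open>\<alpha>\<close> is a
  factorization of y \<circ> \<alpha>. In this way the relation imposed for permutations extends to
  all surjections \<open>\<alpha>\<close> and all maps \<open>y\<close>.\<close>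

lemma gen_act:
  assumes "y \<in> {1..m} \<rightarrow> X" "onto n m \<alpha>" "a \<in> FObj A n" 
  shows "gen A X n (\<lambda>i. y (\<alpha> i)) a = gen A X m y (act A n m \<alpha> a)"
proof -
  obtain k z \<beta> where f: "is_factorization X m y k z \<beta>" using ex_factorization[OF assms(1)] .
  then have "onto m k \<beta>" by (simp add: is_factorization_def)
  then show ?thesis
    using gen_eq_cls[OF f act_in[OF assms(2,3)]]
      gen_eq_cls[OF is_factorization_comp[OF f assms(2)] assms(3)] act_act[OF assms(2) _ assms(3)] by simp
qed

lemma hat_set_eq: "hat_set A X = {cls A X n x a | n x a. x \<in> Injections n X \<and> a \<in> FObj A n}"
  unfolding hat_set_def quotient_def cls_def by blast

lemma gen_factorization:
  assumes "is_factorization X n x k z \<alpha>" "a \<in> FObj A n"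
  shows "gen A X n x a = gen A X k z (act A n k \<alpha> a)"
proof -
  have z: "z \<in> {1..k} \<rightarrow> X" "inj_on z {1..k}" "onto n k \<alpha>" using assms by (simp_all add: is_factorization_def)
  then show ?thesis
    using gen_eq_cls[OF assms] gen_inj_eq_cls[OF z(1,2) act_in[OF z(3) assms(2)]] by simp
qed

lemma gen_in_hat_set:
  assumes "x \<in> {1..n} \<rightarrow> X" "a \<in> FObj A n"
  shows "gen A X n x a \<in> hat_set A X"
proof -
  obtain k z \<alpha> where f: "is_factorization X n x k z \<alpha>" using ex_factorization[OF assms(1)] .
  then have z: "z \<in> {1..k} \<rightarrow> X" "inj_on z {1..k}" "onto n k \<alpha>" by (simp_all add: is_factorization_def)
  show ?thesis
    unfolding hat_set_eq gen_eq_cls[OF f assms(2)]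
    using restrict_in_Injections[OF z(1,2)] act_in[OF z(3) assms(2)] by blast
qed

lemma hat_setE:
  assumes "u \<in> hat_set A X"
  obtains n x a where "x \<in> {1..n} \<rightarrow> X" "inj_on x {1..n}" "a \<in> FObj A n" "u = gen A X n x a"
proof -
  obtain n x a where x: "x \<in> Injections n X" and a: "a \<in> FObj A n" "u = cls A X n x a"
    using assms by (auto simp: hat_set_eq)
  have "x \<in> {1..n} \<rightarrow> X" "inj_on x {1..n}" "restrict x {1..n} = x"
    using x by (auto simp: Injections_iff extensional_restrict)
  then show ?thesis using that[of x n a] a gen_inj_eq_cls[of x n X a] by simp
qed

text \<open>For an injective map \<open>gen\<close> is the class of the pair itself, so
  \<open>cls_eq_iff\<close> applies directly.\<close>

lemma gen_inj_eqD:
  assumes "x \<in> {1..n} \<rightarrow> X" "inj_on x {1..n}" "a \<in> FObj A n"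
    and "y \<in> {1..m} \<rightarrow> X" "inj_on y {1..m}" "b \<in> FObj A m" and "gen A X n x a = gen A X m y b"
  shows "n = m" "\<exists>\<sigma>. onto n n \<sigma> \<and> (\<forall>i\<in>{1..n}. x i = y (\<sigma> i)) \<and> b = act A n n \<sigma> a"
proof -
  have "n = m \<and> (\<exists>\<sigma>. onto n n \<sigma> \<and> (\<forall>i\<in>{1..n}. x i = y (\<sigma> i)) \<and> b = act A n n \<sigma> a)"
    using assms(7) gen_inj_eq_cls[OF assms(1-3)] gen_inj_eq_cls[OF assms(4-6)]
    unfolding cls_eq_iff[OF assms(1-6), symmetric] by simp
  then show "n = m" "\<exists>\<sigma>. onto n n \<sigma> \<and> (\<forall>i\<in>{1..n}. x i = y (\<sigma> i)) \<and> b = act A n n \<sigma> a"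
    by blast+
qed

text \<open>Both sides are brought to normal form, and the permutation between the normal forms is
  absorbed into \<open>\<alpha>\<close>, so that \<open>x\<close> and \<open>y\<close> factor
  through the same \<open>z\<close>. In this shape an equality of classes can be transported to a
  stage of a diagram or to another functor.\<close>

lemma gen_eqD:
  assumes x: "x \<in> {1..n} \<rightarrow> X" "a \<in> FObj A n" and y: "y \<in> {1..m} \<rightarrow> X" "b \<in> FObj A m"
    and eq: "gen A X n x a = gen A X m y b"
  obtains k z \<alpha> \<beta> where "is_factorization X n x k z \<alpha>" "is_factorization X m y k z \<beta>"
    "act A n k \<alpha> a = act A m k \<beta> b"
proof -
  obtain k z \<alpha> where f: "is_factorization X n x k z \<alpha>" using ex_factorization[OF x(1)] .
  obtain l w \<beta> where g: "is_factorization X m y l w \<beta>" using ex_factorization[OF y(1)] .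
  have z: "z \<in> {1..k} \<rightarrow> X" "inj_on z {1..k}" "onto n k \<alpha>" and w: "w \<in> {1..l} \<rightarrow> X" "inj_on w {1..l}" "onto m l \<beta>"
    using f g by (simp_all add: is_factorization_def)
  have "gen A X k z (act A n k \<alpha> a) = gen A X l w (act A m l \<beta> b)"
    using gen_factorization[OF f x(2)] gen_factorization[OF g y(2)] eq by simp
  from gen_inj_eqD[OF z(1,2) act_in[OF z(3) x(2)] w(1,2) act_in[OF w(3) y(2)] this]
  obtain \<sigma> where kl: "k = l" and \<sigma>: "onto k k \<sigma>" "\<forall>i\<in>{1..k}. z i = w (\<sigma> i)"
    "act A m l \<beta> b = act A k k \<sigma> (act A n k \<alpha> a)" by blast
  have "is_factorization X n x l w (\<lambda>i. \<sigma> (\<alpha> i))"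
    using f w kl \<sigma> onto_comp[OF z(3) \<sigma>(1)] onto_in[OF z(3)] by (auto simp: is_factorization_def)
  then show ?thesis using that[OF _ g] \<sigma>(3) act_act[OF z(3) \<sigma>(1) x(2)] kl by simp
qed

text \<open>For fixed \<open>n\<close> the pairs of an injection and a label form a
  \<open>Small\<close> set, because an injection is determined by its list of values; the union over
  \<open>n\<close> is countable.\<close>

lemma small_hat_set:
  assumes "small X"
  shows "small (hat_set A X)"
proof -
  have "Small (Injections n X)" for n
  proof (rule Small_image)
    show "Small (lists X)" using assms by (simp add: Small_lists Small_iff_small)
    \<comment> \<open>Lists are indexed from 0 and \<open>{1..n}\<close> starts at 1, hence the
      shift; the restriction restores the default value outside \<open>{1..n}\<close>.\<close>
    show "Injections n X \<subseteq> (\<lambda>xs. \<lambda>i\<in>{1..n}. xs ! (i - 1)) ` lists X"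
    proof
      fix x assume x: "x \<in> Injections n X"
      have "x = (\<lambda>i\<in>{1..n}. map x [1..<Suc n] ! (i - 1))"
        using x by (auto simp: Injections_iff extensional_def fun_eq_iff simp del: upt_Suc)
      moreover have "map x [1..<Suc n] \<in> lists X"
        using x by (auto simp: Injections_iff Pi_iff simp del: upt_Suc)
      ultimately show "x \<in> (\<lambda>xs. \<lambda>i\<in>{1..n}. xs ! (i - 1)) ` lists X" by (rule image_eqI)
    qed
  qed
  then have "Small (Injections n X \<times> FObj A n)" for n
    using small_FObj[of n] by (intro Small_Times) (simp_all add: Small_iff_small)
  then have "Small ((\<lambda>(x, a). cls A X n x a) ` (Injections n X \<times> FObj A n))" for n
    by (rule Small_image[OF _ order_refl])
  then have "Small (\<Union>n. (\<lambda>(x, a). cls A X n x a) ` (Injections n X \<times> FObj A n))"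
    by (intro Small_UN[OF Small_countable]) auto
  moreover have "hat_set A X = (\<Union>n. (\<lambda>(x, a). cls A X n x a) ` (Injections n X \<times> FObj A n))"
    unfolding hat_set_eq by auto
  ultimately show ?thesis by (simp add: Small_iff_small)
qed

text \<open>The description in \<open>hat_map\<close> ranges over all injective representatives of
  \<open>u\<close> and all factorizations of their composites with \<open>f\<close>. All of them
  yield the same class, to which \<open>THE\<close> therefore evaluates; a non-injective
  \<open>x\<close> is reduced to an injective one by a factorization.\<close>

lemma body_hat_map:
  assumes f: "body f \<in> src f \<rightarrow> tgt f" and x: "x \<in> {1..n} \<rightarrow> src f" and a: "a \<in> FObj A n"
  shows "body (hat_map A f) (gen A (src f) n x a) = gen A (tgt f) n (\<lambda>i. body f (x i)) a"
proof -
  let ?X = "src f" and ?Y = "tgt f"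
  have *: "body (hat_map A f) (gen A ?X n x a) = gen A ?Y n (\<lambda>i. body f (x i)) a"
    if x: "x \<in> {1..n} \<rightarrow> ?X" "inj_on x {1..n}" and a: "a \<in> FObj A n" for n x a
  proof -
    let ?P = "\<lambda>v n' m x' a' y \<alpha>. x' \<in> Injections n' ?X \<and> a' \<in> FObj A n' \<and>
          gen A ?X n x a = cls A ?X n' x' a' \<and> y \<in> Injections m ?Y \<and> \<alpha> \<in> Hom Surj n' m \<and>
          compose {1..n'} (body f) x' = compose {1..n'} y (body \<alpha>) \<and>
          v = cls A ?Y m y (body (FArr A \<alpha>) a')"
    have uniq: "v = gen A ?Y n (\<lambda>i. body f (x i)) a" if "?P v n' m x' a' y \<alpha>" for v n' m x' a' y \<alpha>
    proof -
      have x': "x' \<in> {1..n'} \<rightarrow> ?X" "inj_on x' {1..n'}" "restrict x' {1..n'} = x'"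
        and y: "y \<in> {1..m} \<rightarrow> ?Y" "inj_on y {1..m}" "restrict y {1..m} = y" and a': "a' \<in> FObj A n'"
        using that by (auto simp: Injections_iff extensional_restrict)
      have "gen A ?X n x a = gen A ?X n' x' a'" using that x' gen_inj_eq_cls[OF x'(1,2) a'] by simp
      \<comment> \<open>Two injective representatives of \<open>u\<close> differ by a permutation
        \<open>\<sigma>\<close>, which \<open>gen_act\<close> moves from the label back into the
        map.\<close>
      from gen_inj_eqD[OF x a x'(1,2) a' this]
      obtain \<sigma> where n: "n' = n" and \<sigma>: "onto n n \<sigma>" "\<forall>i\<in>{1..n}. x i = x' (\<sigma> i)" "a' = act A n n \<sigma> a"
        by blast
      have \<alpha>: "onto n' m (body \<alpha>)" "restrict (body \<alpha>) {1..n'} = body \<alpha>" "src \<alpha> = n'" "tgt \<alpha> = m"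
        using that by (auto simp: Hom_Surj_iff extensional_restrict)
      have "\<forall>i\<in>{1..n'}. body f (x' i) = y (body \<alpha> i)"
        using that by (auto simp: compose_def fun_eq_iff) metis
      then have F: "is_factorization ?Y n' (\<lambda>i. body f (x' i)) m y (body \<alpha>)"
        using y \<alpha> by (simp add: is_factorization_def)
      have "Arrow n' m (body \<alpha>) = \<alpha>" using \<alpha> by (auto intro: arrow.expand)
      then have "v = cls A ?Y m (restrict y {1..m}) (act A n' m (body \<alpha>) a')"
        using that y \<alpha> by (simp add: act_def)
      also have "\<dots> = gen A ?Y n' (\<lambda>i. body f (x' i)) a'" using gen_eq_cls[OF F a'] by simp
      also have "\<dots> = gen A ?Y n (\<lambda>i. body f (x' (\<sigma> i))) a"
      proof -
        have "(\<lambda>i. body f (x' i)) \<in> {1..n} \<rightarrow> ?Y" using f x' n by auto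
        from gen_act[OF this \<sigma>(1) a] show ?thesis using n \<sigma>(3) by simp
      qed
      also have "\<dots> = gen A ?Y n (\<lambda>i. body f (x i)) a"
        using f x x' n onto_in[OF \<sigma>(1)] \<sigma>(2) a by (intro gen_cong) auto
      finally show ?thesis .
    qed
    obtain m y \<alpha> where F: "is_factorization ?Y n (\<lambda>i. body f (x i)) m y \<alpha>"
      using ex_factorization[of "\<lambda>i. body f (x i)" n ?Y] f x by blast
    then have y: "y \<in> {1..m} \<rightarrow> ?Y" "inj_on y {1..m}" "onto n m \<alpha>" "\<forall>i\<in>{1..n}. body f (x i) = y (\<alpha> i)"
      by (simp_all add: is_factorization_def)
    have "compose {1..n} (body f) (restrict x {1..n}) = compose {1..n} (restrict y {1..m}) (restrict \<alpha> {1..n})"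
      using y(4) onto_in[OF y(3)] by (auto simp: compose_def fun_eq_iff simp del: atLeastAtMost_iff)
    then have ex: "?P (cls A ?Y m (restrict y {1..m}) (act A n m \<alpha> a)) n m (restrict x {1..n}) a
        (restrict y {1..m}) (Arrow n m (restrict \<alpha> {1..n}))"
      using restrict_in_Injections[OF x] restrict_in_Injections[OF y(1,2)] onto_in_Hom[OF y(3)] a
        gen_inj_eq_cls[OF x a] by (simp add: act_def)
    have "(THE v. \<exists>n' m x' a' y \<alpha>. ?P v n' m x' a' y \<alpha>) = gen A ?Y n (\<lambda>i. body f (x i)) a"
    proof (rule the_equality)
      show "\<exists>n' m x' a' y \<alpha>. ?P (gen A ?Y n (\<lambda>i. body f (x i)) a) n' m x' a' y \<alpha>"
        using ex uniq[OF ex] by metis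
    qed (use uniq in blast)
    then show ?thesis
      unfolding hat_map_def using gen_in_hat_set[OF x(1) a] by simp
  qed
  obtain k z \<alpha> where F: "is_factorization ?X n x k z \<alpha>" using ex_factorization[OF x] .
  then have z: "z \<in> {1..k} \<rightarrow> ?X" "inj_on z {1..k}" "onto n k \<alpha>" "\<forall>i\<in>{1..n}. x i = z (\<alpha> i)"
    by (simp_all add: is_factorization_def)
  have "body (hat_map A f) (gen A ?X n x a) = gen A ?Y k (\<lambda>i. body f (z i)) (act A n k \<alpha> a)"
    using gen_factorization[OF F a] *[OF z(1,2) act_in[OF z(3) a]] by simp
  also have "\<dots> = gen A ?Y n (\<lambda>i. body f (z (\<alpha> i))) a"
  proof -
    have "(\<lambda>i. body f (z i)) \<in> {1..k} \<rightarrow> ?Y" using f z(1) by auto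
    from gen_act[OF this z(3) a] show ?thesis by simp
  qed
  also have "\<dots> = gen A ?Y n (\<lambda>i. body f (x i)) a"
    using f z onto_in[OF z(3)] a by (intro gen_cong) auto
  finally show ?thesis .
qed

end

locale surj_trans = A: surj_functor small A + B: surj_functor small B
  for small :: "'u set \<Rightarrow> bool" and A B :: "'u surjfunc" +
  fixes t :: "nat \<Rightarrow> 'u setarr"
  assumes nat_trans: "is_nat_trans Surj (Sets small) A B t"
begin

lemma t_in: "a \<in> FObj A n \<Longrightarrow> body (t n) a \<in> FObj B n"
  using nat_trans_set_valued(3)[OF nat_trans, of n] by (auto intro: Hom_Sets_body)

lemma t_act: "onto n m \<alpha> \<Longrightarrow> a \<in> FObj A n \<Longrightarrow> body (t m) (act A n m \<alpha> a) = act B n m \<alpha> (body (t n) a)"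
  unfolding act_def by (rule nat_trans_set_valued(4)[OF nat_trans onto_in_Hom])

text \<open>A change of the injective representative acts on the label by a permutation, and
  \<open>t\<close> commutes with that action; so the description in \<open>hat_component\<close> has
  a single value.\<close>

lemma body_hat_component:
  assumes x: "x \<in> {1..n} \<rightarrow> X" and a: "a \<in> FObj A n"
  shows "body (hat_component (Arrow A B t) X) (gen A X n x a) = gen B X n x (body (t n) a)"
proof -
  have *: "body (hat_component (Arrow A B t) X) (gen A X n x a) = gen B X n x (body (t n) a)"
    if x: "x \<in> {1..n} \<rightarrow> X" "inj_on x {1..n}" and a: "a \<in> FObj A n" for n x a
  proof -
    let ?P = "\<lambda>v n' x' a'. x' \<in> Injections n' X \<and> a' \<in> FObj A n' \<and>
          gen A X n x a = cls A X n' x' a' \<and> v = cls B X n' x' (body (t n') a')"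
    have uniq: "v = gen B X n x (body (t n) a)" if "?P v n' x' a'" for v n' x' a'
    proof -
      have x': "x' \<in> {1..n'} \<rightarrow> X" "inj_on x' {1..n'}" "restrict x' {1..n'} = x'" and a': "a' \<in> FObj A n'"
        using that by (auto simp: Injections_iff extensional_restrict)
      have "gen A X n x a = gen A X n' x' a'" using that x' A.gen_inj_eq_cls[OF x'(1,2) a'] by simp
      from A.gen_inj_eqD[OF x a x'(1,2) a' this]
      obtain \<sigma> where n: "n' = n" and \<sigma>: "onto n n \<sigma>" "\<forall>i\<in>{1..n}. x i = x' (\<sigma> i)" "a' = act A n n \<sigma> a"
        by blast
      have "v = gen B X n' x' (body (t n') a')"
        using that x' B.gen_inj_eq_cls[OF x'(1,2) t_in[OF a']] by simp
      also have "\<dots> = gen B X n (\<lambda>i. x' (\<sigma> i)) (body (t n) a)"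
        using B.gen_act[OF _ \<sigma>(1) t_in[OF a], of x' X] x' n t_act[OF \<sigma>(1) a] \<sigma>(3) by simp
      also have "\<dots> = gen B X n x (body (t n) a)"
        using x' n onto_in[OF \<sigma>(1)] \<sigma>(2) t_in[OF a] by (intro B.gen_cong) auto
      finally show ?thesis .
    qed
    have "?P (gen B X n x (body (t n) a)) n (restrict x {1..n}) a"
      using restrict_in_Injections[OF x] a A.gen_inj_eq_cls[OF x a] B.gen_inj_eq_cls[OF x t_in[OF a]] by simp
    then have "(THE v. \<exists>n' x' a'. ?P v n' x' a') = gen B X n x (body (t n) a)"
      using uniq by (intro the_equality) blast+
    then show ?thesis
      unfolding hat_component_def using A.gen_in_hat_set[OF x(1) a] by simp
  qed
  obtain k z \<alpha> where F: "is_factorization X n x k z \<alpha>" using ex_factorization[OF x] .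
  then have z: "z \<in> {1..k} \<rightarrow> X" "inj_on z {1..k}" "onto n k \<alpha>" by (simp_all add: is_factorization_def)
  show ?thesis
    using A.gen_factorization[OF F a] B.gen_factorization[OF F t_in[OF a]]
      *[OF z(1,2) A.act_in[OF z(3) a]] t_act[OF z(3) a] by simp
qed

end


section \<open>The associated functor\<close>

lemma body_comp_funcset:
  "f \<in> Hom (Sets small) X Y \<Longrightarrow> x \<in> S \<rightarrow> X \<Longrightarrow> (\<lambda>i. body f (x i)) \<in> S \<rightarrow> Y"
  by (simp add: Pi_iff Hom_Sets_body)

lemma inj_on_comp_funcset: "inj_on f X \<Longrightarrow> inj_on x S \<Longrightarrow> x \<in> S \<rightarrow> X \<Longrightarrow> inj_on (\<lambda>i. f (x i)) S"
  by (simp add: inj_on_def Pi_iff)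

context surj_functor
begin

abbreviation "HA \<equiv> hat_func small A"

lemma FObj_hat_func: "small X \<Longrightarrow> FObj HA X = hat_set A X"
  by (simp add: hat_func_def)

lemma FArr_hat_func: "f \<in> Hom (Sets small) X Y \<Longrightarrow> FArr HA f = hat_map A f"
  by (simp add: hat_func_def Hom_iff)

lemma body_hat_func:
  assumes "f \<in> Hom (Sets small) X Y" "x \<in> {1..n} \<rightarrow> X" "a \<in> FObj A n"
  shows "body (FArr HA f) (gen A X n x a) = gen A Y n (\<lambda>i. body f (x i)) a"
proof -
  have "body f \<in> X \<rightarrow> Y" "src f = X" "tgt f = Y" using assms(1) by (auto simp: Hom_Sets_iff)
  then show ?thesis using body_hat_map[of f x n a] assms by (simp add: FArr_hat_func)
qed

lemma hat_map_in_Hom: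
  assumes f: "f \<in> Hom (Sets small) X Y"
  shows "hat_map A f \<in> Hom (Sets small) (hat_set A X) (hat_set A Y)"
proof -
  have f': "body f \<in> X \<rightarrow> Y" "src f = X" "tgt f = Y" "small X" "small Y" using f by (auto simp: Hom_Sets_iff)
  have "body (hat_map A f) u \<in> hat_set A Y" if "u \<in> hat_set A X" for u
    using that
  proof (rule hat_setE)
    fix n x a assume x: "x \<in> {1..n} \<rightarrow> X" and a: "a \<in> FObj A n" and u: "u = gen A X n x a"
    have "(\<lambda>i. body f (x i)) \<in> {1..n} \<rightarrow> Y" using f' x by auto
    then show ?thesis using body_hat_map[of f x n a] f' x a u by (simp add: gen_in_hat_set)
  qed
  moreover have "body (hat_map A f) \<in> extensional (hat_set A X)" using f' by (simp add: hat_map_def)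
  ultimately show ?thesis
    using f' small_hat_set by (auto simp: Hom_Sets_iff hat_map_def)
qed

text \<open>On the elements \<open>gen A X n x a\<close> a map acts by composition with
  \<open>x\<close>, so the functor laws reduce to those of function composition.\<close>

lemma set_endo_hat: "set_endo small HA"
proof -
  have "is_functor (Sets small) (Sets small) HA"
  proof
    fix X assume X: "X \<in> Obj (Sets small)"
    then have idX: "Ide (Sets small) X \<in> Hom (Sets small) X X" by (rule D.Ide_in_Hom)
    show "FObj HA X \<in> Obj (Sets small)" using X by (simp add: FObj_hat_func small_hat_set)
    show "FArr HA (Ide (Sets small) X) = Ide (Sets small) (FObj HA X)"
    proof (rule Hom_Sets_eqI)
      show "FArr HA (Ide (Sets small) X) \<in> Hom (Sets small) (hat_set A X) (hat_set A X)"
        using hat_map_in_Hom[OF idX] by (simp add: FArr_hat_func[OF idX])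
      show "Ide (Sets small) (FObj HA X) \<in> Hom (Sets small) (hat_set A X) (hat_set A X)"
        using X D.Ide_in_Hom[of "hat_set A X"] by (simp add: FObj_hat_func small_hat_set)
      fix u assume "u \<in> hat_set A X"
      then show "body (FArr HA (Ide (Sets small) X)) u = body (Ide (Sets small) (FObj HA X)) u"
      proof (rule hat_setE)
        fix n x a assume x: "x \<in> {1..n} \<rightarrow> X" and a: "a \<in> FObj A n" and u: "u = gen A X n x a"
        have "gen A X n (\<lambda>i. body (Ide (Sets small) X) (x i)) a = gen A X n x a"
          using x a by (intro gen_cong[symmetric]) (auto simp: Ide_Sets Pi_iff)
        then show ?thesis
          using X x u a gen_in_hat_set[OF x a] body_hat_func[OF idX x a]
          by (simp add: Ide_Sets FObj_hat_func)
      qed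
    qed
  next
    fix f X Y assume f: "f \<in> Hom (Sets small) X Y"
    then show "FArr HA f \<in> Hom (Sets small) (FObj HA X) (FObj HA Y)"
      using hat_map_in_Hom[OF f] Hom_Sets_small[OF f] by (simp add: FArr_hat_func[OF f] FObj_hat_func)
    fix g Z assume g: "g \<in> Hom (Sets small) Y Z"
    have gf: "g \<cdot>\<^bsub>Sets small\<^esub> f \<in> Hom (Sets small) X Z" by (rule Comp_Sets_in_Hom[OF f g])
    show "FArr HA (g \<cdot>\<^bsub>Sets small\<^esub> f) = FArr HA g \<cdot>\<^bsub>Sets small\<^esub> FArr HA f"
    proof (rule Hom_Sets_eqI)
      show "FArr HA (g \<cdot>\<^bsub>Sets small\<^esub> f) \<in> Hom (Sets small) (hat_set A X) (hat_set A Z)"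
        using hat_map_in_Hom[OF gf] by (simp add: FArr_hat_func[OF gf])
      show "FArr HA g \<cdot>\<^bsub>Sets small\<^esub> FArr HA f \<in> Hom (Sets small) (hat_set A X) (hat_set A Z)"
        using Comp_Sets_in_Hom[OF hat_map_in_Hom[OF f] hat_map_in_Hom[OF g]]
        by (simp add: FArr_hat_func[OF f] FArr_hat_func[OF g])
      fix u assume uX: "u \<in> hat_set A X"
      then show "body (FArr HA (g \<cdot>\<^bsub>Sets small\<^esub> f)) u = body (FArr HA g \<cdot>\<^bsub>Sets small\<^esub> FArr HA f) u"
      proof (rule hat_setE)
        fix n x a assume x: "x \<in> {1..n} \<rightarrow> X" and a: "a \<in> FObj A n" and u: "u = gen A X n x a"
        have fx: "(\<lambda>i. body f (x i)) \<in> {1..n} \<rightarrow> Y" using x Hom_Sets_body[OF f] by auto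
        have gfx: "(\<lambda>i. body (g \<cdot>\<^bsub>Sets small\<^esub> f) (x i)) \<in> {1..n} \<rightarrow> Z" using x Hom_Sets_body[OF gf] by auto
        have "u \<in> src (FArr HA f)"
          using uX hat_map_in_Hom[OF f] by (simp add: FArr_hat_func[OF f] Hom_Sets_iff)
        moreover have "gen A Z n (\<lambda>i. body (g \<cdot>\<^bsub>Sets small\<^esub> f) (x i)) a =
            gen A Z n (\<lambda>i. body g (body f (x i))) a"
        proof (rule gen_cong[OF gfx a])
          fix i assume "i \<in> {1..n}"
          then have "x i \<in> src f" using x f by (auto simp: Hom_Sets_iff)
          then show "body (g \<cdot>\<^bsub>Sets small\<^esub> f) (x i) = body g (body f (x i))" by simp
        qed
        ultimately show ?thesis
          using body_hat_func[OF gf x a] body_hat_func[OF f x a] body_hat_func[OF g fx a] by (simp add: u)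
      qed
    qed
  qed (auto simp: hat_func_def)
  then show ?thesis by (simp add: set_endo_def set_valued_def)
qed

text \<open>Composition with an injection keeps normal forms normal. Equality over \<open>Y\<close>
  therefore gives a permutation relating m \<circ> x and m \<circ> y, from which \<open>m\<close>
  can be cancelled.\<close>

lemma hat_map_inj:
  assumes m: "m \<in> Hom (Sets small) X Y" and inj: "inj_on (body m) X"
  shows "inj_on (body (FArr HA m)) (hat_set A X)"
proof (rule inj_onI)
  fix u v assume u: "u \<in> hat_set A X" and v: "v \<in> hat_set A X"
    and eq: "body (FArr HA m) u = body (FArr HA m) v"
  from u obtain n x a where x: "x \<in> {1..n} \<rightarrow> X" "inj_on x {1..n}" "a \<in> FObj A n" "u = gen A X n x a"
    by (rule hat_setE)
  from v obtain k y b where y: "y \<in> {1..k} \<rightarrow> X" "inj_on y {1..k}" "b \<in> FObj A k" "v = gen A X k y b"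
    by (rule hat_setE)
  have mx: "(\<lambda>i. body m (x i)) \<in> {1..n} \<rightarrow> Y" "inj_on (\<lambda>i. body m (x i)) {1..n}"
    and my: "(\<lambda>i. body m (y i)) \<in> {1..k} \<rightarrow> Y" "inj_on (\<lambda>i. body m (y i)) {1..k}"
    by (rule body_comp_funcset[OF m x(1)] body_comp_funcset[OF m y(1)]
        inj_on_comp_funcset[OF inj x(2,1)] inj_on_comp_funcset[OF inj y(2,1)])+
  have "gen A Y n (\<lambda>i. body m (x i)) a = gen A Y k (\<lambda>i. body m (y i)) b"
    using eq x y body_hat_func[OF m] by simp
  from gen_inj_eqD[OF mx x(3) my y(3) this] obtain \<sigma> where n: "n = k"
    and \<sigma>: "onto n n \<sigma>" "\<forall>i\<in>{1..n}. body m (x i) = body m (y (\<sigma> i))" "b = act A n n \<sigma> a" by blast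
  have "x i = y (\<sigma> i)" if "i \<in> {1..n}" for i
  proof (rule inj_onD[OF inj])
    show "body m (x i) = body m (y (\<sigma> i))" "x i \<in> X" "y (\<sigma> i) \<in> X"
      using \<sigma>(2) that x(1) y(1) n onto_in[OF \<sigma>(1) that] by auto
  qed
  then have "u = gen A X n (\<lambda>i. y (\<sigma> i)) a" using gen_cong[OF x(1,3)] x(4) by simp
  then show "u = v" using gen_act[of y k X n \<sigma> a] y \<sigma> n x(3) by simp
qed

text \<open>As \<open>m\<close> is injective, m \<circ> y is already a normal form. Comparing it
  with a normal form of f \<circ> x shows that \<open>f\<close> sends every \<open>x i\<close> into
  the image of \<open>m\<close>, so the points can be pulled back one by one, under the unchanged
  label \<open>a\<close>.\<close>

lemma hat_pullbacks: "preserves_pullbacks_along_monos small HA"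
  unfolding preserves_pullbacks_along_monos_def
proof (intro allI impI, elim conjE)
  interpret H: set_endo small HA by (rule set_endo_hat)
  fix p q f m assume mono: "is_mono (Sets small) m" and pb: "is_pullback (Sets small) p q f m"
  from pb obtain W X Y Z where H: "p \<in> Hom (Sets small) W X" "q \<in> Hom (Sets small) W Y"
    "f \<in> Hom (Sets small) X Z" "m \<in> Hom (Sets small) Y Z"
    and comm: "\<And>w. w \<in> W \<Longrightarrow> body f (body p w) = body m (body q w)"
    and univ: "\<And>x y. x \<in> X \<Longrightarrow> y \<in> Y \<Longrightarrow> body f x = body m y \<Longrightarrow>
      \<exists>!w. w \<in> W \<and> body p w = x \<and> body q w = y"
    by (rule is_pullback_SetsD) blast
  have small: "small W" "small X" "small Y" "small Z" using H Hom_Sets_small by blast+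
  have inj_m: "inj_on (body m) Y" using mono is_mono_Sets_iff[OF H(4)] by simp
  \<comment> \<open>A pullback of an injection is injective; with \<open>hat_map_inj\<close> this
    yields uniqueness of lifts.\<close>
  have inj_p: "inj_on (body p) W"
  proof (rule inj_onI)
    fix w w' assume w: "w \<in> W" "w' \<in> W" "body p w = body p w'"
    then have "body m (body q w) = body m (body q w')" using comm by metis
    then have "body q w = body q w'" using inj_onD[OF inj_m] Hom_Sets_body[OF H(2)] w by blast
    then show "w = w'"
      using univ[of "body p w" "body q w"] w comm[of w] Hom_Sets_body[OF H(1)] Hom_Sets_body[OF H(2)]
      by metis
  qed
  show "is_pullback (Sets small) (FArr HA p) (FArr HA q) (FArr HA f) (FArr HA m)"
  proof (rule is_pullback_SetsI[OF H.FArr_in_Hom[OF H(1)] H.FArr_in_Hom[OF H(2)]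
        H.FArr_in_Hom[OF H(3)] H.FArr_in_Hom[OF H(4)]])
    fix u assume u: "u \<in> FObj HA W"
    have "f \<cdot>\<^bsub>Sets small\<^esub> p = m \<cdot>\<^bsub>Sets small\<^esub> q"
      using pb by (auto simp: is_pullback_def)
    then show "body (FArr HA f) (body (FArr HA p) u) = body (FArr HA m) (body (FArr HA q) u)"
      using H.body_Comp[OF H(1,3) u] H.body_Comp[OF H(2,4) u] by simp
  next
    fix u v assume "u \<in> FObj HA X" "v \<in> FObj HA Y"
      and eq: "body (FArr HA f) u = body (FArr HA m) v"
    then have u: "u \<in> hat_set A X" and v: "v \<in> hat_set A Y" using small by (simp_all add: FObj_hat_func)
    from u obtain n x a where x: "x \<in> {1..n} \<rightarrow> X" "inj_on x {1..n}" "a \<in> FObj A n" "u = gen A X n x a"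
      by (rule hat_setE)
    from v obtain k y b where y: "y \<in> {1..k} \<rightarrow> Y" "inj_on y {1..k}" "b \<in> FObj A k" "v = gen A Y k y b"
      by (rule hat_setE)
    have fx: "(\<lambda>i. body f (x i)) \<in> {1..n} \<rightarrow> Z"
      and my: "(\<lambda>i. body m (y i)) \<in> {1..k} \<rightarrow> Z" "inj_on (\<lambda>i. body m (y i)) {1..k}"
      by (rule body_comp_funcset[OF H(3) x(1)] body_comp_funcset[OF H(4) y(1)]
          inj_on_comp_funcset[OF inj_m y(2,1)])+
    obtain l z \<alpha> where F: "is_factorization Z n (\<lambda>i. body f (x i)) l z \<alpha>" using ex_factorization[OF fx] .
    then have z: "z \<in> {1..l} \<rightarrow> Z" "inj_on z {1..l}" "onto n l \<alpha>" "\<forall>i\<in>{1..n}. body f (x i) = z (\<alpha> i)"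
      by (simp_all add: is_factorization_def)
    have "gen A Z l z (act A n l \<alpha> a) = gen A Z k (\<lambda>i. body m (y i)) b"
      using eq x y body_hat_func[OF H(3) x(1,3)] body_hat_func[OF H(4) y(1,3)] gen_factorization[OF F x(3)]
      by simp
    from gen_inj_eqD[OF z(1,2) act_in[OF z(3) x(3)] my y(3) this] obtain \<sigma> where l: "l = k"
      and \<sigma>: "onto l l \<sigma>" "\<forall>i\<in>{1..l}. z i = body m (y (\<sigma> i))" "b = act A l l \<sigma> (act A n l \<alpha> a)"
      by blast
    have \<sigma>\<alpha>: "onto n k (\<lambda>i. \<sigma> (\<alpha> i))" using onto_comp[OF z(3) \<sigma>(1)] l by simp
    \<comment> \<open>The given pullback supplies a point over each compatible pair of
      \<open>x i\<close> and \<open>y (\<sigma> (\<alpha> i))\<close>.\<close>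
    have "\<exists>w. w \<in> W \<and> body p w = x i \<and> body q w = y (\<sigma> (\<alpha> i))" if i: "i \<in> {1..n}" for i
    proof -
      have "body f (x i) = body m (y (\<sigma> (\<alpha> i)))" using z(4) \<sigma>(2) onto_in[OF z(3) i] i by simp
      moreover have "y (\<sigma> (\<alpha> i)) \<in> Y" using y(1) onto_in[OF \<sigma>\<alpha> i] by auto
      ultimately show ?thesis using univ[of "x i" "y (\<sigma> (\<alpha> i))"] x(1) i by blast
    qed
    then obtain w where w: "\<And>i. i \<in> {1..n} \<Longrightarrow> w i \<in> W \<and> body p (w i) = x i \<and> body q (w i) = y (\<sigma> (\<alpha> i))"
      by metis
    have wW: "w \<in> {1..n} \<rightarrow> W" using w by blast
    show "\<exists>t\<in>FObj HA W. body (FArr HA p) t = u \<and> body (FArr HA q) t = v"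
    proof (intro bexI conjI)
      show "gen A W n w a \<in> FObj HA W" using gen_in_hat_set[OF wW x(3)] small by (simp add: FObj_hat_func)
      have "gen A X n x a = gen A X n (\<lambda>i. body p (w i)) a" using w by (intro gen_cong[OF x(1,3)]) simp
      then show "body (FArr HA p) (gen A W n w a) = u" using body_hat_func[OF H(1) wW x(3)] x(4) by simp
      \<comment> \<open>Over \<open>Y\<close> the lift becomes
        [y \<circ> \<sigma> \<circ> \<alpha>, a]; moving the surjection to the label turns
        \<open>a\<close> into \<open>b\<close>.\<close>
      have "(\<lambda>i. y (\<sigma> (\<alpha> i))) \<in> {1..n} \<rightarrow> Y" using y(1) onto_in[OF \<sigma>\<alpha>] by auto
      then have "gen A Y n (\<lambda>i. y (\<sigma> (\<alpha> i))) a = gen A Y n (\<lambda>i. body q (w i)) a"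
        using w by (intro gen_cong) (use x(3) in auto)
      moreover have "gen A Y n (\<lambda>i. y (\<sigma> (\<alpha> i))) a = v"
        using gen_act[OF y(1) \<sigma>\<alpha> x(3)] act_act[OF z(3) \<sigma>(1) x(3)] \<sigma>(3) l y(4) by simp
      ultimately show "body (FArr HA q) (gen A W n w a) = v" using body_hat_func[OF H(2) wW x(3)] by simp
    qed
  next
    fix u v assume "u \<in> FObj HA W" "v \<in> FObj HA W" "body (FArr HA p) u = body (FArr HA p) v"
    then show "u = v" using inj_onD[OF hat_map_inj[OF H(1) inj_p]] small by (simp add: FObj_hat_func)
  qed
qed

text \<open>A class, and likewise an equality of two classes, involves finitely many points and
  equations between points. A filtered colimit of sets realises such finite data at a single
  stage.\<close>

lemma hat_finitary: "finitary small HA"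
  unfolding finitary_def
proof (intro allI impI, elim conjE)
  fix J :: "('u, 'u) cat" and D c \<iota>
  assume "is_filtered J" "is_functor J (Sets small) D" and colim: "is_colimit J (Sets small) D c \<iota>"
  then interpret D: filtered_diagram small J D
    by (auto simp: filtered_diagram_def filtered_diagram_axioms_def set_valued_def set_universe_axioms)
  interpret H: set_endo small HA by (rule set_endo_hat)
  let ?HD = "func_comp J HA D" and ?H\<iota> = "\<lambda>j. FArr HA (\<iota> j)"
  interpret HD: filtered_diagram small J ?HD
    using D.filtered is_functor_func_comp[OF D.is_functor_axioms H.is_functor_axioms]
    by (auto simp: filtered_diagram_def filtered_diagram_axioms_def set_valued_def set_universe_axioms)
  have cocone: "is_cocone J (Sets small) D c \<iota>" using colim by (simp add: is_colimit_def)
  then have c: "small c" and \<iota>: "\<And>j. j \<in> Obj J \<Longrightarrow> \<iota> j \<in> Hom (Sets small) (FObj D j) c"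
    by (auto simp: is_cocone_def)
  note surj = D.colimit_jointly_surj[OF colim] and inj = D.colimit_eventually_inj[OF colim]
  have HD: "FObj ?HD j = hat_set A (FObj D j)" if "j \<in> Obj J" for j
    using that D.small_FObj[OF that] by (simp add: func_comp_def compose_def FObj_hat_func)
  have Hdmap: "HD.dmap h (gen A (FObj D i) n x a) = gen A (FObj D j) n (\<lambda>k. D.dmap h (x k)) a"
    if h: "h \<in> Hom J i j" and x: "x \<in> {1..n} \<rightarrow> FObj D i" and a: "a \<in> FObj A n" for h i j n x a
    unfolding HD.dmap_def D.dmap_def using body_hat_func[OF D.FArr_in_Hom[OF h] x a] h
    by (simp add: func_comp_def compose_def Hom_iff)
  have "is_cocone J (Sets small) ?HD (FObj HA c) ?H\<iota>"
  proof (rule HD.is_coconeI)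
    show "small (FObj HA c)" using c by (simp add: FObj_hat_func small_hat_set)
    show "?H\<iota> j \<in> Hom (Sets small) (FObj ?HD j) (FObj HA c)" if "j \<in> Obj J" for j
      using H.FArr_in_Hom[OF \<iota>[OF that]] that by (simp add: func_comp_def compose_def)
    fix h i j u assume h: "h \<in> Hom J i j" and u: "u \<in> FObj ?HD i"
    then have ij: "i \<in> Obj J" "j \<in> Obj J" "h \<in> Arr J" using D.Hom_Obj by (auto simp: Hom_iff)
    have "\<iota> j \<cdot>\<^bsub>Sets small\<^esub> FArr D h = \<iota> i" using cocone h ij by (auto simp: is_cocone_def Hom_iff)
    then show "body (?H\<iota> j) (HD.dmap h u) = body (?H\<iota> i) u"
      unfolding HD.dmap_def using H.body_Comp[OF D.FArr_in_Hom[OF h] \<iota>[OF ij(2)], of u] u ij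
      by (simp add: func_comp_def compose_def)
  qed
  moreover have "HD.jointly_surj (FObj HA c) ?H\<iota>"
    unfolding HD.jointly_surj_def
  proof
    fix u assume "u \<in> FObj HA c"
    then have "u \<in> hat_set A c" using c by (simp add: FObj_hat_func)
    then obtain n x a where x: "x \<in> {1..n} \<rightarrow> c" and a: "a \<in> FObj A n" and u: "u = gen A c n x a"
      by (rule hat_setE)
    have "x ` {1..n} \<subseteq> c" using x by auto
    then obtain j where j: "j \<in> Obj J" "x ` {1..n} \<subseteq> body (\<iota> j) ` FObj D j"
      using D.finite_lift[OF cocone surj, of "x ` {1..n}"] by auto
    then have "\<forall>i\<in>{1..n}. \<exists>d. d \<in> FObj D j \<and> x i = body (\<iota> j) d" by blast
    then obtain x' where x': "\<And>i. i \<in> {1..n} \<Longrightarrow> x' i \<in> FObj D j \<and> x i = body (\<iota> j) (x' i)" by metis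
    then have x'D: "x' \<in> {1..n} \<rightarrow> FObj D j" by blast
    have "gen A c n x a = gen A c n (\<lambda>i. body (\<iota> j) (x' i)) a" using x' by (intro gen_cong[OF x a]) simp
    then have "body (?H\<iota> j) (gen A (FObj D j) n x' a) = u" using body_hat_func[OF \<iota>[OF j(1)] x'D a] u by simp
    moreover have "gen A (FObj D j) n x' a \<in> FObj ?HD j" using HD[OF j(1)] gen_in_hat_set[OF x'D a] by simp
    ultimately show "\<exists>j\<in>Obj J. \<exists>u'\<in>FObj ?HD j. body (?H\<iota> j) u' = u" using j(1) by blast
  qed
  moreover have "HD.eventually_inj ?H\<iota>"
    unfolding HD.eventually_inj_def
  proof (intro ballI impI)
    fix j u v assume j: "j \<in> Obj J" and "u \<in> FObj ?HD j" "v \<in> FObj ?HD j"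
      and eq: "body (?H\<iota> j) u = body (?H\<iota> j) v"
    then have u: "u \<in> hat_set A (FObj D j)" and v: "v \<in> hat_set A (FObj D j)" by (simp_all add: HD)
    from u obtain n x a where x: "x \<in> {1..n} \<rightarrow> FObj D j" "a \<in> FObj A n" "u = gen A (FObj D j) n x a"
      by (rule hat_setE)
    from v obtain m y b where y: "y \<in> {1..m} \<rightarrow> FObj D j" "b \<in> FObj A m" "v = gen A (FObj D j) m y b"
      by (rule hat_setE)
    let ?x = "\<lambda>i. body (\<iota> j) (x i)" and ?y = "\<lambda>i. body (\<iota> j) (y i)"
    have xc: "?x \<in> {1..n} \<rightarrow> c" and yc: "?y \<in> {1..m} \<rightarrow> c"
      by (rule body_comp_funcset[OF \<iota>[OF j] x(1)] body_comp_funcset[OF \<iota>[OF j] y(1)])+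
    have "gen A c n ?x a = gen A c m ?y b"
      using eq x y body_hat_func[OF \<iota>[OF j]] by simp
    from gen_eqD[OF xc x(2) yc y(2) this] obtain k z \<alpha> \<beta> where
      F: "is_factorization c n ?x k z \<alpha>" and G: "is_factorization c m ?y k z \<beta>"
      and ab: "act A n k \<alpha> a = act A m k \<beta> b" .
    \<comment> \<open>All coincidences in \<open>c\<close> between the finitely many points of
      \<open>x\<close> and \<open>y\<close> are realised simultaneously at a stage
      \<open>l\<close>.\<close>
    let ?V = "x ` {1..n} \<union> y ` {1..m}"
    let ?P = "{(s, t) \<in> ?V \<times> ?V. body (\<iota> j) s = body (\<iota> j) t}"
    have "finite ?P" by (rule finite_subset[of _ "?V \<times> ?V"]) auto
    moreover have "?P \<subseteq> {(s, t). s \<in> FObj D j \<and> t \<in> FObj D j \<and> body (\<iota> j) s = body (\<iota> j) t}"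
      using x(1) y(1) by auto
    ultimately obtain l h where h: "h \<in> Hom J j l" "\<forall>(s, t)\<in>?P. D.dmap h s = D.dmap h t"
      using D.finite_identify[OF cocone inj j, of ?P] by blast
    have l: "l \<in> Obj J" using D.Hom_Obj[OF h(1)] by simp
    have on: "onto n k \<alpha>" "onto m k \<beta>" and z: "\<forall>i\<in>{1..n}. ?x i = z (\<alpha> i)" "\<forall>i\<in>{1..m}. ?y i = z (\<beta> i)"
      using F G by (simp_all add: is_factorization_def)
    \<comment> \<open>A section of the surjection \<open>\<alpha>\<close>. Through it
      \<open>z'\<close> becomes a counterpart of \<open>z\<close> at stage \<open>l\<close>, each
      value being represented by one of the points of \<open>x\<close>.\<close>
    obtain r where r: "\<And>i. i \<in> {1..k} \<Longrightarrow> r i \<in> {1..n} \<and> \<alpha> (r i) = i"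
      using onto_surj[OF on(1)] by metis
    define z' where "z' i = D.dmap h (x (r i))" for i
    have z'D: "z' \<in> {1..k} \<rightarrow> FObj D l" using r x(1) D.dmap_in[OF h(1)] by (auto simp: z'_def Pi_iff)
    have hx: "D.dmap h (x i) = z' (\<alpha> i)" if i: "i \<in> {1..n}" for i
    proof -
      have "r (\<alpha> i) \<in> {1..n}" "\<alpha> (r (\<alpha> i)) = \<alpha> i" using r onto_in[OF on(1) i] by auto
      then have "(x i, x (r (\<alpha> i))) \<in> ?P" using z(1) i by auto
      then show ?thesis using h(2) by (auto simp: z'_def)
    qed
    have hy: "D.dmap h (y i) = z' (\<beta> i)" if i: "i \<in> {1..m}" for i
    proof -
      have "r (\<beta> i) \<in> {1..n}" "\<alpha> (r (\<beta> i)) = \<beta> i" using r onto_in[OF on(2) i] by auto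
      then have "(y i, x (r (\<beta> i))) \<in> ?P" using z i by auto
      then show ?thesis using h(2) by (auto simp: z'_def)
    qed
    have hxD: "(\<lambda>i. D.dmap h (x i)) \<in> {1..n} \<rightarrow> FObj D l" and hyD: "(\<lambda>i. D.dmap h (y i)) \<in> {1..m} \<rightarrow> FObj D l"
      using x(1) y(1) D.dmap_in[OF h(1)] by (auto simp: Pi_iff)
    \<comment> \<open>At stage \<open>l\<close> both maps factor through \<open>z'\<close>, by
      \<open>\<alpha>\<close> and \<open>\<beta>\<close> respectively, and the resulting labels
      agree by \<open>ab\<close>.\<close>
    have "HD.dmap h u = gen A (FObj D l) n (\<lambda>i. z' (\<alpha> i)) a"
      unfolding x(3) Hdmap[OF h(1) x(1,2)] by (rule gen_cong[OF hxD x(2) hx])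
    also have "\<dots> = gen A (FObj D l) m (\<lambda>i. z' (\<beta> i)) b"
      using gen_act[OF z'D on(1) x(2)] gen_act[OF z'D on(2) y(2)] ab by simp
    also have "\<dots> = HD.dmap h v"
      unfolding y(3) Hdmap[OF h(1) y(1,2)] by (rule gen_cong[OF hyD y(2) hy, symmetric])
    finally show "\<exists>k. \<exists>h\<in>Hom J j k. HD.dmap h u = HD.dmap h v" using h(1) by blast
  qed
  ultimately show "is_colimit J (Sets small) ?HD (FObj HA c) ?H\<iota>" by (rule HD.is_colimitI)
qed

lemma hat_semi_analytic: "semi_analytic small HA"
proof -
  interpret H: set_endo small HA by (rule set_endo_hat)
  show ?thesis using H.is_functor_axioms hat_finitary hat_pullbacks by (simp add: semi_analytic_def)
qed

end

context surj_trans
begin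

abbreviation "HT \<equiv> hat_trans small (Arrow A B t)"

lemma hat_trans_sel: "src HT = A.HA" "tgt HT = B.HA"
  "small X \<Longrightarrow> body HT X = hat_component (Arrow A B t) X"
  by (simp_all add: hat_trans_def)

lemma body_hat_trans:
  "small X \<Longrightarrow> x \<in> {1..n} \<rightarrow> X \<Longrightarrow> a \<in> FObj A n \<Longrightarrow>
    body (body HT X) (gen A X n x a) = gen B X n x (body (t n) a)"
  by (simp add: hat_trans_sel body_hat_component)

lemma hat_component_in_Hom:
  assumes "small X"
  shows "body HT X \<in> Hom (Sets small) (FObj A.HA X) (FObj B.HA X)"
proof -
  have "body (hat_component (Arrow A B t) X) u \<in> hat_set B X" if "u \<in> hat_set A X" for u
    using that
  proof (rule A.hat_setE)
    fix n x a assume "x \<in> {1..n} \<rightarrow> X" "a \<in> FObj A n" "u = gen A X n x a"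
    then show ?thesis using B.gen_in_hat_set t_in by (simp add: body_hat_component)
  qed
  moreover have "body (hat_component (Arrow A B t) X) \<in> extensional (hat_set A X)"
    by (simp add: hat_component_def)
  ultimately show ?thesis
    using assms A.small_hat_set B.small_hat_set
    by (auto simp: hat_trans_sel Hom_Sets_iff A.FObj_hat_func B.FObj_hat_func hat_component_def)
qed

text \<open>A map \<open>f\<close> changes only the map in [x, a], the transformation only the
  label, so the two operations commute.\<close>

lemma hat_trans_nat: "is_nat_trans (Sets small) (Sets small) A.HA B.HA (body HT)"
proof (rule set_valued_nat_transI)
  interpret HA: set_endo small A.HA by (rule A.set_endo_hat)
  interpret HB: set_endo small B.HA by (rule B.set_endo_hat)
  show "set_valued (Sets small) small A.HA" "set_valued (Sets small) small B.HA" by unfold_locales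
  show "body HT \<in> extensional (Obj (Sets small))" by (simp add: hat_trans_def)
  show "body HT X \<in> Hom (Sets small) (FObj A.HA X) (FObj B.HA X)" if "X \<in> Obj (Sets small)" for X
    using that by (simp add: hat_component_in_Hom)
  fix f X Y u assume f: "f \<in> Hom (Sets small) X Y" and "u \<in> FObj A.HA X"
  then have "u \<in> hat_set A X" and X: "small X" "small Y" using Hom_Sets_small[OF f] by (auto simp: A.FObj_hat_func)
  from this(1) show "body (body HT Y) (body (FArr A.HA f) u) = body (FArr B.HA f) (body (body HT X) u)"
  proof (rule A.hat_setE)
    fix n x a assume x: "x \<in> {1..n} \<rightarrow> X" and a: "a \<in> FObj A n" and u: "u = gen A X n x a"
    have "(\<lambda>i. body f (x i)) \<in> {1..n} \<rightarrow> Y" using x Hom_Sets_body[OF f] by auto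
    then show ?thesis
      using X x a u A.body_hat_func[OF f x a] B.body_hat_func[OF f x t_in[OF a]] by (simp add: body_hat_trans)
  qed
qed

text \<open>The transformation keeps the map in [y, a]. If the value at [y, a] comes from
  \<open>X\<close> along \<open>m\<close>, then \<open>y\<close> factors through \<open>m\<close>,
  and the factored map with the same label \<open>a\<close> is the lift; it is unique by
  \<open>hat_map_inj\<close>.\<close>

lemma hat_trans_semi_cartesian: "semi_cartesian small HT"
  unfolding semi_cartesian_def
proof (intro allI impI)
  interpret HA: set_endo small A.HA by (rule A.set_endo_hat)
  interpret HB: set_endo small B.HA by (rule B.set_endo_hat)
  fix m assume mono: "is_mono (Sets small) m"
  then obtain X Y where m: "m \<in> Hom (Sets small) X Y" and sm: "src m = X" "tgt m = Y"
    by (auto simp: is_mono_def Arr_Sets_iff)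
  have small: "small X" "small Y" using Hom_Sets_small[OF m] by auto
  have inj: "inj_on (body m) X" using mono A.is_mono_Sets_iff[OF m] by simp
  show "is_pullback (Sets small) (FArr (src HT) m) (body HT (src m)) (body HT (tgt m)) (FArr (tgt HT) m)"
    unfolding hat_trans_sel sm
  proof (rule A.is_pullback_SetsI[OF HA.FArr_in_Hom[OF m] hat_component_in_Hom hat_component_in_Hom HB.FArr_in_Hom[OF m]])
    show "small X" "small Y" by fact+
    fix u assume "u \<in> FObj A.HA X"
    then show "body (body HT Y) (body (FArr A.HA m) u) = body (FArr B.HA m) (body (body HT X) u)"
      by (rule nat_trans_set_valued(4)[OF hat_trans_nat m])
  next
    fix u v assume "u \<in> FObj A.HA Y" "v \<in> FObj B.HA X"
      and eq: "body (body HT Y) u = body (FArr B.HA m) v"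
    then have u: "u \<in> hat_set A Y" and v: "v \<in> hat_set B X"
      using small by (simp_all add: A.FObj_hat_func B.FObj_hat_func)
    from u obtain n y a where y: "y \<in> {1..n} \<rightarrow> Y" "inj_on y {1..n}" "a \<in> FObj A n" "u = gen A Y n y a"
      by (rule A.hat_setE)
    from v obtain k x b where x: "x \<in> {1..k} \<rightarrow> X" "inj_on x {1..k}" "b \<in> FObj B k" "v = gen B X k x b"
      by (rule B.hat_setE)
    have mx: "(\<lambda>i. body m (x i)) \<in> {1..k} \<rightarrow> Y" "inj_on (\<lambda>i. body m (x i)) {1..k}"
      by (rule body_comp_funcset[OF m x(1)] inj_on_comp_funcset[OF inj x(2,1)])+
    have "gen B Y n y (body (t n) a) = gen B Y k (\<lambda>i. body m (x i)) b"
      using eq x y small B.body_hat_func[OF m x(1,3)] by (simp add: body_hat_trans)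
    from B.gen_inj_eqD[OF y(1,2) t_in[OF y(3)] mx x(3) this] obtain \<sigma> where n: "n = k"
      and \<sigma>: "onto n n \<sigma>" "\<forall>i\<in>{1..n}. y i = body m (x (\<sigma> i))" "b = act B n n \<sigma> (body (t n) a)" by blast
    have x\<sigma>: "(\<lambda>i. x (\<sigma> i)) \<in> {1..n} \<rightarrow> X" using x(1) onto_in[OF \<sigma>(1)] n by auto
    show "\<exists>w\<in>FObj A.HA X. body (FArr A.HA m) w = u \<and> body (body HT X) w = v"
    proof (intro bexI conjI)
      show "gen A X n (\<lambda>i. x (\<sigma> i)) a \<in> FObj A.HA X"
        using A.gen_in_hat_set[OF x\<sigma> y(3)] small by (simp add: A.FObj_hat_func)
      show "body (FArr A.HA m) (gen A X n (\<lambda>i. x (\<sigma> i)) a) = u"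
        using A.body_hat_func[OF m x\<sigma> y(3)] A.gen_cong[OF y(1,3), of "\<lambda>i. body m (x (\<sigma> i))"] \<sigma>(2) y(4) by simp
      show "body (body HT X) (gen A X n (\<lambda>i. x (\<sigma> i)) a) = v"
        using body_hat_trans[OF small(1) x\<sigma> y(3)] B.gen_act[of x n X n \<sigma>] t_in[OF y(3)] x n \<sigma> by simp
    qed
  next
    fix u v assume "u \<in> FObj A.HA X" "v \<in> FObj A.HA X" "body (FArr A.HA m) u = body (FArr A.HA m) v"
    then show "u = v" using inj_onD[OF A.hat_map_inj[OF m inj]] small by (simp add: A.FObj_hat_func)
  qed
qed

end


section \<open>Natural transformations between endofunctors\<close>

lemma End_sel:
  "Obj (End small) = {F. is_functor (Sets small) (Sets small) F \<and> finitary small F}"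
  "Arr (End small) = {t. is_nat_trans (Sets small) (Sets small) (src t) (tgt t) (body t) \<and>
     finitary small (src t) \<and> finitary small (tgt t)}"
  "Dom (End small) = src" "Cod (End small) = tgt"
  "Ide (End small) F = Arrow F F (\<lambda>X\<in>Obj (Sets small). Ide (Sets small) (FObj F X))"
  "t \<cdot>\<^bsub>End small\<^esub> s = Arrow (src s) (tgt t) (\<lambda>X\<in>Obj (Sets small). body t X \<cdot>\<^bsub>Sets small\<^esub> body s X)"
  by (auto simp: End_def functor_category_def Let_def)

lemma category_End: "category (End small)"
proof -
  let ?E = "functor_category (Sets small) (Sets small)"
  let ?R = "{t \<in> Arr ?E. finitary small (src t) \<and> finitary small (tgt t)}"
  have "category (?E\<lparr>Obj := {F \<in> Obj ?E. finitary small F}, Arr := ?R\<rparr>)"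
  proof (rule category_restrict[OF category_functor_category[OF category_Sets category_Sets]])
    fix s t assume "s \<in> ?R" "t \<in> ?R" "Cod ?E s = Dom ?E t"
    then show "t \<cdot>\<^bsub>?E\<^esub> s \<in> ?R"
      by (auto simp: functor_category_def nat_trans_comp)
  next
    fix t assume "t \<in> ?R"
    then show "Dom ?E t \<in> {F \<in> Obj ?E. finitary small F} \<and> Cod ?E t \<in> {F \<in> Obj ?E. finitary small F}"
      by (simp add: functor_category_def is_nat_trans_def)
  next
    fix F assume "F \<in> {F \<in> Obj ?E. finitary small F}"
    then show "Ide ?E F \<in> ?R"
      by (simp add: functor_category_def nat_trans_ide)
  qed auto
  then show ?thesis by (simp add: End_def Let_def)
qed

lemma Hom_End_iff: "t \<in> Hom (End small) F G \<longleftrightarrow> src t = F \<and> tgt t = G \<and>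
    is_nat_trans (Sets small) (Sets small) F G (body t) \<and> finitary small F \<and> finitary small G"
  by (auto simp: Hom_iff End_sel)

lemma Hom_EndD:
  assumes "t \<in> Hom (End small) F G"
  shows "set_endo small F" "set_endo small G"
    "small X \<Longrightarrow> body t X \<in> Hom (Sets small) (FObj F X) (FObj G X)"
    "small X \<Longrightarrow> u \<in> FObj F X \<Longrightarrow> body (body t X) u \<in> FObj G X"
    "f \<in> Hom (Sets small) X Y \<Longrightarrow> u \<in> FObj F X \<Longrightarrow>
      body (body t Y) (body (FArr F f) u) = body (FArr G f) (body (body t X) u)"
proof -
  have nat: "is_nat_trans (Sets small) (Sets small) F G (body t)" using assms by (simp add: Hom_End_iff)
  show "set_endo small F" "set_endo small G"
    using nat_trans_set_valued(1,2)[OF nat] by (simp_all add: set_endo_def)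
  show X: "body t X \<in> Hom (Sets small) (FObj F X) (FObj G X)" if "small X" for X
    using nat_trans_set_valued(3)[OF nat] that by simp
  show "body (body t X) u \<in> FObj G X" if "small X" "u \<in> FObj F X"
    by (rule Hom_Sets_body[OF X]) fact+
  show "body (body t Y) (body (FArr F f) u) = body (FArr G f) (body (body t X) u)"
    if "f \<in> Hom (Sets small) X Y" "u \<in> FObj F X"
    by (rule nat_trans_set_valued(4)[OF nat that])
qed

lemma Hom_End_eqI:
  assumes s: "s \<in> Hom (End small) F G" and t: "t \<in> Hom (End small) F G"
    and eq: "\<And>X u. small X \<Longrightarrow> u \<in> FObj F X \<Longrightarrow> body (body s X) u = body (body t X) u"
  shows "s = t"
proof -
  have "body s X = body t X" if "small X" for X
    using Hom_Sets_eqI[OF Hom_EndD(3)[OF s that] Hom_EndD(3)[OF t that]] eq[OF that] by simp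
  then have "body s = body t"
    using s t by (intro extensionalityI[of _ "Obj (Sets small)"]) (auto simp: Hom_End_iff is_nat_trans_def)
  then show ?thesis using s t by (auto simp: Hom_End_iff intro: arrow.expand)
qed

lemma body_Comp_End:
  assumes "s \<in> Hom (End small) F G" "small X" "u \<in> FObj F X"
  shows "body (body (t \<cdot>\<^bsub>End small\<^esub> s) X) u = body (body t X) (body (body s X) u)"
proof -
  have "src (body s X) = FObj F X" using Hom_EndD(3)[OF assms(1,2)] by (simp add: Hom_Sets_iff)
  then show ?thesis using assms by (simp add: End_sel)
qed

lemma body_Ide_End: "small X \<Longrightarrow> u \<in> FObj F X \<Longrightarrow> body (body (Ide (End small) F) X) u = u"
  by (simp add: End_sel Ide_Sets)

lemma Comp_End_in_Hom:
  "s \<in> Hom (End small) F G \<Longrightarrow> t \<in> Hom (End small) G H \<Longrightarrow> t \<cdot>\<^bsub>End small\<^esub> s \<in> Hom (End small) F H"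
  by (rule category.Comp_in_Hom[OF category_End])

lemma is_iso_End_bij:
  assumes t: "t \<in> Hom (End small) F G" and iso: "is_iso (End small) t" and X: "small X"
  shows "bij_betw (body (body t X)) (FObj F X) (FObj G X)"
proof -
  have st: "Dom (End small) t = F" "Cod (End small) t = G" using t by (simp_all add: Hom_iff)
  then obtain s where s: "s \<in> Hom (End small) G F"
    and st: "s \<cdot>\<^bsub>End small\<^esub> t = Ide (End small) F" "t \<cdot>\<^bsub>End small\<^esub> s = Ide (End small) G"
    using iso by (auto simp: is_iso_def)
  show ?thesis
  proof (rule bij_betw_byWitness[where f' = "body (body s X)"])
    show "\<forall>u\<in>FObj F X. body (body s X) (body (body t X) u) = u"
      using body_Comp_End[OF t X, of _ s] body_Ide_End[of small X _ F] X st(1) by simp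
    show "\<forall>u\<in>FObj G X. body (body t X) (body (body s X) u) = u"
      using body_Comp_End[OF s X, of _ t] body_Ide_End[of small X _ G] X st(2) by simp
  qed (use Hom_EndD(4)[OF t X] Hom_EndD(4)[OF s X] in auto)
qed

text \<open>Pointwise inverses of a natural transformation are natural. The conclusion names the
  inverse as well, because later arguments conjugate by it.\<close>

lemma is_iso_EndI:
  assumes t: "t \<in> Hom (End small) F G"
    and bij: "\<And>X. small X \<Longrightarrow> bij_betw (body (body t X)) (FObj F X) (FObj G X)"
  shows "\<exists>s\<in>Hom (End small) G F. s \<cdot>\<^bsub>End small\<^esub> t = Ide (End small) F \<and>
      t \<cdot>\<^bsub>End small\<^esub> s = Ide (End small) G \<and> is_iso (End small) s \<and> is_iso (End small) t"
proof -
  interpret F: set_endo small F by (rule Hom_EndD(1)[OF t])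
  interpret G: set_endo small G by (rule Hom_EndD(2)[OF t])
  define i where "i X = inv_into (FObj F X) (body (body t X))" for X
  have i1: "i X (body (body t X) u) = u" if "small X" "u \<in> FObj F X" for X u
    using bij_betw_inv_into_left[OF bij] that by (simp add: i_def)
  have i2: "body (body t X) (i X v) = v" "i X v \<in> FObj F X" if "small X" "v \<in> FObj G X" for X v
    using bij_betw_inv_into_right[OF bij] that bij_betwE[OF bij_betw_inv_into[OF bij]] by (auto simp: i_def)
  let ?s = "Arrow G F (\<lambda>X\<in>Obj (Sets small). mor (FObj G X) (FObj F X) (i X))"
  have "is_nat_trans (Sets small) (Sets small) G F (body ?s)"
  proof (rule set_valued_nat_transI)
    show "set_valued (Sets small) small G" "set_valued (Sets small) small F" by unfold_locales
    show "body ?s X \<in> Hom (Sets small) (FObj G X) (FObj F X)" if "X \<in> Obj (Sets small)" for X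
      using that i2(2) F.small_FObj G.small_FObj by (auto intro!: mor_in_Hom)
    fix f X Y v assume f: "f \<in> Hom (Sets small) X Y" and v: "v \<in> FObj G X"
    have X: "small X" "small Y" using Hom_Sets_small[OF f] by auto
    have "i Y (body (FArr G f) (body (body t X) (i X v))) = body (FArr F f) (i X v)"
      using Hom_EndD(5)[OF t f i2(2)[OF X(1) v]] i1[OF X(2) F.body_in[OF f i2(2)[OF X(1) v]]] by simp
    then show "body (body ?s Y) (body (FArr G f) v) = body (FArr F f) (body (body ?s X) v)"
      using X v G.body_in[OF f v] i2(1)[OF X(1) v] by simp
  qed simp
  then have s: "?s \<in> Hom (End small) G F" using t by (simp add: Hom_End_iff)
  have "?s \<cdot>\<^bsub>End small\<^esub> t = Ide (End small) F"
    by (rule Hom_End_eqI[OF Comp_End_in_Hom[OF t s] category.Ide_in_Hom[OF category_End]])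
      (use t i1 Hom_EndD(4)[OF t] F.is_functor_axioms in \<open>auto simp: body_Comp_End[OF t] body_Ide_End Hom_End_iff End_sel(1)\<close>)
  moreover have "t \<cdot>\<^bsub>End small\<^esub> ?s = Ide (End small) G"
    by (rule Hom_End_eqI[OF Comp_End_in_Hom[OF s t] category.Ide_in_Hom[OF category_End]])
      (use t i2 G.is_functor_axioms in \<open>auto simp: body_Comp_End[OF s] body_Ide_End Hom_End_iff End_sel(1)\<close>)
  ultimately show ?thesis
    using s t by (intro bexI[OF _ s]) (auto simp: is_iso_def Hom_iff)
qed

section \<open>Semi-cartesian transformations in terms of elements\<close>

context set_universe
begin

lemma semi_cartesianD:
  assumes sc: "semi_cartesian small t" and t: "t \<in> Hom (End small) F G"
    and m: "m \<in> Hom (Sets small) X Y" "inj_on (body m) X"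
    and "u \<in> FObj F Y" "v \<in> FObj G X" "body (body t Y) u = body (FArr G m) v"
  shows "\<exists>!w. w \<in> FObj F X \<and> body (FArr F m) w = u \<and> body (body t X) w = v"
proof -
  interpret F: set_endo small F by (rule Hom_EndD(1)[OF t])
  interpret G: set_endo small G by (rule Hom_EndD(2)[OF t])
  have eq: "src t = F" "tgt t = G" "src m = X" "tgt m = Y" using t m by (auto simp: Hom_End_iff Hom_Sets_iff)
  have "is_pullback (Sets small) (FArr F m) (body t X) (body t Y) (FArr G m)"
    using sc m is_mono_Sets_iff[OF m(1)] eq by (auto simp: semi_cartesian_def)
  then obtain W U V Z where "FArr F m \<in> Hom (Sets small) W U" "body t X \<in> Hom (Sets small) W V"
    and univ: "\<And>x y. x \<in> U \<Longrightarrow> y \<in> V \<Longrightarrow> body (body t Y) x = body (FArr G m) y \<Longrightarrow>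
      \<exists>!w. w \<in> W \<and> body (FArr F m) w = x \<and> body (body t X) w = y"
    by (rule is_pullback_SetsD) blast
  then have "W = FObj F X" "U = FObj F Y" "V = FObj G X"
    using F.FArr_in_Hom[OF m(1)] Hom_EndD(3)[OF t, of X] Hom_Sets_small[OF m(1)]
    by (auto simp: Hom_Sets_iff)
  then show ?thesis using univ assms by simp
qed

lemma semi_cartesianI:
  assumes t: "t \<in> Hom (End small) F G"
    and H: "\<And>m X Y u v. m \<in> Hom (Sets small) X Y \<Longrightarrow> inj_on (body m) X \<Longrightarrow> u \<in> FObj F Y \<Longrightarrow> v \<in> FObj G X \<Longrightarrow>
      body (body t Y) u = body (FArr G m) v \<Longrightarrow>
      \<exists>!w. w \<in> FObj F X \<and> body (FArr F m) w = u \<and> body (body t X) w = v"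
  shows "semi_cartesian small t"
  unfolding semi_cartesian_def
proof (intro allI impI)
  interpret F: set_endo small F by (rule Hom_EndD(1)[OF t])
  interpret G: set_endo small G by (rule Hom_EndD(2)[OF t])
  fix m assume mono: "is_mono (Sets small) m"
  then obtain X Y where m: "m \<in> Hom (Sets small) X Y" and eq: "src m = X" "tgt m = Y" "src t = F" "tgt t = G"
    using t by (auto simp: is_mono_def Arr_Sets_iff Hom_End_iff)
  have small: "small X" "small Y" using Hom_Sets_small[OF m] by auto
  have inj: "inj_on (body m) X" using mono is_mono_Sets_iff[OF m] by simp
  show "is_pullback (Sets small) (FArr (src t) m) (body t (src m)) (body t (tgt m)) (FArr (tgt t) m)"
    unfolding eq
  proof (rule is_pullback_SetsI[OF F.FArr_in_Hom[OF m] Hom_EndD(3)[OF t small(1)] Hom_EndD(3)[OF t small(2)]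
        G.FArr_in_Hom[OF m] Hom_EndD(5)[OF t m]])
    fix w w' assume w: "w \<in> FObj F X" "w' \<in> FObj F X" "body (FArr F m) w = body (FArr F m) w'"
      "body (body t X) w = body (body t X) w'"
    then have "\<exists>!v. v \<in> FObj F X \<and> body (FArr F m) v = body (FArr F m) w \<and> body (body t X) v = body (body t X) w"
      using F.body_in[OF m] Hom_EndD(4)[OF t small(1)] Hom_EndD(5)[OF t m] by (intro H[OF m inj]) auto
    then show "w = w'" using w by (metis (full_types))
  qed (use H[OF m inj] in blast)+
qed

text \<open>A commuting square with two opposite bijective sides is a pullback. This covers the
  isomorphisms of \<open>End\<close>.\<close>

lemma semi_cartesian_bij:
  assumes t: "t \<in> Hom (End small) F G"
    and bij: "\<And>X. small X \<Longrightarrow> bij_betw (body (body t X)) (FObj F X) (FObj G X)"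
  shows "semi_cartesian small t"
proof (rule semi_cartesianI[OF t])
  interpret F: set_endo small F by (rule Hom_EndD(1)[OF t])
  fix m X Y u v assume m: "m \<in> Hom (Sets small) X Y" and u: "u \<in> FObj F Y" and v: "v \<in> FObj G X"
    and eq: "body (body t Y) u = body (FArr G m) v"
  have small: "small X" "small Y" using Hom_Sets_small[OF m] by auto
  obtain w where w: "w \<in> FObj F X" "body (body t X) w = v"
    using bij_betw_imp_surj_on[OF bij[OF small(1)]] v by (metis imageE)
  have "body (body t Y) (body (FArr F m) w) = body (body t Y) u" using Hom_EndD(5)[OF t m w(1)] w(2) eq by simp
  then have "body (FArr F m) w = u"
    using inj_onD[OF bij_betw_imp_inj_on[OF bij[OF small(2)]]] F.body_in[OF m w(1)] u by blast
  then show "\<exists>!w. w \<in> FObj F X \<and> body (FArr F m) w = u \<and> body (body t X) w = v"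
    using w inj_onD[OF bij_betw_imp_inj_on[OF bij[OF small(1)]]] by (intro ex1I[of _ w]) auto
qed

text \<open>Pasting of pullback squares: an element is lifted through the square of \<open>t\<close>
  and the result through that of \<open>s\<close>.\<close>

lemma semi_cartesian_Comp:
  assumes s: "s \<in> Hom (End small) F G" "semi_cartesian small s"
    and t: "t \<in> Hom (End small) G H" "semi_cartesian small t"
  shows "semi_cartesian small (t \<cdot>\<^bsub>End small\<^esub> s)"
proof (rule semi_cartesianI[OF Comp_End_in_Hom[OF s(1) t(1)]])
  fix m X Y u v assume m: "m \<in> Hom (Sets small) X Y" "inj_on (body m) X"
    and u: "u \<in> FObj F Y" and v: "v \<in> FObj H X"
    and eq: "body (body (t \<cdot>\<^bsub>End small\<^esub> s) Y) u = body (FArr H m) v"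
  have small: "small X" "small Y" using Hom_Sets_small[OF m(1)] by auto
  have su: "body (body s Y) u \<in> FObj G Y" by (rule Hom_EndD(4)[OF s(1) small(2) u])
  have "body (body t Y) (body (body s Y) u) = body (FArr H m) v"
    using eq body_Comp_End[OF s(1) small(2) u] by simp
  from semi_cartesianD[OF t(2,1) m su v this] obtain w where
    w: "w \<in> FObj G X" "body (FArr G m) w = body (body s Y) u" "body (body t X) w = v"
    and uw: "\<And>w'. w' \<in> FObj G X \<Longrightarrow> body (FArr G m) w' = body (body s Y) u \<Longrightarrow> body (body t X) w' = v \<Longrightarrow> w' = w"
    by blast
  from semi_cartesianD[OF s(2,1) m u w(1) w(2)[symmetric]] obtain z where
    z: "z \<in> FObj F X" "body (FArr F m) z = u" "body (body s X) z = w"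
    and uz: "\<And>z'. z' \<in> FObj F X \<Longrightarrow> body (FArr F m) z' = u \<Longrightarrow> body (body s X) z' = w \<Longrightarrow> z' = z"
    by blast
  show "\<exists>!w. w \<in> FObj F X \<and> body (FArr F m) w = u \<and> body (body (t \<cdot>\<^bsub>End small\<^esub> s) X) w = v"
  proof (intro ex1I conjI)
    show "z \<in> FObj F X" "body (FArr F m) z = u" by fact+
    show "body (body (t \<cdot>\<^bsub>End small\<^esub> s) X) z = v" using body_Comp_End[OF s(1) small(1) z(1)] z w by simp
    fix z' assume z': "z' \<in> FObj F X \<and> body (FArr F m) z' = u \<and> body (body (t \<cdot>\<^bsub>End small\<^esub> s) X) z' = v"
    have "body (body s X) z' = w"
    proof (rule uw)
      show "body (body s X) z' \<in> FObj G X" using Hom_EndD(4)[OF s(1) small(1)] z' by blast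
      show "body (FArr G m) (body (body s X) z') = body (body s Y) u"
        using Hom_EndD(5)[OF s(1) m(1), of z'] z' by simp
      show "body (body t X) (body (body s X) z') = v" using body_Comp_End[OF s(1) small(1), of z'] z' by simp
    qed
    then show "z' = z" using z' by (intro uz) simp_all
  qed
qed

section \<open>The functor is faithful, and hits all semi-cartesian transformations\<close>

lemma SetS_sel:
  "Obj (SetS small) = {A. is_functor Surj (Sets small) A}"
  "Arr (SetS small) = {t. is_nat_trans Surj (Sets small) (src t) (tgt t) (body t)}"
  "Dom (SetS small) = src" "Cod (SetS small) = tgt"
  "Ide (SetS small) A = Arrow A A (\<lambda>n\<in>Obj Surj. Ide (Sets small) (FObj A n))"
  "t \<cdot>\<^bsub>SetS small\<^esub> s = Arrow (src s) (tgt t) (\<lambda>n\<in>Obj Surj. body t n \<cdot>\<^bsub>Sets small\<^esub> body s n)"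
  by (simp_all add: SetS_def functor_category_def)

lemma category_SetS: "category (SetS small)"
  unfolding SetS_def by (rule category_functor_category[OF category_Surj category_Sets])

lemma surj_functor_iff: "A \<in> Obj (SetS small) \<longleftrightarrow> surj_functor small A"
  by (simp add: SetS_sel surj_functor_def set_valued_def set_universe_axioms)

lemma surj_trans_iff: "t \<in> Hom (SetS small) A B \<longleftrightarrow>
    src t = A \<and> tgt t = B \<and> surj_trans small A B (body t)"
  by (auto simp: Hom_iff SetS_sel surj_trans_def surj_trans_axioms_def surj_functor_def set_valued_def
      set_universe_axioms is_nat_trans_def)

lemma FObj_hat: "A \<in> Obj (SetS small) \<Longrightarrow> FObj (hat small) A = hat_func small A"
  by (simp add: hat_def)

lemma FArr_hat: "t \<in> Hom (SetS small) A B \<Longrightarrow> FArr (hat small) t = hat_trans small t"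
  by (simp add: hat_def Hom_iff)

lemma hat_trans_in_Hom:
  assumes "t \<in> Hom (SetS small) A B"
  shows "hat_trans small t \<in> Hom (End small) (hat_func small A) (hat_func small B)"
    "semi_cartesian small (hat_trans small t)"
proof -
  have eq: "t = Arrow A B (body t)" and "surj_trans small A B (body t)"
    using assms by (auto simp: surj_trans_iff intro: arrow.expand)
  then interpret surj_trans small A B "body t" by simp
  show "hat_trans small t \<in> Hom (End small) (hat_func small A) (hat_func small B)"
    using hat_trans_nat hat_trans_sel A.hat_finitary B.hat_finitary by (subst eq) (simp add: Hom_End_iff)
  show "semi_cartesian small (hat_trans small t)"
    using hat_trans_semi_cartesian by (subst eq)
qed

lemma body_hat_trans_gen:
  assumes t: "t \<in> Hom (SetS small) A B" and "small X" "x \<in> {1..n} \<rightarrow> X" "a \<in> FObj A n"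
  shows "body (body (hat_trans small t) X) (gen A X n x a) = gen B X n x (body (body t n) a)"
proof -
  have eq: "t = Arrow A B (body t)" and "surj_trans small A B (body t)"
    using t by (auto simp: surj_trans_iff intro: arrow.expand)
  then interpret surj_trans small A B "body t" by simp
  show ?thesis using body_hat_trans[OF assms(2-4)] by (subst eq)
qed

lemma hat_func_in_Obj: "A \<in> Obj (SetS small) \<Longrightarrow> hat_func small A \<in> Obj (End small)"
  using surj_functor.hat_finitary surj_functor.set_endo_hat
  by (auto simp: surj_functor_iff End_sel set_endo_def set_valued_def)

text \<open>The elements \<open>gen A X n x a\<close> exhaust the associated functor, so it suffices
  to compare values on them.\<close>

lemma Hom_hat_eqI:
  assumes A: "A \<in> Obj (SetS small)"
    and s: "s \<in> Hom (End small) (hat_func small A) G" and t: "t \<in> Hom (End small) (hat_func small A) G"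
    and eq: "\<And>X n x a. small X \<Longrightarrow> x \<in> {1..n} \<rightarrow> X \<Longrightarrow> a \<in> FObj A n \<Longrightarrow>
      body (body s X) (gen A X n x a) = body (body t X) (gen A X n x a)"
  shows "s = t"
proof (rule Hom_End_eqI[OF s t])
  interpret A: surj_functor small A using A by (simp add: surj_functor_iff)
  fix X u assume X: "small X" and "u \<in> FObj (hat_func small A) X"
  then have "u \<in> hat_set A X" by (simp add: A.FObj_hat_func)
  then obtain n x a where "x \<in> {1..n} \<rightarrow> X" "a \<in> FObj A n" "u = gen A X n x a" by (rule A.hat_setE)
  then show "body (body s X) u = body (body t X) u" using eq[OF X] by simp
qed

lemma is_functor_hat: "is_functor (SetS small) (End small) (hat small)"
proof -
  interpret S: category "SetS small" by (rule category_SetS)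
  interpret E: category "End small" by (rule category_End)
  show ?thesis
  proof
    fix A assume A: "A \<in> Obj (SetS small)"
    then interpret A: surj_functor small A by (simp add: surj_functor_iff)
    show "FObj (hat small) A \<in> Obj (End small)" using hat_func_in_Obj[OF A] by (simp add: FObj_hat[OF A])
    have id: "Ide (SetS small) A \<in> Hom (SetS small) A A" by (rule S.Ide_in_Hom[OF A])
    show "FArr (hat small) (Ide (SetS small) A) = Ide (End small) (FObj (hat small) A)"
      unfolding FArr_hat[OF id] FObj_hat[OF A]
    proof (rule Hom_hat_eqI[OF A hat_trans_in_Hom(1)[OF id] E.Ide_in_Hom[OF hat_func_in_Obj[OF A]]])
      fix X n x a assume X: "small X" and x: "x \<in> {1..n} \<rightarrow> X" and a: "a \<in> FObj A n"
      show "body (body (hat_trans small (Ide (SetS small) A)) X) (gen A X n x a) =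
          body (body (Ide (End small) (hat_func small A)) X) (gen A X n x a)"
        using body_hat_trans_gen[OF id X x a] a X A.gen_in_hat_set[OF x a]
        by (simp add: body_Ide_End A.FObj_hat_func SetS_sel Ide_Sets)
    qed
  next
    fix s t A B C assume s: "s \<in> Hom (SetS small) A B"
    then have A: "A \<in> Obj (SetS small)" and B: "B \<in> Obj (SetS small)"
      using S.Dom_in_Obj S.Cod_in_Obj by (auto simp: Hom_iff)
    show "FArr (hat small) s \<in> Hom (End small) (FObj (hat small) A) (FObj (hat small) B)"
      using hat_trans_in_Hom(1)[OF s] by (simp add: FArr_hat[OF s] FObj_hat A B)
    assume t: "t \<in> Hom (SetS small) B C"
    have ts: "t \<cdot>\<^bsub>SetS small\<^esub> s \<in> Hom (SetS small) A C" by (rule S.Comp_in_Hom[OF s t])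
    show "FArr (hat small) (t \<cdot>\<^bsub>SetS small\<^esub> s) = FArr (hat small) t \<cdot>\<^bsub>End small\<^esub> FArr (hat small) s"
      unfolding FArr_hat[OF s] FArr_hat[OF t] FArr_hat[OF ts]
    proof (rule Hom_hat_eqI[OF A hat_trans_in_Hom(1)[OF ts] Comp_End_in_Hom[OF hat_trans_in_Hom(1)[OF s] hat_trans_in_Hom(1)[OF t]]])
      interpret s: surj_trans small A B "body s" using s by (simp add: surj_trans_iff)
      fix X n x a assume X: "small X" and x: "x \<in> {1..n} \<rightarrow> X" and a: "a \<in> FObj A n"
      have "gen A X n x a \<in> FObj (hat_func small A) X" using s.A.gen_in_hat_set[OF x a] X by (simp add: s.A.FObj_hat_func)
      moreover have "a \<in> src (body s n)"
        using nat_trans_set_valued(3)[OF s.nat_trans, of n] a by (simp add: Hom_Sets_iff)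
      ultimately show "body (body (hat_trans small (t \<cdot>\<^bsub>SetS small\<^esub> s)) X) (gen A X n x a) =
          body (body (hat_trans small t \<cdot>\<^bsub>End small\<^esub> hat_trans small s) X) (gen A X n x a)"
        using body_hat_trans_gen[OF ts X x a] body_hat_trans_gen[OF s X x a]
          body_hat_trans_gen[OF t X x s.t_in[OF a]] body_Comp_End[OF hat_trans_in_Hom(1)[OF s] X]
        by (simp add: SetS_sel)
    qed
  qed (auto simp: hat_def)
qed

section \<open>Generic elements, faithfulness and fullness\<close>

definition nu :: "nat \<Rightarrow> 'u" where
  "nu = (SOME e. inj e)"

text \<open>The objects (n] consist of natural numbers, while endofunctors act on subsets of
  \<open>'u\<close>. \<open>N n\<close> is the copy of (n] along the injection \<open>nu\<close>,
  and \<open>inv nu\<close> translates back.\<close>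

definition N :: "nat \<Rightarrow> 'u set" where
  "N n = nu ` {1..n}"

lemma inj_nu: "inj nu"
  unfolding nu_def using infinite_countable_subset[OF infinite_UNIV_universe] by (intro someI_ex[of inj]) blast

lemma nu_funcset: "nu \<in> {1..n} \<rightarrow> N n"
  by (simp add: N_def)

lemma inj_on_nu: "inj_on nu S"
  using inj_nu by (rule inj_on_subset) simp

lemma inv_nu [simp]: "inv nu (nu i) = i"
  by (rule inv_f_f[OF inj_nu])

lemma nu_inv: "v \<in> N n \<Longrightarrow> nu (inv nu v) = v" "v \<in> N n \<Longrightarrow> inv nu v \<in> {1..n}"
  by (auto simp: N_def)

lemma small_N: "small (N n)"
  by (simp add: N_def small_finite)

text \<open>The permutation relating the two representatives fixes the injection \<open>x\<close>,
  so it is the identity and the labels agree.\<close>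

lemma gen_cancel:
  assumes "A \<in> Obj (SetS small)" "x \<in> {1..n} \<rightarrow> X" "inj_on x {1..n}" "a \<in> FObj A n" "b \<in> FObj A n"
    and "gen A X n x a = gen A X n x b"
  shows "a = b"
proof -
  interpret A: surj_functor small A using assms(1) by (simp add: surj_functor_iff)
  obtain \<sigma> where \<sigma>: "onto n n \<sigma>" "\<forall>i\<in>{1..n}. x i = x (\<sigma> i)" "b = act A n n \<sigma> a"
    using A.gen_inj_eqD(2)[OF assms(2,3,4,2,3,5,6)] by blast
  have "\<sigma> i = i" if "i \<in> {1..n}" for i
    using inj_onD[OF assms(3), of "\<sigma> i" i] \<sigma>(2) that onto_in[OF \<sigma>(1) that] by simp
  then show ?thesis using A.act_ident[OF assms(4)] \<sigma>(3) by simp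
qed

text \<open>The value of the induced transformation at [nu, a] is [nu, s(a)], and
  \<open>gen_cancel\<close> recovers s(a) from it.\<close>

lemma faithful_hat: "faithful (SetS small) (hat small)"
  unfolding faithful_def
proof (intro ballI inj_onI)
  fix A B s t assume A: "A \<in> Obj (SetS small)" and B: "B \<in> Obj (SetS small)"
    and s: "s \<in> Hom (SetS small) A B" and t: "t \<in> Hom (SetS small) A B"
    and eq: "FArr (hat small) s = FArr (hat small) t"
  interpret s: surj_trans small A B "body s" using s by (simp add: surj_trans_iff)
  interpret t: surj_trans small A B "body t" using t by (simp add: surj_trans_iff)
  have "body s n = body t n" for n
  proof (rule Hom_Sets_eqI)
    show "body s n \<in> Hom (Sets small) (FObj A n) (FObj B n)" "body t n \<in> Hom (Sets small) (FObj A n) (FObj B n)"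
      using nat_trans_set_valued(3)[OF s.nat_trans, of n] nat_trans_set_valued(3)[OF t.nat_trans, of n] by simp_all
    fix a assume a: "a \<in> FObj A n"
    have "gen B (N n) n nu (body (body s n) a) = gen B (N n) n nu (body (body t n) a)"
      using eq body_hat_trans_gen[OF s small_N nu_funcset a] body_hat_trans_gen[OF t small_N nu_funcset a]
      by (simp add: FArr_hat[OF s] FArr_hat[OF t])
    then show "body (body s n) a = body (body t n) a"
      by (rule gen_cancel[OF B nu_funcset inj_on_nu s.t_in[OF a] t.t_in[OF a]])
  qed
  then have "body s = body t" by (rule ext)
  then show "s = t" using s t by (auto simp: surj_trans_iff intro: arrow.expand)
qed

text \<open>
  A semi-cartesian \<open>t\<close> preserves supports: \<open>t [x, a] = [y, b]\<close> forces \<open>y\<close> to have the same image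
  as \<open>x\<close>. Hence \<open>t [\<nu>, a] = [\<nu>, c]\<close> for a unique \<open>c\<close>, where \<open>\<nu>\<close> is the canonical injection of
  \<open>{1..n}\<close> into the universe.
\<close>

lemma semi_cartesian_preserves_support:
  assumes A: "A \<in> Obj (SetS small)" and B: "B \<in> Obj (SetS small)"
    and t: "t \<in> Hom (End small) (hat_func small A) (hat_func small B)" and sc: "semi_cartesian small t"
    and a: "a \<in> FObj A n"
  shows "\<exists>c\<in>FObj B n. body (body t (N n)) (gen A (N n) n nu a) = gen B (N n) n nu c"
proof -
  interpret A: surj_functor small A using A by (simp add: surj_functor_iff)
  interpret B: surj_functor small B using B by (simp add: surj_functor_iff)
  let ?u = "gen A (N n) n nu a"
  have u: "?u \<in> FObj A.HA (N n)" using A.gen_in_hat_set[OF nu_funcset a] small_N by (simp add: A.FObj_hat_func)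
  then have "body (body t (N n)) ?u \<in> hat_set B (N n)"
    using Hom_EndD(4)[OF t small_N] by (simp add: B.FObj_hat_func small_N)
  then obtain k y b where y: "y \<in> {1..k} \<rightarrow> N n" "inj_on y {1..k}" "b \<in> FObj B k"
    "body (body t (N n)) ?u = gen B (N n) k y b" by (rule B.hat_setE)
  \<comment> \<open>\<open>?Y\<close> is the support of the value of \<open>t\<close> at the generic
    element. The value comes from \<open>?Y\<close>, so the pullback square of the inclusion
    \<open>?m\<close> lifts the generic element itself to \<open>?Y\<close>.\<close>
  let ?Y = "y ` {1..k}" and ?m = "mor (y ` {1..k}) (N n) (\<lambda>v. v)"
  have Y: "?Y \<subseteq> N n" "small ?Y" using y(1) by (auto intro: small_finite)
  have m: "?m \<in> Hom (Sets small) ?Y (N n)" using Y small_N by (intro mor_in_Hom) auto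
  have inj: "inj_on (body ?m) ?Y" by (simp add: inj_on_def)
  have yY: "y \<in> {1..k} \<rightarrow> ?Y" by auto
  have "body (body t (N n)) ?u = body (FArr B.HA ?m) (gen B ?Y k y b)"
    using y B.body_hat_func[OF m yY y(3)] B.gen_cong[OF y(1,3), of "\<lambda>i. body ?m (y i)"] by simp
  then obtain w where w: "w \<in> FObj A.HA ?Y" "body (FArr A.HA ?m) w = ?u"
    using semi_cartesianD[OF sc t m inj u, of "gen B ?Y k y b"] B.gen_in_hat_set[OF yY y(3)] Y
    by (auto simp: B.FObj_hat_func)
  from w(1) have "w \<in> hat_set A ?Y" using Y by (simp add: A.FObj_hat_func)
  then obtain l x c where x: "x \<in> {1..l} \<rightarrow> ?Y" "inj_on x {1..l}" "c \<in> FObj A l" "w = gen A ?Y l x c"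
    by (rule A.hat_setE)
  have xN: "x \<in> {1..l} \<rightarrow> N n" using x(1) Y by auto
  have "gen A (N n) l x c = gen A (N n) l (\<lambda>i. body ?m (x i)) c"
    using x(1) by (intro A.gen_cong[OF xN x(3)]) (auto simp: Pi_iff)
  then have "gen A (N n) l x c = ?u" using w(2) x(4) A.body_hat_func[OF m x(1,3)] by simp
  \<comment> \<open>By uniqueness of normal forms the map \<open>x\<close> of the lift has image
    \<open>N n\<close>; as that image lies in \<open>?Y\<close>, the support cannot be smaller than
    \<open>N n\<close>.\<close>
  from A.gen_inj_eqD[OF xN x(2,3) nu_funcset inj_on_nu a this] obtain \<sigma> where l: "l = n"
    and \<sigma>: "onto l l \<sigma>" "\<forall>i\<in>{1..l}. x i = nu (\<sigma> i)" by blast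
  have "x ` {1..n} = nu ` \<sigma> ` {1..n}" using \<sigma>(2) l by (simp add: image_image)
  then have "x ` {1..n} = N n" using \<sigma>(1) l by (simp add: onto_def N_def)
  moreover have "x ` {1..l} \<subseteq> ?Y" using x(1) by (simp only: image_subset_iff_funcset)
  ultimately have YN: "?Y = N n" using l Y by simp
  have "k = card ?Y" using card_image[OF y(2)] by simp
  then have kn: "k = n" using YN card_image[OF inj_on_nu, of "{1..n}"] by (simp add: N_def)
  \<comment> \<open>\<open>y\<close> is a bijection onto \<open>N n\<close>, that is,
    \<open>nu\<close> precomposed with the permutation inv nu \<circ> y. The permutation is moved to
    the label.\<close>
  have "(\<lambda>i. inv nu (y i)) ` {1..n} = inv nu ` nu ` {1..n}"
    using YN kn by (simp add: N_def flip: image_image)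
  then have on: "onto n n (\<lambda>i. inv nu (y i))" by (simp add: onto_def image_image)
  have "nu (inv nu (y i)) = y i" if "i \<in> {1..n}" for i
    using nu_inv(1)[OF funcset_mem[OF y(1)]] kn that by simp
  then have "gen B (N n) n y b = gen B (N n) n (\<lambda>i. nu (inv nu (y i))) b"
    using y(1,3) kn by (intro B.gen_cong) simp_all
  also have "\<dots> = gen B (N n) n nu (act B n n (\<lambda>i. inv nu (y i)) b)"
    using B.gen_act[OF nu_funcset on] y(3) kn by simp
  finally show ?thesis using y(3,4) kn B.act_in[OF on] by auto
qed

text \<open>With \<open>hat_trans_in_Hom\<close> as the converse, this singles out the induced
  transformations between associated functors as the semi-cartesian ones.\<close>

lemma semi_cartesian_is_hat_trans:
  assumes A: "A \<in> Obj (SetS small)" and B: "B \<in> Obj (SetS small)"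
    and t: "t \<in> Hom (End small) (hat_func small A) (hat_func small B)" and sc: "semi_cartesian small t"
  shows "\<exists>f\<in>Hom (SetS small) A B. hat_trans small f = t"
proof -
  interpret A: surj_functor small A using A by (simp add: surj_functor_iff)
  interpret B: surj_functor small B using B by (simp add: surj_functor_iff)
  define P where "P n a d \<longleftrightarrow> d \<in> FObj B n \<and> body (body t (N n)) (gen A (N n) n nu a) = gen B (N n) n nu d"
    for n a d
  define c where "c n a = (SOME d. P n a d)" for n a
  have "P n a (c n a)" if "a \<in> FObj A n" for n a
    unfolding c_def using semi_cartesian_preserves_support[OF A B t sc that]
    by (intro someI_ex[of "P n a"]) (auto simp: P_def)
  then have c: "\<And>n a. a \<in> FObj A n \<Longrightarrow> c n a \<in> FObj B n"
    "\<And>n a. a \<in> FObj A n \<Longrightarrow> body (body t (N n)) (gen A (N n) n nu a) = gen B (N n) n nu (c n a)"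
    by (auto simp: P_def)
  have gen: "body (body t X) (gen A X n x a) = gen B X n x (c n a)"
    if X: "small X" and x: "x \<in> {1..n} \<rightarrow> X" and a: "a \<in> FObj A n" for X n x a
  proof -
    \<comment> \<open>As in the Yoneda lemma, \<open>?f\<close> carries the generic element [nu, a]
      to [x, a]. Since \<open>x\<close> may be non-injective, the formula also evaluates
      \<open>t\<close> on maps nu \<circ> h with \<open>h\<close> a surjection.\<close>
    let ?f = "mor (N n) X (\<lambda>v. x (inv nu v))"
    have f: "?f \<in> Hom (Sets small) (N n) X" 
      using X small_N nu_inv(2)[THEN funcset_mem[OF x]] by (intro mor_in_Hom) auto
    have fx: "body ?f (nu i) = x i" if "i \<in> {1..n}" for i using that by (simp add: N_def)
    have "gen A X n x a = body (FArr A.HA ?f) (gen A (N n) n nu a)"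
      using A.body_hat_func[OF f nu_funcset a] A.gen_cong[OF x a, of "\<lambda>i. body ?f (nu i)"] fx by simp
    moreover have "gen B X n x (c n a) = body (FArr B.HA ?f) (gen B (N n) n nu (c n a))"
      using B.body_hat_func[OF f nu_funcset c(1)[OF a]] B.gen_cong[OF x c(1)[OF a], of "\<lambda>i. body ?f (nu i)"] fx by simp
    moreover have "gen A (N n) n nu a \<in> FObj A.HA (N n)"
      using A.gen_in_hat_set[OF nu_funcset a] small_N by (simp add: A.FObj_hat_func)
    ultimately show ?thesis using Hom_EndD(5)[OF t f] c(2)[OF a] by simp
  qed
  let ?f = "Arrow A B (\<lambda>n. mor (FObj A n) (FObj B n) (c n))"
  have "is_nat_trans Surj (Sets small) A B (body ?f)"
  proof (rule set_valued_nat_transI)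
    show "set_valued Surj small A" "set_valued Surj small B" by unfold_locales
    show "body ?f \<in> extensional (Obj Surj)" by (simp add: extensional_def)
    show "body ?f n \<in> Hom (Sets small) (FObj A n) (FObj B n)" for n
      using c(1) A.small_FObj B.small_FObj by (auto intro!: mor_in_Hom)
    fix h n m a assume h: "h \<in> Hom Surj n m" and a: "a \<in> FObj A n"
    then have on: "onto n m (body h)" and "Arrow n m (restrict (body h) {1..n}) = h"
      by (auto simp: Hom_Surj_iff extensional_restrict intro: arrow.expand)
    then have act: "body (FArr A h) a = act A n m (body h) a" "body (FArr B h) d = act B n m (body h) d" for d
      by (simp_all add: act_def)
    have nh: "(\<lambda>i. nu (body h i)) \<in> {1..n} \<rightarrow> N m" using onto_in[OF on] nu_funcset by (auto simp: Pi_iff)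
    \<comment> \<open>Both sides are the value of \<open>t\<close> at [nu \<circ> h, a]: on the left
      \<open>h\<close> is moved to the label before applying \<open>t\<close>, on the right
      afterwards.\<close>
    have "gen B (N m) m nu (c m (act A n m (body h) a)) = gen B (N m) m nu (act B n m (body h) (c n a))"
      using gen[OF small_N nh a] gen[OF small_N nu_funcset A.act_in[OF on a]]
        A.gen_act[OF nu_funcset on a] B.gen_act[OF nu_funcset on c(1)[OF a]] by simp
    then have "c m (act A n m (body h) a) = act B n m (body h) (c n a)"
      by (rule gen_cancel[OF B nu_funcset inj_on_nu c(1)[OF A.act_in[OF on a]] B.act_in[OF on c(1)[OF a]]])
    then show "body (body ?f m) (body (FArr A h) a) = body (FArr B h) (body (body ?f n) a)"
      using act a A.act_in[OF on a] by simp
  qed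
  then have f: "?f \<in> Hom (SetS small) A B" by (simp add: Hom_iff SetS_sel)
  moreover have "hat_trans small ?f = t"
    by (rule Hom_hat_eqI[OF A hat_trans_in_Hom(1)[OF f] t]) (simp add: body_hat_trans_gen[OF f] gen)
  ultimately show ?thesis by blast
qed

text \<open>An isomorphism is bijective at every set, hence semi-cartesian.\<close>

lemma full_on_isos_hat: "full_on_isos (SetS small) (End small) (hat small)"
  unfolding full_on_isos_def
proof (intro ballI impI)
  fix A B t assume A: "A \<in> Obj (SetS small)" and B: "B \<in> Obj (SetS small)"
    and "t \<in> Hom (End small) (FObj (hat small) A) (FObj (hat small) B)" and iso: "is_iso (End small) t"
  then have t: "t \<in> Hom (End small) (hat_func small A) (hat_func small B)" by (simp add: FObj_hat)
  then have "semi_cartesian small t" using is_iso_End_bij[OF t iso] by (rule semi_cartesian_bij)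
  then show "\<exists>f\<in>Hom (SetS small) A B. FArr (hat small) f = t"
    using semi_cartesian_is_hat_trans[OF A B t] FArr_hat by metis
qed

end


section \<open>Semi-analytic functors come from functors on surjections\<close>

context set_universe
begin

text \<open>Chosen preimages in a covering small set serve as codes in \<open>'u\<close>; the index
  categories in \<open>finitary\<close> have to consist of such codes.\<close>

lemma Small_inj:
  assumes "Small S"
  obtains g :: "'b \<Rightarrow> 'u" where "inj_on g S" "small (g ` S)"
proof -
  obtain X and f :: "'u \<Rightarrow> 'b" where X: "small X" "S \<subseteq> f ` X" using assms by (auto simp: Small_def)
  have "inv_into X f ` S \<subseteq> X" using X(2) by (auto intro: inv_into_into)
  then show ?thesis using that[of "inv_into X f"] inj_on_inv_into[OF X(2)] small_subset[OF X(1)] by blast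
qed

text \<open>Every set is the filtered colimit of its finite subsets, over an index category coded in the universe.\<close>

lemma finite_support:
  assumes F: "set_endo small F" "finitary small F" and X: "small X" and u: "u \<in> FObj F X"
  shows "\<exists>S\<subseteq>X. finite S \<and> (\<exists>s\<in>FObj F S. fmap F S X (\<lambda>x. x) s = u)"
proof -
  interpret F: set_endo small F by fact
  \<comment> \<open>The finite subsets of \<open>X\<close>, ordered by inclusion. They form a
    \<open>Small\<close> set, because each is the set of entries of a list over
    \<open>X\<close>.\<close>
  define P where "P = {S. finite S \<and> S \<subseteq> X}"
  define Q where "Q = {(S, T). S \<in> P \<and> T \<in> P \<and> S \<subseteq> T}"
  have "P \<subseteq> set ` lists X"
  proof
    fix S assume "S \<in> P"
    then show "S \<in> set ` lists X" using finite_list[of S] by (auto simp: P_def image_iff)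
  qed
  then have "Small P" by (rule Small_image[rotated]) (simp add: X Small_lists Small_iff_small)
  moreover have "Q \<subseteq> P \<times> P" by (auto simp: Q_def)
  ultimately have "Small Q" using Small_subset Small_Times by blast
  \<comment> \<open>Objects and arrows of an index category must be elements of \<open>'u\<close>,
    so subsets and inclusions are replaced by codes, with decodings \<open>gi\<close> and
    \<open>hi\<close>.\<close>
  obtain g :: "'u set \<Rightarrow> 'u" where g: "inj_on g P" "small (g ` P)" using Small_inj[OF \<open>Small P\<close>] .
  obtain h :: "'u set \<times> 'u set \<Rightarrow> 'u" where h: "inj_on h Q" "small (h ` Q)" using Small_inj[OF \<open>Small Q\<close>] .
  define gi where "gi = inv_into P g"
  define hi where "hi = inv_into Q h"
  have gi [simp]: "gi (g S) = S" if "S \<in> P" for S using that g(1) by (simp add: gi_def)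
  have hi [simp]: "hi (h (S, T)) = (S, T)" if "(S, T) \<in> Q" for S T using that h(1) by (simp add: hi_def)
  have Q_refl: "(S, S) \<in> Q" if "S \<in> P" for S using that by (simp add: Q_def)
  have Q_trans: "(S, U) \<in> Q" if "(S, T) \<in> Q" "(T, U) \<in> Q" for S T U using that by (auto simp: Q_def)
  have QP: "S \<in> P" "T \<in> P" "S \<subseteq> T" if "(S, T) \<in> Q" for S T using that by (auto simp: Q_def)
  have g_eq [simp]: "g S = g T \<longleftrightarrow> S = T" if "S \<in> P" "T \<in> P" for S T
    using that inj_on_eq_iff[OF g(1)] by blast
  have small_P: "small S" if "S \<in> P" for S using that by (simp add: P_def small_finite)
  define J :: "('u, 'u) cat" where "J = \<lparr>Obj = g ` P, Arr = h ` Q,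
     Dom = (\<lambda>m. g (fst (hi m))), Cod = (\<lambda>m. g (snd (hi m))), Ide = (\<lambda>a. h (gi a, gi a)),
     Comp = (\<lambda>n m. h (fst (hi m), snd (hi n)))\<rparr>"
  have ObjJ: "Obj J = g ` P" by (simp add: J_def)
  have HomJ: "m \<in> Hom J a b \<longleftrightarrow> (\<exists>S T. (S, T) \<in> Q \<and> m = h (S, T) \<and> a = g S \<and> b = g T)" for m a b
  proof
    assume m: "m \<in> Hom J a b"
    then obtain S T where "(S, T) \<in> Q" "m = h (S, T)" by (auto simp: Hom_iff J_def)
    then show "\<exists>S T. (S, T) \<in> Q \<and> m = h (S, T) \<and> a = g S \<and> b = g T"
      using m by (intro exI[of _ S] exI[of _ T]) (auto simp: Hom_iff J_def)
  next
    assume "\<exists>S T. (S, T) \<in> Q \<and> m = h (S, T) \<and> a = g S \<and> b = g T"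
    then obtain S T where "(S, T) \<in> Q" "m = h (S, T)" "a = g S" "b = g T" by blast
    then show "m \<in> Hom J a b" by (simp add: Hom_iff J_def)
  qed
  have CompJ: "h (T, U) \<cdot>\<^bsub>J\<^esub> h (S, T) = h (S, U)" if "(S, T) \<in> Q" "(T, U) \<in> Q" for S T U
    using that by (simp add: J_def)
  have IdeJ: "Ide J (g S) = h (S, S)" if "S \<in> P" for S using that by (simp add: J_def)
  have catJ: "category J"
  proof
    fix m assume "m \<in> Arr J"
    then show "Dom J m \<in> Obj J" "Cod J m \<in> Obj J" by (auto simp: J_def dest: QP)
  next
    fix a assume "a \<in> Obj J"
    then obtain S where "S \<in> P" "a = g S" by (auto simp: ObjJ)
    then show "Ide J a \<in> Hom J a a"
      unfolding HomJ by (intro exI[of _ S] conjI) (simp_all add: IdeJ Q_refl)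
  next
    fix m a b assume "m \<in> Hom J a b"
    then obtain S T where ST: "(S, T) \<in> Q" "m = h (S, T)" "a = g S" "b = g T" by (auto simp: HomJ)
    have P: "S \<in> P" "T \<in> P" using QP[OF ST(1)] by auto
    show "m \<cdot>\<^bsub>J\<^esub> Ide J a = m" "Ide J b \<cdot>\<^bsub>J\<^esub> m = m"
      using ST P CompJ[OF Q_refl[OF P(1)] ST(1)] CompJ[OF ST(1) Q_refl[OF P(2)]] by (simp_all add: IdeJ)
    fix m' c assume "m' \<in> Hom J b c"
    then obtain T' U where TU: "(T', U) \<in> Q" "m' = h (T', U)" "b = g T'" "c = g U" by (auto simp: HomJ)
    have T': "T' = T" using ST TU QP(1)[OF TU(1)] P(2) by simp
    then show "m' \<cdot>\<^bsub>J\<^esub> m \<in> Hom J a c"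
      using ST TU CompJ[OF ST(1), of U] Q_trans[OF ST(1), of U] by (auto simp: HomJ)
    fix m'' d assume "m'' \<in> Hom J c d"
    then obtain U' V where UV: "(U', V) \<in> Q" "m'' = h (U', V)" "c = g U'" "d = g V" by (auto simp: HomJ)
    have "U' = U" using UV TU QP(1)[OF UV(1)] QP(2)[OF TU(1)] by simp
    then show "(m'' \<cdot>\<^bsub>J\<^esub> m') \<cdot>\<^bsub>J\<^esub> m = m'' \<cdot>\<^bsub>J\<^esub> (m' \<cdot>\<^bsub>J\<^esub> m)"
      using ST TU UV T' CompJ Q_trans by simp
  qed
  have filt: "is_filtered J"
    unfolding is_filtered_def
  proof (intro conjI ballI)
    show "category J" by (rule catJ)
    show "Obj J \<noteq> {}" by (auto simp: ObjJ P_def)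
    show "\<exists>c\<in>Obj J. Hom J a c \<noteq> {} \<and> Hom J b c \<noteq> {}" if ab: "a \<in> Obj J" "b \<in> Obj J" for a b
    proof -
      obtain S T where ST: "S \<in> P" "T \<in> P" "a = g S" "b = g T" using ab by (auto simp: ObjJ)
      then have U: "S \<union> T \<in> P" by (auto simp: P_def)
      then have "h (S, S \<union> T) \<in> Hom J a (g (S \<union> T))" "h (T, S \<union> T) \<in> Hom J b (g (S \<union> T))"
        using ST by (auto simp: HomJ Q_def)
      then show ?thesis using U by (auto simp: ObjJ)
    qed
    show "\<exists>c\<in>Obj J. \<exists>k\<in>Hom J b c. k \<cdot>\<^bsub>J\<^esub> m = k \<cdot>\<^bsub>J\<^esub> m'"
      if b: "b \<in> Obj J" and m: "m \<in> Hom J a b" and m': "m' \<in> Hom J a b" for a b m m'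
    proof -
      \<comment> \<open>\<open>J\<close> is a partial order: parallel arrows are equal, so an
        identity coequalizes them.\<close>
      have "m = m'" using m m' QP(1,2) by (auto simp: HomJ)
      moreover have "Ide J b \<in> Hom J b b" by (rule category.Ide_in_Hom[OF catJ b])
      ultimately show ?thesis using b by auto
    qed
  qed
  define D :: "('u, 'u, 'u set, 'u setarr) func" where
    "D = \<lparr>FObj = (\<lambda>a\<in>Obj J. gi a), FArr = (\<lambda>m\<in>Arr J. mor (fst (hi m)) (snd (hi m)) (\<lambda>x. x))\<rparr>"
  have DObj: "FObj D (g S) = S" if "S \<in> P" for S using that by (simp add: D_def ObjJ)
  have DArr: "FArr D (h (S, T)) = mor S T (\<lambda>x. x)" if "(S, T) \<in> Q" for S T
    using that by (simp add: D_def J_def)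
  have D: "is_functor J (Sets small) D"
  proof -
    interpret J: category J by (rule catJ)
    interpret S: category "Sets small" by (rule category_Sets)
    show ?thesis
    proof
      fix a assume "a \<in> Obj J"
      then obtain S where "S \<in> P" "a = g S" by (auto simp: ObjJ)
      then show "FObj D a \<in> Obj (Sets small)" "FArr D (Ide J a) = Ide (Sets small) (FObj D a)"
        using DArr[OF Q_refl] by (simp_all add: DObj small_P IdeJ Ide_Sets)
    next
      fix m a b assume "m \<in> Hom J a b"
      then obtain S T where ST: "(S, T) \<in> Q" "m = h (S, T)" "a = g S" "b = g T" by (auto simp: HomJ)
      then show "FArr D m \<in> Hom (Sets small) (FObj D a) (FObj D b)"
        using QP[OF ST(1)] by (auto simp: DObj DArr intro!: mor_in_Hom small_P)
      fix m' c assume "m' \<in> Hom J b c"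
      then obtain T' U where TU: "(T', U) \<in> Q" "m' = h (T', U)" "b = g T'" "c = g U" by (auto simp: HomJ)
      have "T' = T" using ST TU QP(1)[OF TU(1)] QP(2)[OF ST(1)] by simp
      moreover have "(\<lambda>x. x) \<in> S \<rightarrow> T" using QP(3)[OF ST(1)] by auto
      ultimately show "FArr D (m' \<cdot>\<^bsub>J\<^esub> m) = FArr D m' \<cdot>\<^bsub>Sets small\<^esub> FArr D m"
        using ST TU CompJ[OF ST(1), of U] Q_trans[OF ST(1), of U] by (auto simp: DArr Comp_mor)
    qed (auto simp: D_def)
  qed
  then interpret D: filtered_diagram small J D
    using filt by (auto simp: filtered_diagram_def filtered_diagram_axioms_def set_valued_def set_universe_axioms)
  have FD: "is_functor J (Sets small) (func_comp J F D)"
    by (rule is_functor_func_comp[OF D F.is_functor_axioms])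
  then interpret FD: filtered_diagram small J "func_comp J F D"
    using filt by (auto simp: filtered_diagram_def filtered_diagram_axioms_def set_valued_def set_universe_axioms)
  define \<iota> where "\<iota> a = mor (gi a) X (\<lambda>x. x)" for a
  have \<iota>: "\<iota> (g S) = mor S X (\<lambda>x. x)" if "S \<in> P" for S using that by (simp add: \<iota>_def)
  have "is_colimit J (Sets small) D X \<iota>"
  proof (rule D.is_colimitI)
    show "is_cocone J (Sets small) D X \<iota>"
    proof (rule D.is_coconeI[OF X])
      fix a assume "a \<in> Obj J"
      then show "\<iota> a \<in> Hom (Sets small) (FObj D a) X"
        using X small_P by (auto simp: ObjJ DObj \<iota> intro!: mor_in_Hom) (auto simp: P_def)
    next
      fix m a b x assume "m \<in> Hom J a b" and x: "x \<in> FObj D a"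
      then obtain S T where ST: "(S, T) \<in> Q" "m = h (S, T)" "a = g S" "b = g T" by (auto simp: HomJ)
      then have "x \<in> S" "x \<in> T" using x QP[OF ST(1)] by (auto simp: DObj)
      then show "body (\<iota> b) (D.dmap m x) = body (\<iota> a) x"
        using ST QP[OF ST(1)] by (simp add: D.dmap_def DArr \<iota>)
    qed
    show "D.jointly_surj X \<iota>"
      unfolding D.jointly_surj_def
    proof
      fix x assume x: "x \<in> X"
      have xP: "{x} \<in> P" using x by (simp add: P_def)
      then show "\<exists>j\<in>Obj J. \<exists>y\<in>FObj D j. body (\<iota> j) y = x"
        by (intro bexI[of _ "g {x}"] bexI[of _ x]) (simp_all add: \<iota> DObj ObjJ)
    qed
    show "D.eventually_inj \<iota>"
      unfolding D.eventually_inj_def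
    proof (intro ballI impI)
      fix a x y assume a: "a \<in> Obj J" and xy: "x \<in> FObj D a" "y \<in> FObj D a" "body (\<iota> a) x = body (\<iota> a) y"
      \<comment> \<open>The legs are inclusions and thus injective, so no transition map is needed
        to identify \<open>x\<close> and \<open>y\<close>.\<close>
      then have "x = y" by (auto simp: ObjJ DObj \<iota>)
      then show "\<exists>k. \<exists>m\<in>Hom J a k. D.dmap m x = D.dmap m y" using category.Ide_in_Hom[OF catJ a] by blast
    qed
  qed
  then have "is_colimit J (Sets small) (func_comp J F D) (FObj F X) (\<lambda>j. FArr F (\<iota> j))"
    using F(2) filt D g(2) h(2) unfolding finitary_def by (simp add: J_def)
  \<comment> \<open>The preserved colimit presents F(X) by the sets F(S) with \<open>S\<close>
    finite, and its legs are jointly surjective.\<close>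
  from FD.colimit_jointly_surj[OF this] u obtain a s where a: "a \<in> Obj J" "s \<in> FObj (func_comp J F D) a"
    "body (FArr F (\<iota> a)) s = u" by (auto simp: FD.jointly_surj_def)
  then obtain S where "S \<in> P" "a = g S" by (auto simp: ObjJ)
  then have "s \<in> FObj F S" "fmap F S X (\<lambda>x. x) s = u"
    using a by (simp_all add: func_comp_def compose_def ObjJ DObj fmap_def \<iota>)
  then show ?thesis using \<open>S \<in> P\<close> by (auto simp: P_def)
qed

end

section \<open>Supports in a semi-analytic functor\<close>

locale semi_analytic_functor = set_universe small + set_endo small F
  for small :: "'u set \<Rightarrow> bool" and F :: "'u setfunc" +
  assumes finitary: "finitary small F"
    and pullbacks: "preserves_pullbacks_along_monos small F"
begin

text \<open>A map is injective exactly if its pullback along itself has identities as projections.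
  For an injective \<open>f\<close> this square is a pullback along a mono, so \<open>F\<close>
  preserves it.\<close>

lemma fmap_inj:
  assumes X: "small X" "small Y" and f: "f \<in> X \<rightarrow> Y" "inj_on f X"
  shows "inj_on (fmap F X Y f) (FObj F X)"
proof (rule inj_onI)
  let ?i = "mor X X (\<lambda>x. x)" and ?f = "mor X Y f"
  have i: "?i \<in> Hom (Sets small) X X" and fH: "?f \<in> Hom (Sets small) X Y" using X f by (auto intro: mor_in_Hom)
  have "is_pullback (Sets small) ?i ?i ?f ?f"
    by (rule is_pullback_SetsI[OF i i fH fH]) (use inj_onD[OF f(2)] in auto)
  moreover have "is_mono (Sets small) ?f" using is_mono_mor_iff[OF X f(1)] f(2) by simp
  ultimately have "is_pullback (Sets small) (FArr F ?i) (FArr F ?i) (FArr F ?f) (FArr F ?f)"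
    using pullbacks by (simp add: preserves_pullbacks_along_monos_def)
  then obtain W U V Z where "FArr F ?i \<in> Hom (Sets small) W U" "FArr F ?i \<in> Hom (Sets small) W V"
    and univ: "\<And>x y. x \<in> U \<Longrightarrow> y \<in> V \<Longrightarrow> body (FArr F ?f) x = body (FArr F ?f) y \<Longrightarrow>
      \<exists>!w. w \<in> W \<and> body (FArr F ?i) w = x \<and> body (FArr F ?i) w = y"
    by (rule is_pullback_SetsD) blast
  then have UV: "U = FObj F X" "V = FObj F X" using FArr_in_Hom[OF i] by (auto simp: Hom_Sets_iff)
  fix u v assume "u \<in> FObj F X" "v \<in> FObj F X" "fmap F X Y f u = fmap F X Y f v"
  then show "u = v" using univ[of u v] by (auto simp: UV fmap_def)
qed

text \<open>The preimage square is a pullback along the inclusion of \<open>Y\<close>, so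
  \<open>F\<close> preserves it. This is how supports are pulled back along
  \<open>f\<close>.\<close>

lemma fmap_preimage:
  assumes small: "small X" "small Z" and f: "f \<in> X \<rightarrow> Z" and Y: "Y \<subseteq> Z"
    and u: "u \<in> FObj F X" and v: "v \<in> FObj F Y" and eq: "fmap F X Z f u = fmap F Y Z (\<lambda>x. x) v"
  shows "\<exists>w\<in>FObj F {x\<in>X. f x \<in> Y}. fmap F {x\<in>X. f x \<in> Y} X (\<lambda>x. x) w = u"
proof -
  let ?W = "{x\<in>X. f x \<in> Y}"
  let ?p = "mor ?W X (\<lambda>x. x)" and ?q = "mor ?W Y f" and ?f = "mor X Z f" and ?m = "mor Y Z (\<lambda>x. x)"
  have small': "small Y" "small ?W" using small Y by (auto intro: small_subset)
  have H: "?p \<in> Hom (Sets small) ?W X" "?q \<in> Hom (Sets small) ?W Y" "?f \<in> Hom (Sets small) X Z"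
    "?m \<in> Hom (Sets small) Y Z"
    using small small' f Y by (auto intro!: mor_in_Hom)
  have "is_pullback (Sets small) ?p ?q ?f ?m"
    by (rule is_pullback_SetsI[OF H]) auto
  moreover have "is_mono (Sets small) ?m" using is_mono_mor_iff[of Y Z "\<lambda>x. x"] small small' Y by auto
  ultimately have "is_pullback (Sets small) (FArr F ?p) (FArr F ?q) (FArr F ?f) (FArr F ?m)"
    using pullbacks by (simp add: preserves_pullbacks_along_monos_def)
  then obtain W U V Z' where "FArr F ?p \<in> Hom (Sets small) W U" "FArr F ?q \<in> Hom (Sets small) W V"
    and univ: "\<And>x y. x \<in> U \<Longrightarrow> y \<in> V \<Longrightarrow> body (FArr F ?f) x = body (FArr F ?m) y \<Longrightarrow>
      \<exists>!w. w \<in> W \<and> body (FArr F ?p) w = x \<and> body (FArr F ?q) w = y"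
    by (rule is_pullback_SetsD) blast
  then have "W = FObj F ?W" "U = FObj F X" "V = FObj F Y"
    using FArr_in_Hom[OF H(1)] FArr_in_Hom[OF H(2)] by (auto simp: Hom_Sets_iff)
  then show ?thesis using univ[of u v] u v eq by (auto simp: fmap_def)
qed

definition A_set :: "nat \<Rightarrow> 'u set" where
  "A_set n = {a \<in> FObj F (N n). \<forall>S. S \<subset> N n \<longrightarrow> a \<notin> fmap F S (N n) (\<lambda>v. v) ` FObj F S}"

text \<open>The map \<open>\<alpha>\<close> of numbers carried over to the copies in the
  universe.\<close>

definition conj_nu :: "(nat \<Rightarrow> nat) \<Rightarrow> 'u \<Rightarrow> 'u" where
  "conj_nu \<alpha> v = nu (\<alpha> (inv nu v))"

definition A :: "'u surjfunc" where
  "A = \<lparr>FObj = A_set, FArr = (\<lambda>f\<in>Arr Surj. mor (A_set (src f)) (A_set (tgt f))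
     (fmap F (N (src f)) (N (tgt f)) (conj_nu (body f))))\<rparr>"

lemma A_set_D: "a \<in> A_set n \<Longrightarrow> a \<in> FObj F (N n)"
  by (simp add: A_set_def)

lemma A_set_full: "a \<in> A_set n \<Longrightarrow> S \<subseteq> N n \<Longrightarrow> s \<in> FObj F S \<Longrightarrow> fmap F S (N n) (\<lambda>v. v) s = a \<Longrightarrow> S = N n"
  unfolding A_set_def by blast

lemma conj_nu_funcset: "onto n m \<alpha> \<Longrightarrow> conj_nu \<alpha> \<in> N n \<rightarrow> N m"
proof
  fix v assume on: "onto n m \<alpha>" and v: "v \<in> N n"
  show "conj_nu \<alpha> v \<in> N m" unfolding conj_nu_def N_def using onto_in[OF on nu_inv(2)[OF v]] by (rule imageI)
qed

lemma fmap_A_set: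
  assumes on: "onto n m \<alpha>" and a: "a \<in> A_set n"
  shows "fmap F (N n) (N m) (conj_nu \<alpha>) a \<in> A_set m"
  unfolding A_set_def
proof (intro CollectI conjI allI impI notI)
  let ?f = "conj_nu \<alpha>"
  have f: "?f \<in> N n \<rightarrow> N m" by (rule conj_nu_funcset[OF on])
  show "fmap F (N n) (N m) ?f a \<in> FObj F (N m)" by (rule fmap_in[OF small_N small_N f A_set_D[OF a]])
  fix S assume S: "S \<subset> N m" and "fmap F (N n) (N m) ?f a \<in> fmap F S (N m) (\<lambda>v. v) ` FObj F S"
  then obtain s where s: "s \<in> FObj F S" "fmap F (N n) (N m) ?f a = fmap F S (N m) (\<lambda>v. v) s" by blast
  obtain w where w: "w \<in> FObj F {v\<in>N n. ?f v \<in> S}" "fmap F {v\<in>N n. ?f v \<in> S} (N n) (\<lambda>v. v) w = a"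
    using fmap_preimage[OF small_N small_N f _ A_set_D[OF a] s] S by blast
  \<comment> \<open>The preimage of \<open>S\<close> supports \<open>a\<close>, so it is all of
    \<open>N n\<close>; since \<open>\<alpha>\<close> is onto, \<open>S\<close> then contains
    \<open>N m\<close>.\<close>
  have all: "{v\<in>N n. ?f v \<in> S} = N n" by (rule A_set_full[OF a _ w]) blast
  have "N m \<subseteq> S"
  proof
    fix v assume "v \<in> N m"
    then obtain j where j: "j \<in> {1..m}" "v = nu j" by (auto simp: N_def)
    then obtain i where i: "i \<in> {1..n}" "\<alpha> i = j" using onto_surj[OF on] by blast
    then have "nu i \<in> N n" by (simp add: N_def)
    then have "?f (nu i) \<in> S" using all by blast
    then show "v \<in> S" using i j by (simp add: conj_nu_def)
  qed
  then show False using S by blast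
qed

lemma surj_functor_A: "surj_functor small A"
proof -
  interpret Su: category Surj by (rule category_Surj)
  have small_A: "small (A_set n)" for n
    by (rule small_subset[OF small_FObj[of "N n"]]) (auto simp: small_N A_set_def)
  have FArr: "FArr A f = mor (A_set n) (A_set m) (fmap F (N n) (N m) (conj_nu (body f)))"
    if "f \<in> Hom Surj n m" for f n m
  proof -
    have "f \<in> Arr Surj" using that by (simp add: Hom_iff)
    moreover have "src f = n" "tgt f = m" using that by (simp_all add: Hom_Surj_iff)
    ultimately show ?thesis by (simp add: A_def)
  qed
  have FObj: "FObj A n = A_set n" for n by (simp add: A_def)
  have "is_functor Surj (Sets small) A"
  proof
    fix n show "FObj A n \<in> Obj (Sets small)" by (simp add: FObj small_A)
    have id: "Ide Surj n \<in> Hom Surj n n" by (rule Su.Ide_in_Hom) simp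
    show "FArr A (Ide Surj n) = Ide (Sets small) (FObj A n)"
      unfolding FArr[OF id] FObj Ide_Sets
    proof (rule mor_cong)
      fix a assume a: "a \<in> A_set n"
      show "fmap F (N n) (N n) (conj_nu (body (Ide Surj n))) a = a"
      proof (rule fmap_ident[OF small_N A_set_D[OF a]])
        fix v assume "v \<in> N n"
        then show "conj_nu (body (Ide Surj n)) v = v"
          using nu_inv[of v n] by (simp add: conj_nu_def Surj_def)
      qed
    qed
  next
    fix f n m assume f: "f \<in> Hom Surj n m"
    then have of: "onto n m (body f)" by (simp add: Hom_Surj_iff)
    show "FArr A f \<in> Hom (Sets small) (FObj A n) (FObj A m)"
      unfolding FArr[OF f] FObj using fmap_A_set[OF of] small_A by (intro mor_in_Hom) auto
    fix g k assume g: "g \<in> Hom Surj m k"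
    then have og: "onto m k (body g)" by (simp add: Hom_Surj_iff)
    have gf: "g \<cdot>\<^bsub>Surj\<^esub> f \<in> Hom Surj n k" by (rule Su.Comp_in_Hom[OF f g])
    have "fmap F (N n) (N k) (conj_nu (body (g \<cdot>\<^bsub>Surj\<^esub> f))) a =
        fmap F (N m) (N k) (conj_nu (body g)) (fmap F (N n) (N m) (conj_nu (body f)) a)"
      if a: "a \<in> A_set n" for a
    proof -
      have "fmap F (N m) (N k) (conj_nu (body g)) (fmap F (N n) (N m) (conj_nu (body f)) a) =
          fmap F (N n) (N k) (\<lambda>v. conj_nu (body g) (conj_nu (body f) v)) a"
        by (rule fmap_fmap[OF small_N small_N small_N conj_nu_funcset[OF of] conj_nu_funcset[OF og] A_set_D[OF a]])
      also have "\<dots> = fmap F (N n) (N k) (conj_nu (body (g \<cdot>\<^bsub>Surj\<^esub> f))) a"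
      proof (rule fmap_cong)
        fix v assume "v \<in> N n"
        then have "inv nu v \<in> {1..src f}" using f nu_inv(2) by (auto simp: Hom_Surj_iff)
        then show "conj_nu (body g) (conj_nu (body f) v) = conj_nu (body (g \<cdot>\<^bsub>Surj\<^esub> f)) v"
          by (simp add: conj_nu_def Surj_def compose_def)
      qed
      finally show ?thesis by simp
    qed
    then show "FArr A (g \<cdot>\<^bsub>Surj\<^esub> f) = FArr A g \<cdot>\<^bsub>Sets small\<^esub> FArr A f"
      unfolding FArr[OF f] FArr[OF g] FArr[OF gf] using fmap_A_set[OF of]
      by (subst Comp_mor) (auto intro!: mor_cong)
  qed (auto simp: A_def extensional_def category_Sets[unfolded category_def])
  then show ?thesis by (simp add: surj_functor_def set_valued_def set_universe_axioms)
qed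

sublocale A: surj_functor small A
  by (rule surj_functor_A)

lemma FObj_A [simp]: "FObj A n = A_set n"
  by (simp add: A_def)

lemma act_A:
  assumes on: "onto n m \<alpha>" and a: "a \<in> A_set n"
  shows "act A n m \<alpha> a = fmap F (N n) (N m) (conj_nu \<alpha>) a"
proof -
  have "FArr A (Arrow n m (restrict \<alpha> {1..n})) =
      mor (A_set n) (A_set m) (fmap F (N n) (N m) (conj_nu (restrict \<alpha> {1..n})))"
    using onto_in_Hom[OF on] by (simp add: A_def Hom_iff)
  then have "act A n m \<alpha> a = fmap F (N n) (N m) (conj_nu (restrict \<alpha> {1..n})) a"
    using a by (simp add: act_def)
  also have "\<dots> = fmap F (N n) (N m) (conj_nu \<alpha>) a"
    using nu_inv(2) by (intro fmap_cong) (simp add: conj_nu_def)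
  finally show ?thesis .
qed

text \<open>The element F(x)(a). Because \<open>a\<close> lives over the copy \<open>N n\<close>,
  the map \<open>x\<close> is precomposed with \<open>inv nu\<close>.\<close>

definition ev :: "'u set \<Rightarrow> nat \<Rightarrow> (nat \<Rightarrow> 'u) \<Rightarrow> 'u \<Rightarrow> 'u" where
  "ev X n x a = fmap F (N n) X (\<lambda>v. x (inv nu v)) a"

lemma inv_nu_funcset: "x \<in> {1..n} \<rightarrow> X \<Longrightarrow> (\<lambda>v. x (inv nu v)) \<in> N n \<rightarrow> X"
  using nu_inv(2) by (auto simp: Pi_iff)

lemma ev_in: "small X \<Longrightarrow> x \<in> {1..n} \<rightarrow> X \<Longrightarrow> a \<in> A_set n \<Longrightarrow> ev X n x a \<in> FObj F X"
  unfolding ev_def by (rule fmap_in[OF small_N _ inv_nu_funcset A_set_D])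

lemma ev_map:
  assumes "f \<in> Hom (Sets small) X Y" "x \<in> {1..n} \<rightarrow> X" "a \<in> A_set n"
  shows "body (FArr F f) (ev X n x a) = ev Y n (\<lambda>i. body f (x i)) a"
  unfolding ev_def body_FArr_eq_fmap[OF assms(1)]
  using fmap_fmap[OF small_N _ _ inv_nu_funcset[OF assms(2)] _ A_set_D[OF assms(3)], of Y "body f"]
    Hom_Sets_small[OF assms(1)] Hom_Sets_body[OF assms(1)] by blast

text \<open>By functoriality of \<open>F\<close>, \<open>ev\<close> obeys the relation that defines
  \<open>gen\<close>; so [x, a] \<mapsto> F(x)(a) has a chance to be well defined on
  classes.\<close>

lemma ev_factorization:
  assumes X: "small X" and f: "is_factorization X n x k z \<alpha>" and a: "a \<in> A_set n"
  shows "ev X n x a = ev X k z (act A n k \<alpha> a)"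
proof -
  have z: "z \<in> {1..k} \<rightarrow> X" "onto n k \<alpha>" "\<forall>i\<in>{1..n}. x i = z (\<alpha> i)"
    using f by (simp_all add: is_factorization_def)
  have "ev X k z (act A n k \<alpha> a) = fmap F (N n) X (\<lambda>v. z (inv nu (conj_nu \<alpha> v))) a"
    unfolding ev_def act_A[OF z(2) a]
    by (rule fmap_fmap[OF small_N small_N X conj_nu_funcset[OF z(2)] inv_nu_funcset[OF z(1)] A_set_D[OF a]])
  also have "\<dots> = ev X n x a"
    unfolding ev_def using z(3) nu_inv(2) by (intro fmap_cong) (simp add: conj_nu_def)
  finally show ?thesis by simp
qed

definition phi :: "'u set \<Rightarrow> 'u \<Rightarrow> 'u" where
  "phi X u = (THE v. \<exists>n x a. x \<in> {1..n} \<rightarrow> X \<and> a \<in> A_set n \<and> u = gen A X n x a \<and> v = ev X n x a)"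

text \<open>Representatives of one class have factorizations through a common injection with equal
  labels, and \<open>ev\<close> is determined by that injection and label.\<close>

lemma phi_gen:
  assumes X: "small X" and x: "x \<in> {1..n} \<rightarrow> X" and a: "a \<in> A_set n"
  shows "phi X (gen A X n x a) = ev X n x a"
  unfolding phi_def
proof (rule the_equality)
  show "\<exists>n' x' a'. x' \<in> {1..n'} \<rightarrow> X \<and> a' \<in> A_set n' \<and> gen A X n x a = gen A X n' x' a' \<and> ev X n x a = ev X n' x' a'"
    using x a by blast
  fix v assume "\<exists>n' x' a'. x' \<in> {1..n'} \<rightarrow> X \<and> a' \<in> A_set n' \<and> gen A X n x a = gen A X n' x' a' \<and> v = ev X n' x' a'"
  then obtain m y b where y: "y \<in> {1..m} \<rightarrow> X" "b \<in> A_set m" "gen A X n x a = gen A X m y b" "v = ev X m y b"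
    by blast
  have "a \<in> FObj A n" "b \<in> FObj A m" using a y(2) by simp_all
  from A.gen_eqD[OF x this(1) y(1) this(2) y(3)] obtain k z \<alpha> \<beta> where
    f: "is_factorization X n x k z \<alpha>" and g: "is_factorization X m y k z \<beta>"
    and ab: "act A n k \<alpha> a = act A m k \<beta> b" .
  show "v = ev X n x a"
    using y(4) ev_factorization[OF X f a] ev_factorization[OF X g y(2)] ab by simp
qed

text \<open>The common element is supported on the image of \<open>y\<close>, hence \<open>a\<close>
  is supported on the part of \<open>N n\<close> that \<open>x\<close> sends into that image. By the
  choice of \<open>A_set\<close> this part is everything.\<close>

lemma ev_support:
  assumes X: "small X" and x: "x \<in> {1..n} \<rightarrow> X" and a: "a \<in> A_set n"
    and y: "y \<in> {1..k} \<rightarrow> X" and b: "b \<in> A_set k" and eq: "ev X n x a = ev X k y b"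
  shows "x ` {1..n} \<subseteq> y ` {1..k}"
proof -
  let ?Y = "y ` {1..k}" and ?f = "\<lambda>v. x (inv nu v)"
  have Y: "?Y \<subseteq> X" "small ?Y" using y by (auto intro: small_finite)
  have yY: "(\<lambda>v. y (inv nu v)) \<in> N k \<rightarrow> ?Y" by (rule inv_nu_funcset) auto
  let ?v = "fmap F (N k) ?Y (\<lambda>v. y (inv nu v)) b"
  have "fmap F ?Y X (\<lambda>v. v) ?v = ev X k y b"
    unfolding ev_def using Y by (intro fmap_fmap[OF small_N _ X yY _ A_set_D[OF b]]) auto
  then have eq': "fmap F (N n) X ?f a = fmap F ?Y X (\<lambda>v. v) ?v" using eq by (simp add: ev_def)
  obtain w where w: "w \<in> FObj F {v\<in>N n. ?f v \<in> ?Y}" "fmap F {v\<in>N n. ?f v \<in> ?Y} (N n) (\<lambda>v. v) w = a"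
    using fmap_preimage[OF small_N X inv_nu_funcset[OF x] Y(1) A_set_D[OF a]
        fmap_in[OF small_N Y(2) yY A_set_D[OF b]] eq'] by blast
  have all: "{v\<in>N n. ?f v \<in> ?Y} = N n" by (rule A_set_full[OF a _ w]) blast
  show ?thesis
  proof (rule image_subsetI)
    fix i assume "i \<in> {1..n}"
    then have "nu i \<in> N n" by (simp add: N_def)
    then have "?f (nu i) \<in> ?Y" using all by blast
    then show "x i \<in> ?Y" by simp
  qed
qed

text \<open>Two applications of \<open>ev_support\<close> show that \<open>x\<close> and
  \<open>y\<close> have the same image, so \<open>x\<close> is \<open>y\<close> precomposed with a
  permutation. The labels then agree because \<open>F\<close> preserves the injectivity of
  \<open>y\<close>.\<close>

lemma phi_inj:
  assumes X: "small X"
  shows "inj_on (phi X) (hat_set A X)"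
proof (rule inj_onI)
  fix u v assume u: "u \<in> hat_set A X" and v: "v \<in> hat_set A X" and eq: "phi X u = phi X v"
  from u obtain n x a where x: "x \<in> {1..n} \<rightarrow> X" "inj_on x {1..n}" "a \<in> A_set n" "u = gen A X n x a"
    by (rule A.hat_setE) simp
  from v obtain k y b where y: "y \<in> {1..k} \<rightarrow> X" "inj_on y {1..k}" "b \<in> A_set k" "v = gen A X k y b"
    by (rule A.hat_setE) simp
  have ev: "ev X n x a = ev X k y b" using eq phi_gen[OF X] x y by simp
  have im: "x ` {1..n} = y ` {1..k}"
    using ev_support[OF X x(1,3) y(1,3) ev] ev_support[OF X y(1,3) x(1,3) ev[symmetric]] by blast
  let ?\<sigma> = "\<lambda>i. inv_into {1..k} y (x i)"
  have "?\<sigma> ` {1..n} = inv_into {1..k} y ` y ` {1..k}" using im by (simp flip: image_image)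
  then have "onto n k ?\<sigma>" using y(2) by (simp add: onto_def image_image)
  moreover have "x i = y (?\<sigma> i)" if "i \<in> {1..n}" for i
    using im that by (metis f_inv_into_f imageI)
  ultimately have f: "is_factorization X n x k y ?\<sigma>" using y by (simp add: is_factorization_def)
  then have on: "onto n k ?\<sigma>" by (simp add: is_factorization_def)
  have eq': "ev X k y (act A n k ?\<sigma> a) = ev X k y b" using ev_factorization[OF X f x(3)] ev by simp
  have "inj_on (inv nu) (N k)" by (rule inj_on_inverseI[of _ nu]) (rule nu_inv(1))
  then have "inj_on (\<lambda>v. y (inv nu v)) (N k)"
    using nu_inv(2) by (intro inj_on_comp_funcset[OF y(2)] funcsetI)
  note inj = fmap_inj[OF small_N X inv_nu_funcset[OF y(1)] this]
  have "act A n k ?\<sigma> a \<in> A_set k" using A.act_in[OF on, of a] x(3) by simp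
  then have "act A n k ?\<sigma> a = b"
    using inj_onD[OF inj eq'[unfolded ev_def]] A_set_D y(3) by blast
  then show "u = v" using A.gen_factorization[OF f, of a] x y by simp
qed

text \<open>Surjectivity: an element of \<open>F X\<close> has a finite support of minimal size.\<close>

lemma phi_surj:
  assumes X: "small X" and u: "u \<in> FObj F X"
  shows "u \<in> phi X ` hat_set A X"
proof -
  \<comment> \<open>The finite supports of \<open>u\<close>. There is one by
    \<open>finite_support\<close>, hence also one of least cardinality.\<close>
  define P where "P S \<longleftrightarrow> S \<subseteq> X \<and> finite S \<and> (\<exists>s\<in>FObj F S. fmap F S X (\<lambda>x. x) s = u)" for S
  obtain S0 where "P S0" unfolding P_def using finite_support[OF set_endo_axioms finitary X u] by blast
  from ex_has_least_nat[of P, OF this, of card] obtain S where "P S" and min: "\<And>T. P T \<Longrightarrow> card S \<le> card T"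
    by blast
  then have S: "S \<subseteq> X" "finite S" by (simp_all add: P_def)
  obtain s where s: "s \<in> FObj F S" "fmap F S X (\<lambda>x. x) s = u" using \<open>P S\<close> by (auto simp: P_def)
  let ?n = "card S"
  obtain z where z: "bij_betw z {1..?n} S" using ex_bij_betw_nat_finite_1 S by blast
  have zS: "z \<in> {1..?n} \<rightarrow> S" using bij_betwE[OF z] by blast
  then have zX: "z \<in> {1..?n} \<rightarrow> X" using S by auto
  have smS: "small S" using S small_finite by blast
  \<comment> \<open>The inverse of the enumeration \<open>z\<close> of \<open>S\<close>, followed by
    \<open>nu\<close>: it carries \<open>s\<close> over to the standard set
    \<open>N ?n\<close>.\<close>
  let ?c = "\<lambda>v. nu (inv_into {1..?n} z v)"
  have c: "?c \<in> S \<rightarrow> N ?n" using bij_betwE[OF bij_betw_inv_into[OF z]] by (auto simp: N_def)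
  let ?a = "fmap F S (N ?n) ?c s"
  have a: "?a \<in> FObj F (N ?n)" by (rule fmap_in[OF smS small_N c s(1)])
  have ev: "fmap F (N ?n) X (\<lambda>v. z (inv nu v)) ?a = u"
  proof -
    have "fmap F (N ?n) X (\<lambda>v. z (inv nu v)) ?a = fmap F S X (\<lambda>v. z (inv nu (?c v))) s"
      by (rule fmap_fmap[OF smS small_N X c inv_nu_funcset[OF zX] s(1)])
    also have "\<dots> = fmap F S X (\<lambda>x. x) s"
      using bij_betw_inv_into_right[OF z] by (intro fmap_cong) simp
    finally show ?thesis using s(2) by simp
  qed
  have "?a \<in> A_set ?n"
    unfolding A_set_def
  proof (intro CollectI conjI allI impI notI a)
    fix T assume T: "T \<subset> N ?n" and aT: "?a \<in> fmap F T (N ?n) (\<lambda>v. v) ` FObj F T"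
    obtain r where r: "r \<in> FObj F T" "fmap F T (N ?n) (\<lambda>v. v) r = ?a" by (rule imageE[OF aT]) simp
    have T': "(\<lambda>v. v) \<in> T \<rightarrow> N ?n" using T by auto
    \<comment> \<open>If \<open>T\<close> supported \<open>?a\<close>, its image under
      \<open>?g\<close> would support \<open>u\<close>, with fewer elements than
      \<open>S\<close>.\<close>
    let ?g = "\<lambda>v. z (inv nu v)"
    have fin: "finite T" by (rule finite_subset[of _ "N ?n"]) (use T in \<open>auto simp: N_def\<close>)
    have gX: "?g ` T \<subseteq> X" using inv_nu_funcset[OF zX] T by auto
    have smT: "small (?g ` T)" using fin by (simp add: small_finite)
    have "u = fmap F T X ?g r"
      using ev r fmap_fmap[OF small_finite[OF fin] small_N X T' inv_nu_funcset[OF zX] r(1)] by simp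
    also have "\<dots> = fmap F (?g ` T) X (\<lambda>v. v) (fmap F T (?g ` T) ?g r)"
      by (rule fmap_fmap[OF small_finite[OF fin] smT X _ _ r(1), symmetric]) (use gX in auto)
    finally have "P (?g ` T)"
      unfolding P_def using gX fin fmap_in[OF small_finite[OF fin] smT _ r(1), of ?g] by auto
    then have "card S \<le> card (?g ` T)" by (rule min)
    also have "\<dots> \<le> card T" by (rule card_image_le[OF fin])
    also have "\<dots> < card (N ?n)" by (rule psubset_card_mono[OF _ T]) (simp add: N_def)
    also have "\<dots> = card S" using card_image[OF inj_on_nu, of "{1..?n}"] by (simp add: N_def)
    finally show False by simp
  qed
  then show ?thesis
    using phi_gen[OF X zX, of ?a] ev A.gen_in_hat_set[OF zX, of ?a] by (auto simp: ev_def)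
qed

text \<open>\<open>phi\<close> is natural because \<open>gen\<close> and \<open>ev\<close> both turn
  the action of \<open>f\<close> into composition with \<open>x\<close>.\<close>

lemma ex_iso_hat:
  "\<exists>t\<in>Hom (End small) (hat_func small A) F. is_iso (End small) t"
proof -
  interpret HA: set_endo small A.HA by (rule A.set_endo_hat)
  let ?t = "Arrow (hat_func small A) F (\<lambda>X\<in>Obj (Sets small). mor (hat_set A X) (FObj F X) (phi X))"
  have phi_in: "phi X u \<in> FObj F X" if "small X" "u \<in> hat_set A X" for X u
    using that(2) by (rule A.hat_setE) (use that phi_gen ev_in in auto)
  have "is_nat_trans (Sets small) (Sets small) A.HA F (body ?t)"
  proof (rule set_valued_nat_transI)
    show "set_valued (Sets small) small A.HA" "set_valued (Sets small) small F" by unfold_locales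
    show "body ?t X \<in> Hom (Sets small) (FObj A.HA X) (FObj F X)" if "X \<in> Obj (Sets small)" for X
      using that phi_in A.small_hat_set small_FObj by (auto simp: A.FObj_hat_func intro!: mor_in_Hom)
    fix f X Y u assume f: "f \<in> Hom (Sets small) X Y" and "u \<in> FObj A.HA X"
    have small: "small X" "small Y" using Hom_Sets_small[OF f] by auto
    then have "u \<in> hat_set A X" using \<open>u \<in> FObj A.HA X\<close> by (simp add: A.FObj_hat_func)
    then obtain n x a where x: "x \<in> {1..n} \<rightarrow> X" "a \<in> A_set n" "u = gen A X n x a"
      by (rule A.hat_setE) simp
    have fx: "(\<lambda>i. body f (x i)) \<in> {1..n} \<rightarrow> Y" by (rule body_comp_funcset[OF f x(1)])
    show "body (body ?t Y) (body (FArr A.HA f) u) = body (FArr F f) (body (body ?t X) u)"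
      using x small phi_gen[OF small(1) x(1,2)] phi_gen[OF small(2) fx x(2)] ev_map[OF f x(1,2)]
        A.body_hat_func[OF f x(1)] A.gen_in_hat_set[OF x(1)] A.gen_in_hat_set[OF fx] by simp
  qed simp
  then have t: "?t \<in> Hom (End small) (hat_func small A) F"
    using A.hat_finitary finitary by (simp add: Hom_End_iff)
  have "bij_betw (body (body ?t X)) (FObj A.HA X) (FObj F X)" if X: "small X" for X
  proof -
    have "bij_betw (phi X) (hat_set A X) (FObj F X)"
      using phi_inj[OF X] phi_surj[OF X] phi_in[OF X] by (auto simp: bij_betw_def)
    moreover have "bij_betw (body (body ?t X)) (hat_set A X) (FObj F X) \<longleftrightarrow> bij_betw (phi X) (hat_set A X) (FObj F X)"
      by (rule bij_betw_cong) (simp add: X)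
    ultimately show ?thesis using X by (simp add: A.FObj_hat_func)
  qed
  then show ?thesis using is_iso_EndI[OF t] t by blast
qed

lemma A_in_Obj: "A \<in> Obj (SetS small)"
  by (simp add: surj_functor_iff surj_functor_A)

end


section \<open>The essential image\<close>

lemma ex_inverse_End:
  assumes t: "t \<in> Hom (End small) F G" and iso: "is_iso (End small) t"
  shows "\<exists>s\<in>Hom (End small) G F. is_iso (End small) s \<and>
    (\<forall>X u. small X \<longrightarrow> u \<in> FObj F X \<longrightarrow> body (body s X) (body (body t X) u) = u) \<and>
    (\<forall>X v. small X \<longrightarrow> v \<in> FObj G X \<longrightarrow> body (body t X) (body (body s X) v) = v)"
proof -
  obtain s where s: "s \<in> Hom (End small) G F" and st: "s \<cdot>\<^bsub>End small\<^esub> t = Ide (End small) F"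
    "t \<cdot>\<^bsub>End small\<^esub> s = Ide (End small) G" and iso_s: "is_iso (End small) s"
    using is_iso_EndI[OF t is_iso_End_bij[OF t iso]] by blast
  have "body (body s X) (body (body t X) u) = u" if "small X" "u \<in> FObj F X" for X u
    using body_Comp_End[OF t that, of s] body_Ide_End[of small X u F] that st(1) by simp
  moreover have "body (body t X) (body (body s X) v) = v" if "small X" "v \<in> FObj G X" for X v
    using body_Comp_End[OF s that, of t] body_Ide_End[of small X v G] that st(2) by simp
  ultimately show ?thesis using s iso_s by blast
qed

context set_universe
begin

lemma iso_semi_cartesian:
  "t \<in> Hom (End small) F G \<Longrightarrow> is_iso (End small) t \<Longrightarrow> semi_cartesian small t"
  by (rule semi_cartesian_bij[OF _ is_iso_End_bij])

text \<open>Elements are transported to \<open>F\<close> along the inverse \<open>s\<close>, lifted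
  there and sent back along \<open>t\<close>. Finitarity of \<open>G\<close> is part of being the
  codomain of an arrow of \<open>End\<close>.\<close>

lemma semi_analytic_iso:
  assumes t: "t \<in> Hom (End small) F G" and iso: "is_iso (End small) t" and F: "semi_analytic small F"
  shows "semi_analytic small G"
proof -
  interpret F: set_endo small F by (rule Hom_EndD(1)[OF t])
  interpret G: set_endo small G by (rule Hom_EndD(2)[OF t])
  obtain s where s: "s \<in> Hom (End small) G F"
    and st: "\<And>X u. small X \<Longrightarrow> u \<in> FObj F X \<Longrightarrow> body (body s X) (body (body t X) u) = u"
      "\<And>X v. small X \<Longrightarrow> v \<in> FObj G X \<Longrightarrow> body (body t X) (body (body s X) v) = v"
    using ex_inverse_End[OF t iso] by blast
  have "is_pullback (Sets small) (FArr G p) (FArr G q) (FArr G f) (FArr G m)"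
    if mono: "is_mono (Sets small) m" and pb: "is_pullback (Sets small) p q f m" for p q f m
  proof -
    from pb obtain W X Y Z where H: "p \<in> Hom (Sets small) W X" "q \<in> Hom (Sets small) W Y"
      "f \<in> Hom (Sets small) X Z" "m \<in> Hom (Sets small) Y Z"
      and comm: "f \<cdot>\<^bsub>Sets small\<^esub> p = m \<cdot>\<^bsub>Sets small\<^esub> q"
      unfolding is_pullback_def by blast
    have small: "small W" "small X" "small Y" "small Z" using Hom_Sets_small H by blast+
    have "is_pullback (Sets small) (FArr F p) (FArr F q) (FArr F f) (FArr F m)"
      using F mono pb by (simp add: semi_analytic_def preserves_pullbacks_along_monos_def)
    then obtain W' X' Y' Z' where H': "FArr F p \<in> Hom (Sets small) W' X'" "FArr F q \<in> Hom (Sets small) W' Y'"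
      and univ: "\<And>x y. x \<in> X' \<Longrightarrow> y \<in> Y' \<Longrightarrow> body (FArr F f) x = body (FArr F m) y \<Longrightarrow>
        \<exists>!w. w \<in> W' \<and> body (FArr F p) w = x \<and> body (FArr F q) w = y"
      by (rule is_pullback_SetsD) blast
    have eq: "W' = FObj F W" "X' = FObj F X" "Y' = FObj F Y"
      using H' F.FArr_in_Hom[OF H(1)] F.FArr_in_Hom[OF H(2)] by (auto simp: Hom_Sets_iff)
    have commF: "body (FArr F f) (body (FArr F p) w) = body (FArr F m) (body (FArr F q) w)" if "w \<in> FObj F W" for w
      using F.body_Comp[OF H(1,3) that] F.body_Comp[OF H(2,4) that] comm by simp
    show ?thesis
    proof (rule is_pullback_SetsI[OF G.FArr_in_Hom[OF H(1)] G.FArr_in_Hom[OF H(2)] G.FArr_in_Hom[OF H(3)]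
          G.FArr_in_Hom[OF H(4)]])
      fix w assume "w \<in> FObj G W"
      then show "body (FArr G f) (body (FArr G p) w) = body (FArr G m) (body (FArr G q) w)"
        using G.body_Comp[OF H(1,3)] G.body_Comp[OF H(2,4)] comm by simp
    next
      fix u v assume u: "u \<in> FObj G X" and v: "v \<in> FObj G Y" and eq': "body (FArr G f) u = body (FArr G m) v"
      let ?u = "body (body s X) u" and ?v = "body (body s Y) v"
      have uv: "?u \<in> FObj F X" "?v \<in> FObj F Y" using Hom_EndD(4)[OF s] u v small by blast+
      have "body (FArr F f) ?u = body (FArr F m) ?v"
        using Hom_EndD(5)[OF s H(3) u] Hom_EndD(5)[OF s H(4) v] eq' by simp
      then obtain w where w: "w \<in> FObj F W" "body (FArr F p) w = ?u" "body (FArr F q) w = ?v"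
        using univ[of ?u ?v] uv eq by blast
      have "body (FArr G p) (body (body t W) w) = u" "body (FArr G q) (body (body t W) w) = v"
        using Hom_EndD(5)[OF t H(1) w(1)] Hom_EndD(5)[OF t H(2) w(1)] w st(2) small u v by simp_all
      then show "\<exists>w\<in>FObj G W. body (FArr G p) w = u \<and> body (FArr G q) w = v"
        using Hom_EndD(4)[OF t small(1) w(1)] by blast
    next
      fix w w' assume w: "w \<in> FObj G W" "w' \<in> FObj G W"
        and p: "body (FArr G p) w = body (FArr G p) w'" and q: "body (FArr G q) w = body (FArr G q) w'"
      let ?w = "body (body s W) w" and ?w' = "body (body s W) w'"
      have sw: "?w \<in> FObj F W" "?w' \<in> FObj F W" using Hom_EndD(4)[OF s small(1)] w by blast+
      have "body (FArr F p) ?w = body (FArr F p) ?w'" "body (FArr F q) ?w = body (FArr F q) ?w'"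
        using Hom_EndD(5)[OF s H(1) w(1)] Hom_EndD(5)[OF s H(1) w(2)]
          Hom_EndD(5)[OF s H(2) w(1)] Hom_EndD(5)[OF s H(2) w(2)] p q by simp_all
      then have "?w = ?w'"
        using univ[of "body (FArr F p) ?w'" "body (FArr F q) ?w'"] sw commF
          F.body_in[OF H(1)] F.body_in[OF H(2)] unfolding eq by blast
      then show "w = w'" using st(2)[OF small(1)] w by metis
    qed
  qed
  then show ?thesis
    using t G.is_functor_axioms
    by (simp add: semi_analytic_def preserves_pullbacks_along_monos_def Hom_End_iff)
qed

lemma category_San: "category (San small)"
  unfolding San_def
proof (rule category_restrict[OF category_End])
  let ?R = "{t \<in> Arr (End small).
      semi_analytic small (src t) \<and> semi_analytic small (tgt t) \<and> semi_cartesian small t}"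
  interpret E: category "End small" by (rule category_End)
  fix F assume "F \<in> {F \<in> Obj (End small). semi_analytic small F}"
  then have F: "F \<in> Obj (End small)" "semi_analytic small F" by auto
  have id: "Ide (End small) F \<in> Hom (End small) F F" by (rule E.Ide_in_Hom[OF F(1)])
  \<comment> \<open>The identity is its own inverse, so it is semi-cartesian as an
    isomorphism.\<close>
  then have "is_iso (End small) (Ide (End small) F)"
    using E.Comp_Ide[OF id] unfolding is_iso_def by (auto simp: Hom_iff)
  then show "Ide (End small) F \<in> ?R"
    using iso_semi_cartesian[OF id] id F by (auto simp: Hom_iff End_sel)
next
  let ?R = "{t \<in> Arr (End small).
      semi_analytic small (src t) \<and> semi_analytic small (tgt t) \<and> semi_cartesian small t}"
  fix s t
  assume s: "s \<in> ?R" and t: "t \<in> ?R" and eq: "Cod (End small) s = Dom (End small) t"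
  have H: "s \<in> Hom (End small) (src s) (tgt s)" "t \<in> Hom (End small) (tgt s) (tgt t)"
    using s t eq by (auto simp: Hom_iff End_sel(3,4))
  then show "t \<cdot>\<^bsub>End small\<^esub> s \<in> ?R"
    using semi_cartesian_Comp[OF H(1) _ H(2)] Comp_End_in_Hom[OF H] s t
    by (auto simp: Hom_iff End_sel(3,4))
qed (auto simp: End_sel is_nat_trans_def)

lemma ex_iso_hat_func:
  assumes F: "F \<in> Obj (End small)" "semi_analytic small F"
  shows "\<exists>A\<in>Obj (SetS small). \<exists>t\<in>Hom (End small) (hat_func small A) F. is_iso (End small) t"
proof -
  interpret semi_analytic_functor small F
    using F set_universe_axioms
    by (auto simp: semi_analytic_functor_def semi_analytic_functor_axioms_def set_endo_def set_valued_def semi_analytic_def)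
  show ?thesis using A_in_Obj ex_iso_hat by blast
qed

lemma hat_func_semi_analytic: "A \<in> Obj (SetS small) \<Longrightarrow> semi_analytic small (hat_func small A)"
  by (simp add: surj_functor_iff surj_functor.hat_semi_analytic)

lemma semi_analytic_iff_hat:
  assumes "F \<in> Obj (End small)"
  shows "semi_analytic small F \<longleftrightarrow>
    (\<exists>A\<in>Obj (SetS small). \<exists>i\<in>Hom (End small) (FObj (hat small) A) F. is_iso (End small) i)"
  using ex_iso_hat_func[OF assms] semi_analytic_iso[OF _ _ hat_func_semi_analytic] by (metis FObj_hat)

text \<open>From left to right, \<open>g\<close> is conjugated by isomorphisms between its ends and
  associated functors; the conjugate is still semi-cartesian, hence induced. From right to left, all
  three factors are semi-cartesian, and semi-analyticity passes along isomorphisms.\<close>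

lemma semi_cartesian_iff_hat:
  assumes g: "g \<in> Arr (End small)"
  shows "semi_analytic small (src g) \<and> semi_analytic small (tgt g) \<and> semi_cartesian small g \<longleftrightarrow>
    (\<exists>A\<in>Obj (SetS small). \<exists>B\<in>Obj (SetS small). \<exists>f\<in>Hom (SetS small) A B.
      \<exists>i\<in>Hom (End small) (src g) (FObj (hat small) A). \<exists>j\<in>Hom (End small) (FObj (hat small) B) (tgt g).
        is_iso (End small) i \<and> is_iso (End small) j \<and>
        g = j \<cdot>\<^bsub>End small\<^esub> FArr (hat small) f \<cdot>\<^bsub>End small\<^esub> i)" (is "?L \<longleftrightarrow> ?R")
proof
  have gH: "g \<in> Hom (End small) (src g) (tgt g)" using g by (simp add: Hom_iff End_sel(3,4))
  have Obj: "src g \<in> Obj (End small)" "tgt g \<in> Obj (End small)"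
    using g by (auto simp: End_sel is_nat_trans_def)
  show ?R if L: ?L
  proof -
    obtain A i' where A: "A \<in> Obj (SetS small)" and i': "i' \<in> Hom (End small) (hat_func small A) (src g)"
      "is_iso (End small) i'" using ex_iso_hat_func[OF Obj(1)] L by blast
    obtain B j where B: "B \<in> Obj (SetS small)" and j: "j \<in> Hom (End small) (hat_func small B) (tgt g)"
      "is_iso (End small) j" using ex_iso_hat_func[OF Obj(2)] L by blast
    obtain i where i: "i \<in> Hom (End small) (src g) (hat_func small A)" "is_iso (End small) i"
      and i'i: "\<And>X v. small X \<Longrightarrow> v \<in> FObj (src g) X \<Longrightarrow> body (body i' X) (body (body i X) v) = v"
      using ex_inverse_End[OF i'] by blast
    obtain j' where j': "j' \<in> Hom (End small) (tgt g) (hat_func small B)" "is_iso (End small) j'"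
      and jj': "\<And>X v. small X \<Longrightarrow> v \<in> FObj (tgt g) X \<Longrightarrow> body (body j X) (body (body j' X) v) = v"
      using ex_inverse_End[OF j] by blast
    let ?h = "j' \<cdot>\<^bsub>End small\<^esub> g \<cdot>\<^bsub>End small\<^esub> i'"
    have gi': "g \<cdot>\<^bsub>End small\<^esub> i' \<in> Hom (End small) (hat_func small A) (tgt g)"
      by (rule Comp_End_in_Hom[OF i'(1) gH])
    have h: "?h \<in> Hom (End small) (hat_func small A) (hat_func small B)"
      by (rule Comp_End_in_Hom[OF gi' j'(1)])
    have "semi_cartesian small ?h"
      using L by (intro semi_cartesian_Comp[OF gi' _ j'(1)] semi_cartesian_Comp[OF i'(1) _ gH]
          iso_semi_cartesian[OF i'] iso_semi_cartesian[OF j']) simp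
    then obtain f where f: "f \<in> Hom (SetS small) A B" "hat_trans small f = ?h"
      using semi_cartesian_is_hat_trans[OF A B h] by blast
    have hi: "?h \<cdot>\<^bsub>End small\<^esub> i \<in> Hom (End small) (src g) (hat_func small B)" by (rule Comp_End_in_Hom[OF i(1) h])
    \<comment> \<open>The isomorphisms inserted by the conjugation cancel on elements, by
      \<open>i'i\<close> and \<open>jj'\<close>.\<close>
    have "g = j \<cdot>\<^bsub>End small\<^esub> ?h \<cdot>\<^bsub>End small\<^esub> i"
    proof (rule Hom_End_eqI[OF gH Comp_End_in_Hom[OF hi j(1)]])
      fix X u assume X: "small X" and u: "u \<in> FObj (src g) X"
      have iu: "body (body i X) u \<in> FObj (hat_func small A) X" by (rule Hom_EndD(4)[OF i(1) X u])
      have gu: "body (body g X) u \<in> FObj (tgt g) X" by (rule Hom_EndD(4)[OF gH X u])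
      show "body (body g X) u = body (body (j \<cdot>\<^bsub>End small\<^esub> ?h \<cdot>\<^bsub>End small\<^esub> i) X) u"
        using body_Comp_End[OF hi X u, of j] body_Comp_End[OF i(1) X u, of ?h]
          body_Comp_End[OF gi' X iu, of j'] body_Comp_End[OF i'(1) X iu, of g] i'i[OF X u] jj'[OF X gu] by simp
    qed
    then show ?R using A B f i j FArr_hat[OF f(1)] FObj_hat by metis
  qed
  show ?L if ?R
  proof -
    from that obtain A B f i j where A: "A \<in> Obj (SetS small)" and B: "B \<in> Obj (SetS small)"
      and f: "f \<in> Hom (SetS small) A B" and i: "i \<in> Hom (End small) (src g) (hat_func small A)" "is_iso (End small) i"
      and j: "j \<in> Hom (End small) (hat_func small B) (tgt g)" "is_iso (End small) j"
      and eq: "g = j \<cdot>\<^bsub>End small\<^esub> hat_trans small f \<cdot>\<^bsub>End small\<^esub> i"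
      by (metis FObj_hat FArr_hat)
    obtain i' where i': "i' \<in> Hom (End small) (hat_func small A) (src g)" "is_iso (End small) i'"
      using ex_inverse_End[OF i] by blast
    note hf = hat_trans_in_Hom[OF f]
    have "semi_cartesian small g"
      unfolding eq
      by (rule semi_cartesian_Comp[OF Comp_End_in_Hom[OF i(1) hf(1)] semi_cartesian_Comp[OF i(1) _ hf] j(1)])
        (rule iso_semi_cartesian[OF i] iso_semi_cartesian[OF j])+
    then show ?L
      using semi_analytic_iso[OF i' hat_func_semi_analytic[OF A]] semi_analytic_iso[OF j hat_func_semi_analytic[OF B]]
      by blast
  qed
qed

text \<open>Both sides are \<open>End\<close> with new \<open>Obj\<close> and \<open>Arr\<close>, so
  equality of the records reduces to equality of these two sets.\<close>

lemma essential_image_hat: "essential_image (SetS small) (End small) (hat small) = San small"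
  unfolding essential_image_def San_def End_sel(3,4)
  using semi_analytic_iff_hat semi_cartesian_iff_hat
  by (intro arg_cong2[where f = "\<lambda>Ob R. End small\<lparr>Obj := Ob, Arr := R\<rparr>"] Collect_cong) blast+

end

text \<open>\<open>hat\<close> and \<open>San\<close> are bare records; functoriality of the one and
  the category laws of the other are presupposed by the remaining assertions and are therefore
  stated alongside them.\<close>

theorem theorem2p2:
  fixes small :: "'u set \<Rightarrow> bool"
  assumes "set_universe small"
  shows "is_functor (SetS small) (End small) (hat small) \<and>
         faithful (SetS small) (hat small) \<and>
         full_on_isos (SetS small) (End small) (hat small) \<and>
         category (San small) \<and>
         essential_image (SetS small) (End small) (hat small) = San small"
proof -
  interpret set_universe small by fact
  show ?thesis
    using is_functor_hat faithful_hat full_on_isos_hat category_San essential_image_hat by blast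
qed

end
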